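(* Let $K\subset\mathbb{C}$ be non-polar, compact and polynomially convex, and let $(q_k)_{k\in\mathbb{N}}$ be a sequence of complex polynomials with degrees $n_k=\deg q_k\to\infty$. If $(q_k)_{k\in\mathbb{N}}$ is $K$-regular and centers on $K$, then for every $m=0,1,\ldots$ $$\omega_{K(q_k^{(m)})}\to\omega_K\quad\text{weak* as } k\to\infty,$$ where $q_k^{(m)}$ denotes the $m$th derivative of $q_k$ and $K(q_k^{(m)})$ its filled-in Julia set.
   Context: $\mathbb{D}(R)=\{z\in\mathbb{C}:|z|<R\}$. For a polynomial $q$ of degree at least $2$, the filled-in Julia set is $K(q)=\{z\in\mathbb{C}: (q^j(z))_j \text{ is bounded}\}$, where $q^j$ is the $j$th iterate of $q$. Polynomially convex (full) for a compact $K\subset\mathbb{C}$ means that $\Omega:=\mathbb{C}\setminus K$ is connected. For a non-polar compact set $C\subset\mathbb{C}$, $\omega_C$ is the equilibrium measure of $C$, i.e. the unique Borel probability measure on $C$ maximizing the energy $I(\mu)=\iint\log|z-w|\,d\mu(w)\,d\mu(z)$. The Green's function of $\Omega$ with pole at $\infty$ is $g_\Omega(z)=\int\log|z-w|\,d\omega_K(w)-I(\omega_K)$. Weak* convergence $\mu_k\to\mu$ of probability measures means $\int f\,d\mu_k\to\int f\,d\mu$ for every compactly supported continuous $f$ on $\mathbb{C}$. All sequences of polynomials considered have degrees tending to infinity, so finitely many terms of degree too small for the expressions to make sense are disregarded. Centering: a sequence $(q_k)_k$ of polynomials centers on a non-empty compact set $C\subset\mathbb{C}$ if there exist $N\in\mathbb{N}$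 and $R>0$ such that (1) $q_k^{-1}(\{0\})\subset\mathbb{D}(R)$ for all $k\ge N$; and (2) for every closed set $L\subset\mathbb{C}$ with $L\cap C=\emptyset$ there exists $M=M(L)>0$ such that for all $k\ge N$ the number of zeros of $q_k$ in $L$, counted with multiplicity, is at most $M$. $K$-regularity: a sequence $(q_k)_k$ of polynomials of degrees $n_k$ is $K$-regular if for some $R>0$ (taken large enough that $K\subset\mathbb{D}(R)$) one has $\lim_{k\to\infty}\frac{1}{n_k}\log|q_k(z)|=g_\Omega(z)$ uniformly on $\mathbb{C}\setminus\mathbb{D}(R)$. *)

theory Defs
  imports "HOL-Probability.Probability_Measure" "HOL-Computational_Algebra.Polynomial"
begin

(* Lebesgue integral with values in [-\<infinity>, \<infinity>]. The Bochner integral is not suitable for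
   logarithmic energies, since it returns 0 on non-integrable functions. It is only
   used below for functions that are bounded above with respect to a finite measure,
   so the first integral is finite and the difference is well defined. *)
definition ext_integral :: "'a measure \<Rightarrow> ('a \<Rightarrow> ereal) \<Rightarrow> ereal" where
  "ext_integral \<mu> f =
     enn2ereal (\<integral>\<^sup>+ x. e2ennreal (f x) \<partial>\<mu>) - enn2ereal (\<integral>\<^sup>+ x. e2ennreal (- f x) \<partial>\<mu>)"

(* Needed because ln 0 = 0 on the reals. *)
definition log_dist :: "complex \<Rightarrow> complex \<Rightarrow> ereal" where
  "log_dist z w = (if z = w then - \<infinity> else ereal (ln (cmod (z - w))))"

definition log_potential :: "complex measure \<Rightarrow> complex \<Rightarrow> ereal" where
  "log_potential \<mu> z = ext_integral \<mu> (\<lambda>w. log_dist z w)"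

definition log_energy :: "complex measure \<Rightarrow> ereal" where
  "log_energy \<mu> = ext_integral \<mu> (log_potential \<mu>)"

definition borel_prob_on :: "complex set \<Rightarrow> complex measure \<Rightarrow> bool" where
  "borel_prob_on C \<mu> \<longleftrightarrow> sets \<mu> = sets borel \<and> prob_space \<mu> \<and> measure \<mu> C = 1"

(* Finite non-zero measures are normalised to probability measures, which only scales
   the energy by a positive factor. *)
definition polar :: "complex set \<Rightarrow> bool" where
  "polar E \<longleftrightarrow>
     (\<forall>C \<mu>. compact C \<and> C \<subseteq> E \<and> borel_prob_on C \<mu> \<longrightarrow> log_energy \<mu> = - \<infinity>)"

(* Meaningful for non-polar compact C. *)
definition equilibrium_measure :: "complex set \<Rightarrow> complex measure" where
  "equilibrium_measure C =
     (THE \<mu>. borel_prob_on C \<mu> \<and> (\<forall>\<nu>. borel_prob_on C \<nu> \<longrightarrow> log_energy \<nu> \<le> log_energy \<mu>))"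

(* The Green's function, with pole at infinity, of the complement of K, for non-polar
   compact K. Off K the extended real below is finite, so passing to the reals loses
   nothing. *)
definition green :: "complex set \<Rightarrow> complex \<Rightarrow> real" where
  "green K z = real_of_ereal
     (log_potential (equilibrium_measure K) z - log_energy (equilibrium_measure K))"

definition polynomially_convex :: "complex set \<Rightarrow> bool" where
  "polynomially_convex K \<longleftrightarrow> compact K \<and> connected (- K)"

definition filled_julia :: "complex poly \<Rightarrow> complex set" where
  "filled_julia q = {z. bounded (range (\<lambda>j. (poly q ^^ j) z))}"

definition centers_on :: "(nat \<Rightarrow> complex poly) \<Rightarrow> complex set \<Rightarrow> bool" where
  "centers_on q C \<longleftrightarrow>
     compact C \<and> C \<noteq> {} \<and>
     (\<exists>N R. R > 0 \<and>
        (\<forall>k\<ge>N. {z. poly (q k) z = 0} \<subseteq> ball 0 R) \<and>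
        (\<forall>L. closed L \<and> L \<inter> C = {} \<longrightarrow>
           (\<exists>M>0. \<forall>k\<ge>N. size {#z \<in># proots (q k). z \<in> L#} \<le> M)))"

(* The convention ln 0 = 0 does not enlarge the class of K-regular sequences: near a zero
   of a non-constant q k the logarithm tends to -\<infinity>, also from within the complement of
   the disc, so uniform convergence to the locally bounded Green's function already
   excludes such zeros for large k. *)
definition K_regular :: "complex set \<Rightarrow> (nat \<Rightarrow> complex poly) \<Rightarrow> bool" where
  "K_regular K q \<longleftrightarrow>
     (\<exists>R>0. K \<subseteq> ball 0 R \<and>
        uniform_limit (- ball 0 R)
          (\<lambda>k z. ln (cmod (poly (q k) z)) / real (degree (q k)))
          (green K) sequentially)"

(* Complex-valued test functions include the real-valued ones. *)
definition weak_star_conv :: "(nat \<Rightarrow> complex measure) \<Rightarrow> complex measure \<Rightarrow> bool" where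
  "weak_star_conv \<mu> \<nu> \<longleftrightarrow>
     (\<forall>f :: complex \<Rightarrow> complex.
        continuous_on UNIV f \<and> compact (closure {z. f z \<noteq> 0}) \<longrightarrow>
        (\<lambda>k. integral\<^sup>L (\<mu> k) f) \<longlonglongrightarrow> integral\<^sup>L \<nu> f)"

end

theory Submission
  imports Defs "HOL-Probability.Probability" "HOL-Complex_Analysis.Complex_Analysis"
    "HOL-Computational_Algebra.Fundamental_Theorem_Algebra" "HOL-Real_Asymp.Real_Asymp"
begin

text \<open>Write \<open>\<omega>\<close> for the equilibrium measure of \<open>K\<close>, \<open>I\<close> for its energy and \<open>g = U\<^sup>\<omega> - I\<close> for the Green's
  function. Centering forces every weak limit of the normalised zero measures of \<open>q k\<close> to live on \<open>K\<close>,
  and regularity together with the identity theorem identifies its potential with \<open>U\<^sup>\<omega>\<close> off \<open>K\<close>. Hence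
  \<open>ln |q k| / n k\<close> tends to \<open>g\<close> off \<open>K\<close>, in a sense that tolerates zeros and that passes to derivatives,
  because \<open>g\<close> is not constant on any disc.

  Let \<open>p\<close> be an \<open>m\<close>-th derivative of large degree \<open>n\<close>. Its filled Julia set lies in the lemniscate
  \<open>|p| \<le> c\<close> for a fixed escape radius \<open>c\<close>, whose equilibrium measure \<open>\<kappa>\<close> has the explicit potential
  \<open>(ln (max c |p|) - ln |a|) / n\<close>, with \<open>a\<close> the leading coefficient of \<open>p\<close>. The energies of \<open>\<kappa>\<close> and of
  the equilibrium measure of the Julia set both tend to \<open>I\<close>, so by positive definiteness of the
  logarithmic energy the two measures have the same weak limits \<open>\<sigma>\<close>. The energy of \<open>\<sigma>\<close> is at least \<open>I\<close>.
  A Jensen-type estimate for the explicit potential shows that \<open>\<sigma>\<close> does not charge \<open>{g > 0}\<close>, whence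
  \<open>\<integral> U\<^sup>\<omega> d\<sigma> \<le> I\<close>: off \<open>K\<close> because \<open>g \<le> 0\<close> there, and on \<open>K\<close> because \<open>\<omega>\<close> maximises the energy.
  Positive definiteness then gives \<open>\<sigma> = \<omega>\<close>.\<close>

subsection \<open>Weak compactness\<close>

text \<open>The equilibrium measure of a filled Julia set has no usable formula, and the set may
  have pieces near zeros of \<open>p\<close> far from \<open>K\<close>, so its limits are not
  confined to \<open>K\<close> by any support argument. The detour through the lemniscate replaces
  it by a measure whose potential is read off from \<open>|p|\<close>. The two are comparable
  because of two capacity formulas: energy \<open>(ln c - ln |a|) / n\<close> for the lemniscate and
  \<open>- ln |a| / (n - 1)\<close> for the Julia set. With \<open>c\<close> fixed and
  \<open>ln |a| / n\<close> tending to \<open>- I\<close>, both tend to \<open>I\<close>, and the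
  Julia set lies where the lemniscate potential is constant.

  Two obstacles shape the tools. Potentials are not weakly continuous and energies may be infinite,
  so the kernel is \<open>ln (D / |z - w|)\<close> with values in \<open>ennreal\<close>, identities
  are arranged without subtraction, and limits are taken through potentials truncated at a small
  distance. The potential of \<open>\<omega>\<close> need not equal \<open>I\<close> at every point
  of \<open>K\<close>, so on \<open>K\<close> it is controlled only on average, by the first
  variation of the energy.

  Weak compactness on a disc is reduced to Helly's theorem on the line by a continuous curve that
  covers the disc.\<close>

definition zigzag :: "real \<Rightarrow> real" where
  "zigzag t = max 0 (min 1 (1/2 - cos (pi * t)))"

lemma zigzag_bounds: "0 \<le> zigzag t" "zigzag t \<le> 1"
  by (auto simp: zigzag_def)

lemma zigzag_plus_even: "zigzag (t + 2 * real_of_int m) = zigzag t"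
proof -
  have "cos (pi * (t + 2 * real_of_int m)) = cos (pi * t + 2 * pi * real_of_int m)"
    by (simp add: algebra_simps)
  also have "\<dots> = cos (pi * t)"
    by (simp add: cos_add cos_int_2pin sin_int_2pin)
  finally show ?thesis by (simp add: zigzag_def)
qed

text \<open>Schoenberg's curve asks for a continuous function of period 2 that is 0 on [0, 1/3] and
  1 on [2/3, 1]. Clipping \<open>1/2 - cos (pi * t)\<close> gives one that inherits continuity and
  period from the cosine.\<close>

lemma zigzag_low: "0 \<le> t \<Longrightarrow> t \<le> 1/3 \<Longrightarrow> zigzag t = 0"
proof -
  assume t: "0 \<le> t" "t \<le> 1/3"
  have "cos (pi/3) \<le> cos (pi * t)"
    by (rule cos_monotone_0_pi_le) (use t in \<open>auto simp: field_simps\<close>)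
  then show ?thesis by (simp add: cos_60 zigzag_def)
qed

lemma zigzag_high: "2/3 \<le> t \<Longrightarrow> t \<le> 1 \<Longrightarrow> zigzag t = 1"
proof -
  assume t: "2/3 \<le> t" "t \<le> 1"
  have "cos (pi * t) \<le> cos (pi * (2/3))"
    by (rule cos_monotone_0_pi_le) (use t in \<open>auto simp: field_simps\<close>)
  also have "cos (pi * (2/3)) = - cos (pi/3)"
    using cos_pi_minus[of "pi/3"] by (simp add: field_simps)
  finally show ?thesis by (simp add: cos_60 zigzag_def)
qed

text \<open>The two coordinates of Schoenberg's space-filling curve.\<close>

definition schoenberg :: "nat \<Rightarrow> real \<Rightarrow> real" where
  "schoenberg i t = (\<Sum>n. (1/2) ^ Suc n * zigzag (3 ^ (2 * n + i) * t))"

lemma schoenberg_summable: "summable (\<lambda>n. (1/2) ^ Suc n * zigzag (3 ^ (2 * n + i) * t))"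
proof (rule summable_comparison_test')
  show "summable (\<lambda>n. (1/2::real) ^ Suc n)"
    using power_half_series by (rule sums_summable)
  fix n
  have "(1/2) ^ Suc n * zigzag (3 ^ (2 * n + i) * t) \<le> (1/2) ^ Suc n * 1"
    by (intro mult_left_mono zigzag_bounds) auto
  then show "norm ((1/2) ^ Suc n * zigzag (3 ^ (2 * n + i) * t)) \<le> (1/2) ^ Suc n"
    using zigzag_bounds by (simp add: abs_mult)
qed

lemma schoenberg_bounds: "0 \<le> schoenberg i t" "schoenberg i t \<le> 1"
proof -
  show "0 \<le> schoenberg i t"
    unfolding schoenberg_def by (intro suminf_nonneg schoenberg_summable mult_nonneg_nonneg zigzag_bounds) auto
  have "schoenberg i t \<le> (\<Sum>n. (1/2::real) ^ Suc n)"
    unfolding schoenberg_def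
  proof (intro suminf_le schoenberg_summable sums_summable[OF power_half_series])
    fix n
    have "(1/2) ^ Suc n * zigzag (3 ^ (2 * n + i) * t) \<le> (1/2) ^ Suc n * 1"
      by (intro mult_left_mono zigzag_bounds) auto
    then show "(1/2) ^ Suc n * zigzag (3 ^ (2 * n + i) * t) \<le> (1/2) ^ Suc n" by simp
  qed
  then show "schoenberg i t \<le> 1" using power_half_series by (simp add: sums_iff)
qed

lemma continuous_on_schoenberg: "continuous_on UNIV (schoenberg i)"
proof -
  have "uniform_limit UNIV (\<lambda>N t. \<Sum>n<N. (1/2) ^ Suc n * zigzag (3 ^ (2 * n + i) * t)) (schoenberg i) sequentially"
    unfolding schoenberg_def
  proof (rule Weierstrass_m_test)
    show "summable (\<lambda>n. (1/2::real) ^ Suc n)"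
      using power_half_series by (rule sums_summable)
    fix n t
    have "(1/2) ^ Suc n * zigzag (3 ^ (2 * n + i) * t) \<le> (1/2) ^ Suc n * 1"
      by (intro mult_left_mono zigzag_bounds) auto
    then show "norm ((1/2) ^ Suc n * zigzag (3 ^ (2 * n + i) * t)) \<le> (1/2) ^ Suc n"
      using zigzag_bounds by (simp add: abs_mult)
  qed
  moreover have "continuous_on UNIV (\<lambda>t. \<Sum>n<N. (1/2) ^ Suc n * zigzag (3 ^ (2 * n + i) * t))" for N
    unfolding zigzag_def by (intro continuous_intros)
  ultimately show ?thesis
    by (intro uniform_limit_theorem[OF _ _ ]) auto
qed

lemma binary_expansion:
  fixes x :: real
  assumes "0 \<le> x" "x \<le> 1"
  obtains a :: "nat \<Rightarrow> nat" where "\<And>n. a n \<le> 1" "(\<lambda>n. (1/2) ^ Suc n * real (a n)) sums x"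
proof -
  \<comment> \<open>\<open>y n\<close> is the remainder after \<open>n\<close> binary digits,
    rescaled to [0, 1]. The digit 1 is taken already at 1/2, and x = 1 receives the expansion with
    all digits 1.\<close>
  define y where "y = rec_nat x (\<lambda>_ u. 2 * u - (if u \<ge> 1/2 then 1 else 0))"
  define a where "a n = (if y n \<ge> 1/2 then 1 else (0::nat))" for n
  have y0: "y 0 = x" and ySuc: "y (Suc n) = 2 * y n - real (a n)" for n
    by (auto simp: y_def a_def)
  have yb: "0 \<le> y n \<and> y n \<le> 1" for n
    by (induction n) (use assms in \<open>auto simp: y0 ySuc a_def\<close>)
  have part: "(\<Sum>k<n. (1/2) ^ Suc k * real (a k)) = x - (1/2)^n * y n" for n
    by (induction n) (auto simp: y0 ySuc field_simps)
  have "(\<lambda>n. (1/2)^n * y n) \<longlonglongrightarrow> 0"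
  proof (rule tendsto_sandwich[OF _ _ tendsto_const])
    show "(\<lambda>n. (1/2::real)^n) \<longlonglongrightarrow> 0" by (rule LIMSEQ_power_zero) auto
    show "\<forall>\<^sub>F n in sequentially. (1/2)^n * y n \<le> (1/2)^n"
      using yb by (intro always_eventually allI) (simp add: mult_left_le)
  qed (use yb in auto)
  then have "(\<lambda>n. x - (1/2)^n * y n) \<longlonglongrightarrow> x - 0" by (intro tendsto_intros)
  then have "(\<lambda>n. (1/2) ^ Suc n * real (a n)) sums x"
    unfolding sums_def part by simp
  with that[of a] show thesis by (auto simp: a_def)
qed

text \<open>The binary digits of \<open>x\<close> and \<open>y\<close> are interlaced and, doubled,
  become the ternary digits of the parameter. Multiplication by \<open>3 ^ k\<close> brings digit
  \<open>k\<close> to the front; being 0 or 2, it puts the tail \<open>T k\<close> into [0, 1/3] or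
  [2/3, 1], where \<open>zigzag\<close> returns the original binary digit.\<close>

lemma schoenberg_surj:
  assumes "0 \<le> x" "x \<le> 1" "0 \<le> y" "y \<le> 1"
  shows "\<exists>t\<in>{0..1}. schoenberg 0 t = x \<and> schoenberg 1 t = y"
proof -
  obtain a where a: "\<And>n. a n \<le> 1" "(\<lambda>n. (1/2) ^ Suc n * real (a n)) sums x"
    using binary_expansion assms by blast
  obtain b where b: "\<And>n. b n \<le> 1" "(\<lambda>n. (1/2) ^ Suc n * real (b n)) sums y"
    using binary_expansion assms by blast
  define c where "c k = (if even k then a (k div 2) else b (k div 2))" for k
  have c1: "c k \<le> 1" for k using a(1) b(1) by (auto simp: c_def)
  define T where "T k = (\<Sum>j. 2 * real (c (j + k)) * (1/3) ^ Suc j)" for k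
  have geo: "(\<lambda>j. 2 * (1/3::real) ^ Suc j) sums 1"
    using sums_mult[OF geometric_sums[of "1/3::real"], of "2/3"] by simp
  have trm: "0 \<le> 2 * real (c (j + k)) * (1/3) ^ Suc j" "2 * real (c (j + k)) * (1/3) ^ Suc j \<le> 2 * (1/3) ^ Suc j" for j k
    using c1[of "j+k"] by auto
  have summ: "summable (\<lambda>j. 2 * real (c (j + k)) * (1/3) ^ Suc j)" for k
    by (rule summable_comparison_test'[OF sums_summable[OF geo]]) (use trm in \<open>auto simp: abs_mult\<close>)
  have Tb: "0 \<le> T k" "T k \<le> 1" for k
  proof -
    show "0 \<le> T k" unfolding T_def by (intro suminf_nonneg summ trm)
    have "T k \<le> (\<Sum>j. 2 * (1/3) ^ Suc j)" unfolding T_def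
      by (intro suminf_le summ trm sums_summable[OF geo])
    then show "T k \<le> 1" using geo by (simp add: sums_iff)
  qed
  have Trec: "3 * T k = 2 * real (c k) + T (Suc k)" for k
  proof -
    have "T k = 2 * real (c k) * (1/3) + (\<Sum>j. 2 * real (c (Suc j + k)) * (1/3) ^ Suc (Suc j))"
      unfolding T_def using suminf_split_head[OF summ[of k]] by simp
    also have "(\<Sum>j. 2 * real (c (Suc j + k)) * (1/3) ^ Suc (Suc j)) = (1/3) * T (Suc k)"
      unfolding T_def by (subst suminf_mult[OF summ, symmetric]) (simp add: algebra_simps)
    finally show ?thesis by simp
  qed
  \<comment> \<open>All ternary digits are even, so the integer part split off from
    \<open>3 ^ k * T 0\<close> is even and is invisible to a function of period 2.\<close>
  have "\<exists>m::int. 3 ^ k * T 0 = T k + 2 * real_of_int m" for k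
  proof (induction k)
    case 0 show ?case by (intro exI[of _ 0]) simp
  next
    case (Suc k)
    then obtain m where m: "3 ^ k * T 0 = T k + 2 * real_of_int m" by blast
    have "3 ^ Suc k * T 0 = 3 * T k + 6 * real_of_int m" using m by simp
    also have "\<dots> = T (Suc k) + 2 * real_of_int (int (c k) + 3 * m)" by (simp add: Trec)
    finally show ?case by blast
  qed
  then have zz: "zigzag (3 ^ k * T 0) = zigzag (T k)" for k
    by (metis zigzag_plus_even)
  have zc: "zigzag (3 ^ k * T 0) = real (c k)" for k
  proof (cases "c k = 0")
    case True
    then show ?thesis unfolding zz using Trec[of k] Tb[of "Suc k"] Tb[of k] by (subst zigzag_low) auto
  next
    case False
    then have "c k = 1" using c1[of k] by linarith
    then show ?thesis unfolding zz using Trec[of k] Tb[of "Suc k"] Tb[of k] by (subst zigzag_high) auto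
  qed
  have "schoenberg 0 (T 0) = x"
    unfolding schoenberg_def zc using a(2) by (simp add: c_def sums_iff)
  moreover have "schoenberg 1 (T 0) = y"
    unfolding schoenberg_def zc using b(2) by (simp add: c_def sums_iff)
  ultimately show ?thesis using Tb by (intro bexI[of _ "T 0"]) auto
qed

text \<open>The unit square is stretched to the square circumscribed about the disc of radius
  \<open>\<rho>\<close>. Parameters outside [0, 1] also give points of that square, which makes
  continuous functions bounded along the whole curve.\<close>

definition square_curve :: "real \<Rightarrow> real \<Rightarrow> complex" where
  "square_curve \<rho> t = Complex (\<rho> * (2 * schoenberg 0 t - 1)) (\<rho> * (2 * schoenberg 1 t - 1))"

lemma continuous_on_square_curve: "continuous_on A (square_curve \<rho>)"
  unfolding square_curve_def Complex_eq
  by (intro continuous_intros continuous_on_subset[OF continuous_on_schoenberg]) auto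

lemma square_curve_bound: "0 \<le> \<rho> \<Longrightarrow> cmod (square_curve \<rho> t) \<le> 2 * \<rho>"
proof -
  assume \<rho>: "0 \<le> \<rho>"
  have "\<bar>2 * schoenberg i t - 1\<bar> \<le> 1" for i using schoenberg_bounds[of i t] by (simp add: abs_le_iff)
  then have *: "\<bar>\<rho> * (2 * schoenberg i t - 1)\<bar> \<le> \<rho>" for i
    using mult_left_mono[of "\<bar>2 * schoenberg i t - 1\<bar>" 1 \<rho>] \<rho> by (simp add: abs_mult)
  show ?thesis using cmod_le[of "square_curve \<rho> t"] *[of 0] *[of 1] by (simp add: square_curve_def)
qed

lemma square_curve_surj:
  assumes "0 < \<rho>" "cmod z \<le> \<rho>"
  shows "\<exists>t\<in>{0..1}. square_curve \<rho> t = z"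
proof -
  have b: "\<bar>Re z\<bar> \<le> \<rho>" "\<bar>Im z\<bar> \<le> \<rho>" using assms abs_Re_le_cmod[of z] abs_Im_le_cmod[of z] by linarith+
  obtain t where "t\<in>{0..1}" "schoenberg 0 t = (Re z / \<rho> + 1) / 2" "schoenberg 1 t = (Im z / \<rho> + 1) / 2"
    using schoenberg_surj[of "(Re z / \<rho> + 1) / 2" "(Im z / \<rho> + 1) / 2"] b assms
    by (auto simp: abs_le_iff field_simps)
  then show ?thesis using assms
    by (intro bexI[of _ t]) (auto simp: square_curve_def complex_eq_iff field_simps)
qed

text \<open>The least parameter is a Borel section of the curve: its sublevel sets are images of
  compact intervals.\<close>

definition curve_section :: "real \<Rightarrow> complex \<Rightarrow> real" where
  "curve_section \<rho> z = (if \<exists>t\<in>{0..1}. square_curve \<rho> t = z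
     then Inf {t\<in>{0..1}. square_curve \<rho> t = z} else 2)"

lemma curve_section_attained:
  assumes "\<exists>t\<in>{0..1}. square_curve \<rho> t = z"
  shows "curve_section \<rho> z \<in> {t\<in>{0..1}. square_curve \<rho> t = z}"
proof -
  let ?A = "{t\<in>{0..1}. square_curve \<rho> t = z}"
  have "closed ?A"
    by (intro continuous_closed_preimage_constant continuous_on_square_curve) auto
  moreover have "bdd_below ?A" by (rule bdd_belowI[of _ 0]) auto
  ultimately have "Inf ?A \<in> ?A" using assms by (intro closed_contains_Inf) auto
  then show ?thesis using assms by (simp add: curve_section_def)
qed

lemma measurable_curve_section: "curve_section \<rho> \<in> borel_measurable borel"
proof (rule borel_measurableI_le)
  fix c :: real
  have "{z. curve_section \<rho> z \<le> c} \<in> sets borel"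
  proof (cases "c \<ge> 2")
    case True
    have "curve_section \<rho> z \<le> 2" for z
      using curve_section_attained[of \<rho> z] by (cases "\<exists>t\<in>{0..1}. square_curve \<rho> t = z") (auto simp: curve_section_def)
    with True have "{z. curve_section \<rho> z \<le> c} = UNIV" by (auto intro: order_trans)
    then show ?thesis by simp
  next
    case False
    \<comment> \<open>The default value 2 lies beyond [0, 1], so below level 2 only points on the
      curve occur.\<close>
    have "{z. curve_section \<rho> z \<le> c} = square_curve \<rho> ` ({0..1} \<inter> {..c})"
    proof safe
      fix z assume z: "curve_section \<rho> z \<le> c"
      then have "\<exists>t\<in>{0..1}. square_curve \<rho> t = z" using False by (auto simp: curve_section_def split: if_splits)
      from curve_section_attained[OF this] z
      show "z \<in> square_curve \<rho> ` ({0..1} \<inter> {..c})" by (intro image_eqI[of _ _ "curve_section \<rho> z"]) auto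
    next
      fix t assume t: "t \<in> {0..1::real}" "t \<le> c"
      have "Inf {u\<in>{0..1}. square_curve \<rho> u = square_curve \<rho> t} \<le> t"
        by (rule cInf_lower) (use t in \<open>auto intro: bdd_belowI[of _ 0]\<close>)
      with t show "curve_section \<rho> (square_curve \<rho> t) \<le> c" by (auto simp: curve_section_def)
    qed
    moreover have "compact (square_curve \<rho> ` ({0..1} \<inter> {..c}))"
      by (intro compact_continuous_image continuous_on_square_curve compact_Int_closed) auto
    ultimately show ?thesis by (simp add: borel_compact)
  qed
  then show "{w \<in> space borel. curve_section \<rho> w \<le> c} \<in> sets borel" by simp
qed

text \<open>Test functions need not be bounded: the limits are taken of measures living on a common
  disc, so truncated logarithms can be tested directly.\<close>

definition weak_lim :: "(nat \<Rightarrow> complex measure) \<Rightarrow> complex measure \<Rightarrow> bool" where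
  "weak_lim M \<sigma> \<longleftrightarrow>
     (\<forall>f::complex \<Rightarrow> real. continuous_on UNIV f \<longrightarrow> (\<lambda>k. \<integral>x. f x \<partial>M k) \<longlonglongrightarrow> (\<integral>x. f x \<partial>\<sigma>))"

lemma weak_limD:
  "weak_lim M \<sigma> \<Longrightarrow> continuous_on UNIV f \<Longrightarrow> (\<lambda>k. \<integral>x. f x \<partial>M k) \<longlonglongrightarrow> (\<integral>x. f x \<partial>\<sigma>)"
  for f :: "complex \<Rightarrow> real"
  by (simp add: weak_lim_def)

lemma weak_lim_subseq: "weak_lim M \<sigma> \<Longrightarrow> strict_mono r \<Longrightarrow> weak_lim (M \<circ> r) \<sigma>"
  unfolding weak_lim_def
proof (intro allI impI)
  fix f :: "complex \<Rightarrow> real"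
  assume a: "\<forall>f::complex \<Rightarrow> real. continuous_on UNIV f \<longrightarrow> (\<lambda>k. \<integral>x. f x \<partial>M k) \<longlonglongrightarrow> (\<integral>x. f x \<partial>\<sigma>)"
    and r: "strict_mono r" and f: "continuous_on UNIV f"
  show "(\<lambda>k. \<integral>x. f x \<partial>(M \<circ> r) k) \<longlonglongrightarrow> (\<integral>x. f x \<partial>\<sigma>)"
    using LIMSEQ_subseq_LIMSEQ[OF a[rule_format, OF f] r] by (simp add: o_def)
qed

lemma borel_prob_onD:
  assumes "borel_prob_on C \<mu>"
  shows "sets \<mu> = sets borel" "space \<mu> = UNIV" "prob_space \<mu>" "measure \<mu> C = 1"
  using assms sets_eq_imp_space_eq[of \<mu> borel] by (auto simp: borel_prob_on_def)

lemma borel_prob_on_iff_AE: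
  assumes "C \<in> sets borel"
  shows "borel_prob_on C \<mu> \<longleftrightarrow> sets \<mu> = sets borel \<and> prob_space \<mu> \<and> (AE z in \<mu>. z \<in> C)"
proof -
  have "measure \<mu> C = 1 \<longleftrightarrow> (AE z in \<mu>. z \<in> C)" if "sets \<mu> = sets borel" "prob_space \<mu>"
    using prob_space.AE_in_set_eq_1[OF that(2), of C] that assms by auto
  then show ?thesis by (auto simp: borel_prob_on_def)
qed

lemma borel_prob_on_AE:
  assumes "borel_prob_on C \<mu>" "C \<in> sets borel"
  shows "AE z in \<mu>. z \<in> C"
  using assms borel_prob_on_iff_AE by blast

lemma borel_prob_on_mono:
  assumes "borel_prob_on C \<mu>" "C \<subseteq> C'" "C \<in> sets borel" "C' \<in> sets borel"
  shows "borel_prob_on C' \<mu>"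
  using assms borel_prob_on_AE[OF assms(1,3)] by (auto simp: borel_prob_on_iff_AE elim!: eventually_mono)

lemma integrable_continuous_on_compact:
  fixes f :: "complex \<Rightarrow> 'b::{banach, second_countable_topology}"
  assumes "borel_prob_on C \<mu>" "compact C" "continuous_on C f" "f \<in> borel_measurable borel"
  shows "integrable \<mu> f"
proof -
  interpret prob_space \<mu> using assms(1) by (rule borel_prob_onD)
  have "bounded (f ` C)" using assms by (intro compact_imp_bounded compact_continuous_image)
  then obtain B where B: "\<And>x. x \<in> C \<Longrightarrow> norm (f x) \<le> B" by (auto simp: bounded_iff)
  show ?thesis
  proof (rule integrable_const_bound[of _ B])
    show "AE x in \<mu>. norm (f x) \<le> B"
      using borel_prob_on_AE[OF assms(1) borel_compact[OF assms(2)]] by eventually_elim (rule B)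
    show "f \<in> borel_measurable \<mu>" using assms(4) borel_prob_onD(1)[OF assms(1)] by (simp cong: measurable_cong_sets)
  qed
qed

lemma borel_measurable_continuous_UNIV: "continuous_on UNIV f \<Longrightarrow> f \<in> borel_measurable borel"
  by (rule borel_measurable_continuous_onI)

lemma integrable_continuous:
  fixes f :: "complex \<Rightarrow> 'b::{banach, second_countable_topology}"
  assumes "borel_prob_on C \<mu>" "compact C" "continuous_on UNIV f"
  shows "integrable \<mu> f"
  using assms
  by (intro integrable_continuous_on_compact[OF assms(1,2)] borel_measurable_continuous_UNIV)
     (auto intro: continuous_on_subset)

text \<open>Pushed to the line by the Borel section, the measures live on [0, 1] and form a tight
  sequence. A weak limit there is carried back by the curve, whose continuity turns continuous test
  functions on the plane into bounded continuous ones on the line.\<close>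

theorem weak_compactness:
  assumes \<rho>: "0 < \<rho>" and M: "\<And>k::nat. borel_prob_on (cball 0 \<rho>) (M k)"
  shows "\<exists>r \<sigma>. strict_mono r \<and> borel_prob_on (cball 0 \<rho>) \<sigma> \<and> weak_lim (M \<circ> r) \<sigma>"
proof -
  let ?s = "curve_section \<rho>" and ?\<phi> = "square_curve \<rho>"
  have sM[measurable_cong]: "sets (M k) = sets borel" for k using borel_prob_onD[OF M] by blast
  note [measurable] = measurable_curve_section
  have m\<phi>[measurable]: "?\<phi> \<in> borel_measurable borel"
    by (rule borel_measurable_continuous_UNIV[OF continuous_on_square_curve])
  have AEball: "AE z in M k. z \<in> cball 0 \<rho>" for k by (rule borel_prob_on_AE[OF M]) auto
  define N where "N k = distr (M k) borel ?s" for k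
  have N: "real_distribution (N k)" for k
    unfolding N_def using borel_prob_onD(3)[OF M[of k]]
    by (intro prob_space.real_distribution_distr) (auto cong: measurable_cong_sets simp: sM)
  have att: "?s z \<in> {0..1}" "?\<phi> (?s z) = z" if "z \<in> cball 0 \<rho>" for z
    using curve_section_attained[OF square_curve_surj[OF \<rho>, of z]] that by auto
  \<comment> \<open>The intervals in \<open>tight\<close> are open on the left, so the left end -1
    leaves room for the parameter 0.\<close>
  have N1: "measure (N k) {-1<..1} = 1" for k
  proof -
    interpret prob_space "M k" using borel_prob_onD(3)[OF M] .
    have "measure (N k) {-1<..1} = measure (M k) (?s -` {-1<..1} \<inter> space (M k))"
      unfolding N_def by (rule measure_distr) auto
    also have "\<dots> = 1"
      by (subst prob_eq_1) (use AEball[of k] att in \<open>auto elim!: eventually_mono, fastforce\<close>)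
    finally show ?thesis .
  qed
  have "tight N"
    unfolding tight_def using N N1 by (intro conjI allI impI exI[of _ "-1"] exI[of _ 1]) auto
  from tight_imp_convergent_subsubsequence[OF this strict_mono_id]
  obtain r \<nu> where r: "strict_mono r" and \<nu>: "real_distribution \<nu>" and w: "weak_conv_m (N \<circ> id \<circ> r) \<nu>"
    by blast
  define \<sigma> where "\<sigma> = distr \<nu> borel ?\<phi>"
  have s\<nu>[measurable_cong]: "sets \<nu> = sets borel" using \<nu> by (simp add: real_distribution.events_eq_borel)
  interpret \<nu>: prob_space \<nu> using \<nu> by (simp add: real_distribution_def)
  have lim: "(\<lambda>k. \<integral>x. f x \<partial>(M \<circ> r) k) \<longlonglongrightarrow> (\<integral>x. f x \<partial>\<sigma>)" if f: "continuous_on UNIV f" for f :: "complex \<Rightarrow> real"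
  proof -
    have fm[measurable]: "f \<in> borel_measurable borel" by (rule borel_measurable_continuous_UNIV[OF f])
    have "bounded (f ` cball 0 (2 * \<rho>))"
      by (intro compact_imp_bounded compact_continuous_image continuous_on_subset[OF f]) auto
    then obtain B where B: "\<And>x. x \<in> cball 0 (2 * \<rho>) \<Longrightarrow> norm (f x) \<le> B" unfolding bounded_iff by blast
    have "(\<lambda>n. \<integral>x. f (?\<phi> x) \<partial>(N \<circ> id \<circ> r) n) \<longlonglongrightarrow> (\<integral>x. f (?\<phi> x) \<partial>\<nu>)"
    proof (rule weak_conv_imp_integral_bdd_continuous_conv[OF _ \<nu> w])
      show "real_distribution ((N \<circ> id \<circ> r) n)" for n using N by simp
      show "isCont (\<lambda>x. f (?\<phi> x)) x" for x
        using continuous_on_compose2[OF f continuous_on_square_curve[of UNIV]] by (simp add: continuous_on_eq_continuous_at)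
      show "norm (f (?\<phi> x)) \<le> B" for x using B square_curve_bound[of \<rho> x] \<rho> by auto
    qed
    moreover have "(\<integral>x. f (?\<phi> x) \<partial>(N \<circ> id \<circ> r) n) = (\<integral>x. f x \<partial>(M \<circ> r) n)" for n
    proof -
      have "(\<integral>x. f (?\<phi> x) \<partial>(N \<circ> id \<circ> r) n) = (\<integral>x. f (?\<phi> (?s x)) \<partial>M (r n))"
        unfolding N_def o_def id_def by (rule integral_distr) auto
      also have "\<dots> = (\<integral>x. f x \<partial>M (r n))"
        by (rule integral_cong_AE) (use AEball[of "r n"] att in \<open>auto elim!: eventually_mono\<close>)
      finally show ?thesis by simp
    qed
    moreover have "(\<integral>x. f (?\<phi> x) \<partial>\<nu>) = (\<integral>x. f x \<partial>\<sigma>)"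
      unfolding \<sigma>_def by (rule integral_distr[symmetric]) auto
    ultimately show ?thesis by simp
  qed
  have \<sigma>p: "prob_space \<sigma>" unfolding \<sigma>_def by (rule \<nu>.prob_space_distr) auto
  interpret \<sigma>: prob_space \<sigma> by (rule \<sigma>p)
  have \<sigma>b: "AE x in \<sigma>. cmod x \<le> 2 * \<rho>"
    unfolding \<sigma>_def by (subst AE_distr_iff) (use square_curve_bound \<rho> in auto)
  \<comment> \<open>So far the limit is known to live only in the image of the curve, a square.
    Testing with the distance to the disc removes the corners.\<close>
  let ?f = "\<lambda>z. max 0 (cmod z - \<rho>)"
  have fc: "continuous_on UNIV ?f" by (intro continuous_intros)
  have "(\<integral>x. ?f x \<partial>(M \<circ> r) k) = 0" for k
  proof (rule integral_eq_zero_AE)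
    show "AE x in (M \<circ> r) k. ?f x = 0" using AEball[of "r k"] unfolding o_def by eventually_elim auto
  qed
  with lim[OF fc] have "(\<integral>x. ?f x \<partial>\<sigma>) = 0" by (simp add: LIMSEQ_const_iff)
  moreover have "integrable \<sigma> ?f"
    by (rule \<sigma>.integrable_const_bound[of _ \<rho>])
       (use \<sigma>b \<rho> in \<open>auto elim!: eventually_mono simp: \<sigma>_def\<close>)
  ultimately have "AE x in \<sigma>. ?f x = 0"
    by (subst (asm) integral_nonneg_eq_0_iff_AE) auto
  then have "AE x in \<sigma>. x \<in> cball 0 \<rho>" by eventually_elim auto
  then have "borel_prob_on (cball 0 \<rho>) \<sigma>"
    using \<sigma>p by (subst borel_prob_on_iff_AE) (auto simp: \<sigma>_def)
  with r lim show ?thesis by (auto simp: weak_lim_def)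
qed

text \<open>The indicator of an open set is the limit of \<open>min 1 (n * infdist z (- S))\<close>,
  and open sets form an intersection-stable generator of the Borel sets.\<close>

lemma measure_eqI_continuous:
  fixes \<mu> \<nu> :: "complex measure"
  assumes \<mu>: "borel_prob_on (cball 0 \<rho>) \<mu>" and \<nu>: "borel_prob_on (cball 0 \<rho>) \<nu>"
    and eq: "\<And>f::complex \<Rightarrow> real. continuous_on UNIV f \<Longrightarrow> (\<integral>x. f x \<partial>\<mu>) = (\<integral>x. f x \<partial>\<nu>)"
  shows "\<mu> = \<nu>"
proof (rule measure_eqI_generator_eq[where E="{S. open S}" and \<Omega>=UNIV and A="\<lambda>_. UNIV"])
  interpret \<mu>: prob_space \<mu> using \<mu> by (rule borel_prob_onD)
  interpret \<nu>: prob_space \<nu> using \<nu> by (rule borel_prob_onD)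
  have s[measurable_cong]: "sets \<mu> = sets borel" "sets \<nu> = sets borel" using \<mu> \<nu> by (auto simp: borel_prob_on_def)
  show "Int_stable {S::complex set. open S}" by (auto simp: Int_stable_def)
  show "sets \<mu> = sigma_sets UNIV {S. open S}" "sets \<nu> = sigma_sets UNIV {S. open S}"
    using s by (auto simp: borel_def)
  show "emeasure \<mu> UNIV \<noteq> \<infinity>" by simp
  fix S :: "complex set" assume "S \<in> {S. open S}"
  then have S: "open S" by simp
  show "emeasure \<mu> S = emeasure \<nu> S"
  \<comment> \<open>The distance to the empty complement is 0 by convention, so the approximation
    fails for the whole plane.\<close>
  proof (cases "S = UNIV")
    case True
    then show ?thesis using \<mu>.emeasure_space_1 \<nu>.emeasure_space_1 borel_prob_onD(2)[OF \<mu>] borel_prob_onD(2)[OF \<nu>] by simp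
  next
    case False
    define f where "f n z = min 1 (real n * infdist z (-S))" for n z
    have fc: "continuous_on UNIV (f n)" for n unfolding f_def by (intro continuous_intros)
    have f01: "0 \<le> f n z" "f n z \<le> 1" for n z by (auto simp: f_def infdist_nonneg)
    have flim: "(\<lambda>n. f n z) \<longlonglongrightarrow> indicat_real S z" for z
    proof (cases "z \<in> S")
      case True
      have "infdist z (-S) > 0" using True False S
        by (subst infdist_pos_not_in_closed) auto
      then obtain n0 where "1 < real n0 * infdist z (-S)" using reals_Archimedean3 by blast
      then have "f n z = 1" if "n \<ge> n0" for n
        unfolding f_def using that mult_right_mono[of "real n0" "real n" "infdist z (-S)"] infdist_nonneg[of z "-S"] by auto
      then have "\<forall>\<^sub>F n in sequentially. f n z = 1" by (auto simp: eventually_sequentially)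
      then show ?thesis using True by (simp add: tendsto_eventually)
    next
      case F: False
      then have "infdist z (-S) = 0" by (intro infdist_zero) auto
      then show ?thesis using F by (simp add: f_def)
    qed
    have *: "(\<lambda>n. \<integral>x. f n x \<partial>N) \<longlonglongrightarrow> measure N S" if N: "borel_prob_on (cball 0 \<rho>) N" for N
    proof -
      interpret N: prob_space N using N by (rule borel_prob_onD)
      have [measurable_cong]: "sets N = sets borel" using borel_prob_onD[OF N] by blast
      have [measurable]: "S \<in> sets borel" using S by auto
      have [measurable]: "f n \<in> borel_measurable borel" for n by (rule borel_measurable_continuous_UNIV[OF fc])
      have "(\<lambda>n. \<integral>x. f n x \<partial>N) \<longlonglongrightarrow> (\<integral>x. indicat_real S x \<partial>N)"
        by (rule integral_dominated_convergence[where w="\<lambda>_. 1"]) (use flim f01 S in auto)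
      then show ?thesis using S borel_prob_onD(2)[OF N] by simp
    qed
    have "measure \<mu> S = measure \<nu> S"
      using *[OF \<mu>] *[OF \<nu>] eq[OF fc] LIMSEQ_unique by auto
    then show ?thesis by (simp add: \<mu>.emeasure_eq_measure \<nu>.emeasure_eq_measure)
  qed
qed auto

subsection \<open>Logarithmic energy with a nonnegative kernel\<close>

text \<open>On a disc of diameter at most \<open>D\<close> the kernel \<open>ln (D / |z - w|)\<close> is nonnegative, so potentials
  and energies can be nonnegative integrals.\<close>

definition lker :: "real \<Rightarrow> complex \<Rightarrow> complex \<Rightarrow> ennreal" where
  "lker D z w = (if z = w then \<infinity> else ennreal (ln (D / cmod (z - w))))"

definition lpot :: "real \<Rightarrow> complex measure \<Rightarrow> complex \<Rightarrow> ennreal" where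
  "lpot D \<mu> z = (\<integral>\<^sup>+w. lker D z w \<partial>\<mu>)"

definition lenergy :: "real \<Rightarrow> complex measure \<Rightarrow> complex measure \<Rightarrow> ennreal" where
  "lenergy D \<mu> \<nu> = (\<integral>\<^sup>+z. lpot D \<nu> z \<partial>\<mu>)"

text \<open>Truncation makes the kernel continuous, so this potential is continuous in
  \<open>z\<close> and under weak limits, while \<open>ln D - tpot s \<mu> z\<close> increases to
  \<open>lpot D \<mu> z\<close> as \<open>s\<close> decreases to 0. It is also the mean of the
  logarithmic potential over the circle of radius \<open>s\<close> about \<open>z\<close>, which is
  how it is estimated from values of polynomials.\<close>

definition tpot :: "real \<Rightarrow> complex measure \<Rightarrow> complex \<Rightarrow> real" where
  "tpot s \<mu> z = (\<integral>w. ln (max s (cmod (z - w))) \<partial>\<mu>)"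

lemma lker_commute: "lker D z w = lker D w z"
  by (auto simp: lker_def norm_minus_commute)

lemma measurable_lker [measurable]:
  assumes [measurable]: "f \<in> borel_measurable M" "g \<in> borel_measurable M"
  shows "(\<lambda>x. lker D (f x) (g x)) \<in> borel_measurable M"
  unfolding lker_def by measurable

lemma measurable_lpot [measurable]:
  assumes "borel_prob_on C \<mu>"
  shows "lpot D \<mu> \<in> borel_measurable borel"
proof -
  interpret prob_space \<mu> using assms by (rule borel_prob_onD)
  have [measurable_cong]: "sets \<mu> = sets borel" using borel_prob_onD[OF assms] by blast
  show ?thesis unfolding lpot_def by measurable
qed

lemma lenergy_commute:
  assumes "borel_prob_on C \<mu>" "borel_prob_on C' \<nu>"
  shows "lenergy D \<mu> \<nu> = lenergy D \<nu> \<mu>"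
proof -
  interpret \<mu>: prob_space \<mu> using assms(1) by (rule borel_prob_onD)
  interpret \<nu>: prob_space \<nu> using assms(2) by (rule borel_prob_onD)
  interpret pair_sigma_finite \<mu> \<nu> ..
  have [measurable_cong]: "sets \<mu> = sets borel" "sets \<nu> = sets borel"
    using borel_prob_onD[OF assms(1)] borel_prob_onD[OF assms(2)] by blast+
  show ?thesis unfolding lenergy_def lpot_def
    by (subst Fubini'[symmetric]) (auto simp: lker_commute)
qed

lemma ln_max_lipschitz:
  fixes a b s :: real
  assumes "0 < s"
  shows "\<bar>ln (max s a) - ln (max s b)\<bar> \<le> \<bar>a - b\<bar> / s"
proof -
  have *: "ln (max s a) - ln (max s b) \<le> \<bar>a - b\<bar> / s" if "b \<le> a" for a b :: real
  proof -
    have "ln (max s a) - ln (max s b) = ln (max s a / max s b)" using assms by (subst ln_div) auto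
    also have "\<dots> \<le> max s a / max s b - 1" using assms by (intro ln_le_minus_one) auto
    also have "\<dots> = (max s a - max s b) / max s b" using assms by (simp add: field_simps)
    also have "\<dots> \<le> \<bar>a - b\<bar> / s" using assms that by (intro frac_le) auto
    finally show ?thesis .
  qed
  have mono: "ln (max s b) \<le> ln (max s a)" if "b \<le> a" for a b using assms that by auto
  show ?thesis
  proof (cases "b \<le> a")
    case True then show ?thesis using *[OF True] mono[OF True] by linarith
  next
    case False
    then have "a \<le> b" by simp
    then show ?thesis using *[OF \<open>a \<le> b\<close>] mono[OF \<open>a \<le> b\<close>] by (simp add: abs_minus_commute)
  qed
qed

lemma continuous_ln_max: "0 < s \<Longrightarrow> continuous_on A (\<lambda>w. ln (max s (cmod (z - w))))"
  by (intro continuous_intros) auto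

lemma integrable_ln_max:
  assumes "borel_prob_on C \<mu>" "compact C" "0 < s"
  shows "integrable \<mu> (\<lambda>w. ln (max s (cmod (z - w))))"
  by (rule integrable_continuous[OF assms(1,2) continuous_ln_max[OF assms(3)]])

lemma tpot_lipschitz:
  assumes "borel_prob_on C \<mu>" "compact C" "0 < s"
  shows "\<bar>tpot s \<mu> z - tpot s \<mu> z'\<bar> \<le> cmod (z - z') / s"
proof -
  interpret prob_space \<mu> using assms(1) by (rule borel_prob_onD)
  have i: "integrable \<mu> (\<lambda>w. ln (max s (cmod (z - w))) - ln (max s (cmod (z' - w))))"
    using assms by (intro Bochner_Integration.integrable_diff integrable_ln_max)
  have "\<bar>tpot s \<mu> z - tpot s \<mu> z'\<bar> = \<bar>\<integral>w. ln (max s (cmod (z - w))) - ln (max s (cmod (z' - w))) \<partial>\<mu>\<bar>"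
    unfolding tpot_def using assms by (subst Bochner_Integration.integral_diff) (auto intro: integrable_ln_max)
  also have "\<dots> \<le> (\<integral>w. \<bar>ln (max s (cmod (z - w))) - ln (max s (cmod (z' - w)))\<bar> \<partial>\<mu>)"
    by (rule integral_abs_bound)
  also have "\<dots> \<le> (\<integral>w. cmod (z - z') / s \<partial>\<mu>)"
  proof (rule integral_mono)
    fix w
    have "\<bar>ln (max s (cmod (z - w))) - ln (max s (cmod (z' - w)))\<bar> \<le> \<bar>cmod (z - w) - cmod (z' - w)\<bar> / s"
      by (rule ln_max_lipschitz[OF assms(3)])
    also have "\<dots> \<le> cmod (z - z') / s"
      using norm_triangle_ineq3[of "z - w" "z' - w"] assms(3) by (intro divide_right_mono) auto
    finally show "\<bar>ln (max s (cmod (z - w))) - ln (max s (cmod (z' - w)))\<bar> \<le> cmod (z - z') / s" .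
  qed (use i in auto)
  finally show ?thesis by (simp add: prob_space)
qed

lemma continuous_tpot:
  assumes "borel_prob_on C \<mu>" "compact C" "0 < s"
  shows "continuous_on A (tpot s \<mu>)"
proof (rule continuous_on_subset[OF lipschitz_on_continuous_on])
  show "(1/s)-lipschitz_on UNIV (tpot s \<mu>)"
    using tpot_lipschitz[OF assms] assms(3) by (intro lipschitz_onI) (auto simp: dist_norm dist_real_def)
qed auto

lemma weak_lim_tpot:
  assumes "weak_lim M \<sigma>" "0 < s"
  shows "(\<lambda>k. tpot s (M k) z) \<longlonglongrightarrow> tpot s \<sigma> z"
  unfolding tpot_def by (rule weak_limD[OF assms(1) continuous_ln_max[OF assms(2)]])

lemma tpot_le_ln:
  assumes "borel_prob_on (cball 0 \<rho>) \<mu>" "cmod z \<le> \<rho>" "2 * \<rho> \<le> D" "0 < s" "s \<le> D"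
  shows "tpot s \<mu> z \<le> ln D"
proof -
  interpret prob_space \<mu> using assms(1) by (rule borel_prob_onD)
  have "tpot s \<mu> z \<le> (\<integral>w. ln D \<partial>\<mu>)"
    unfolding tpot_def
  proof (rule integral_mono_AE)
    show "integrable \<mu> (\<lambda>w. ln (max s (cmod (z - w))))"
      by (rule integrable_ln_max[OF assms(1)]) (use assms in auto)
    show "AE w in \<mu>. ln (max s (cmod (z - w))) \<le> ln D"
      using borel_prob_on_AE[OF assms(1) borel_closed[OF closed_cball]]
    proof eventually_elim
      case (elim w)
      then have "max s (cmod (z - w)) \<le> D" using assms norm_triangle_ineq4[of z w] by auto
      then show ?case using assms by simp
    qed
  qed auto
  then show ?thesis by (simp add: prob_space)
qed

lemma nn_integral_truncated:
  assumes "borel_prob_on (cball 0 \<rho>) \<mu>" "cmod z \<le> \<rho>" "2 * \<rho> \<le> D" "0 < s" "s \<le> D"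
  shows "(\<integral>\<^sup>+w. ennreal (ln (D / max s (cmod (z - w)))) \<partial>\<mu>) = ennreal (ln D - tpot s \<mu> z)"
proof -
  interpret prob_space \<mu> using assms(1) by (rule borel_prob_onD)
  have D: "0 < D" using assms by simp
  have eq: "ln (D / max s (cmod (z - w))) = ln D - ln (max s (cmod (z - w)))" for w
    using D assms by (subst ln_div) auto
  have i: "integrable \<mu> (\<lambda>w. ln (max s (cmod (z - w))))"
    by (rule integrable_ln_max[OF assms(1)]) (use assms in auto)
  have "(\<integral>\<^sup>+w. ennreal (ln (D / max s (cmod (z - w)))) \<partial>\<mu>) = ennreal (\<integral>w. ln D - ln (max s (cmod (z - w))) \<partial>\<mu>)"
    unfolding eq
  proof (rule nn_integral_eq_integral)
    show "integrable \<mu> (\<lambda>w. ln D - ln (max s (cmod (z - w))))" using i by simp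
    show "AE w in \<mu>. 0 \<le> ln D - ln (max s (cmod (z - w)))"
      using borel_prob_on_AE[OF assms(1) borel_closed[OF closed_cball]]
    proof eventually_elim
      case (elim w)
      then have "max s (cmod (z - w)) \<le> D" using assms norm_triangle_ineq4[of z w] by auto
      then show ?case using assms by simp
    qed
  qed
  also have "(\<integral>w. ln D - ln (max s (cmod (z - w))) \<partial>\<mu>) = ln D - tpot s \<mu> z"
    using i by (simp add: tpot_def prob_space)
  finally show ?thesis .
qed

lemma truncated_le_lker:
  assumes "0 < s" "0 < D"
  shows "ennreal (ln (D / max s (cmod (z - w)))) \<le> lker D z w"
  using assms by (auto simp: lker_def intro!: ennreal_leI divide_left_mono)

lemma lpot_ge_truncated:
  assumes "borel_prob_on (cball 0 \<rho>) \<mu>" "cmod z \<le> \<rho>" "2 * \<rho> \<le> D" "0 < s" "s \<le> D"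
  shows "ennreal (ln D - tpot s \<mu> z) \<le> lpot D \<mu> z"
  unfolding lpot_def nn_integral_truncated[OF assms, symmetric]
  by (rule nn_integral_mono) (use assms truncated_le_lker in auto)

text \<open>The levels \<open>D / Suc n\<close> never exceed \<open>D\<close>, so the truncated
  kernels stay nonnegative. Off the diagonal the supremum is attained once the level is below the
  distance; on it the terms are \<open>ln (Suc n)\<close>.\<close>

lemma SUP_truncated_eq_lker:
  assumes "0 < D" "cmod (z - w) \<le> D"
  shows "(SUP n. ennreal (ln (D / max (D / real (Suc n)) (cmod (z - w))))) = lker D z w"
proof (rule antisym)
  show "(SUP n. ennreal (ln (D / max (D / real (Suc n)) (cmod (z - w))))) \<le> lker D z w"
    by (rule SUP_least, rule truncated_le_lker) (use assms in auto)
  show "lker D z w \<le> (SUP n. ennreal (ln (D / max (D / real (Suc n)) (cmod (z - w)))))"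
  proof (cases "z = w")
    case True
    have "filterlim (\<lambda>n. ln (real (Suc n))) at_top sequentially"
      by (intro filterlim_compose[OF ln_at_top] filterlim_compose[OF filterlim_real_sequentially] filterlim_Suc)
    then have "(\<lambda>n. ennreal (ln (real (Suc n)))) \<longlonglongrightarrow> \<infinity>"
      by (simp add: ennreal_tendsto_top_eq_at_top filterlim_compose)
    then have "\<infinity> \<le> (SUP n. ennreal (ln (real (Suc n))))"
      by (rule LIMSEQ_le_const2) (auto intro!: exI[of _ 0] SUP_upper)
    moreover have "ln (D / max (D / real (Suc n)) (cmod (z - w))) = ln (real (Suc n))" for n
      using True assms by simp
    ultimately show ?thesis using True by (simp add: lker_def)
  next
    case False
    then have "cmod (z - w) > 0" by simp
    then obtain n where "D / cmod (z - w) < real n" using reals_Archimedean2 by blast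
    then have "D < real n * cmod (z - w)" using \<open>cmod (z - w) > 0\<close> by (simp add: field_simps)
    then have "D \<le> real (Suc n) * cmod (z - w)" using \<open>cmod (z - w) > 0\<close>
      unfolding of_nat_Suc distrib_right by linarith
    then have "D / real (Suc n) \<le> cmod (z - w)" by (simp add: field_simps)
    then have "lker D z w = ennreal (ln (D / max (D / real (Suc n)) (cmod (z - w))))"
      using False by (simp add: lker_def max_def)
    then show ?thesis by (auto intro!: SUP_upper2[of n])
  qed
qed

lemma lpot_eq_SUP:
  assumes "borel_prob_on (cball 0 \<rho>) \<mu>" "cmod z \<le> \<rho>" "2 * \<rho> \<le> D" "0 < \<rho>"
  shows "lpot D \<mu> z = (SUP n. ennreal (ln D - tpot (D / real (Suc n)) \<mu> z))"
proof -
  interpret prob_space \<mu> using assms(1) by (rule borel_prob_onD)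
  have [measurable_cong]: "sets \<mu> = sets borel" using borel_prob_onD[OF assms(1)] by blast
  have D: "0 < D" using assms by simp
  let ?f = "\<lambda>n w. ennreal (ln (D / max (D / real (Suc n)) (cmod (z - w))))"
  have "lpot D \<mu> z = (\<integral>\<^sup>+w. (SUP n. ?f n w) \<partial>\<mu>)"
    unfolding lpot_def
  proof (rule nn_integral_cong_AE)
    show "AE w in \<mu>. lker D z w = (SUP n. ?f n w)"
      using borel_prob_on_AE[OF assms(1) borel_closed[OF closed_cball]]
    proof eventually_elim
      case (elim w)
      then have "cmod (z - w) \<le> D" using assms norm_triangle_ineq4[of z w] by auto
      then show ?case using SUP_truncated_eq_lker[OF D] by simp
    qed
  qed
  also have "\<dots> = (SUP n. \<integral>\<^sup>+w. ?f n w \<partial>\<mu>)"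
  proof (rule nn_integral_monotone_convergence_SUP)
    show "incseq ?f"
    proof (intro incseq_SucI le_funI ennreal_leI)
      fix n w
      have "D / real (Suc (Suc n)) \<le> D / real (Suc n)" using D by (intro divide_left_mono) auto
      then have "max (D / real (Suc (Suc n))) (cmod (z - w)) \<le> max (D / real (Suc n)) (cmod (z - w))" by auto
      moreover have "0 < max (D / real (Suc (Suc n))) (cmod (z - w))" using D by (simp add: less_max_iff_disj)
      ultimately show "ln (D / max (D / real (Suc n)) (cmod (z - w))) \<le> ln (D / max (D / real (Suc (Suc n))) (cmod (z - w)))"
        using D by (intro ln_mono divide_left_mono divide_pos_pos mult_pos_pos) (auto simp: less_max_iff_disj)
    qed
  qed auto
  also have "\<dots> = (SUP n. ennreal (ln D - tpot (D / real (Suc n)) \<mu> z))"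
    by (intro SUP_cong refl nn_integral_truncated[OF assms(1,2,3)]) (use D in \<open>auto simp: field_simps\<close>)
  finally show ?thesis .
qed

lemma incseq_truncated_lpot:
  assumes "borel_prob_on (cball 0 \<rho>) \<mu>" "0 < D"
  shows "incseq (\<lambda>n. ennreal (ln D - tpot (D / real (Suc n)) \<mu> z))"
proof (intro incseq_SucI ennreal_leI diff_mono order_refl)
  fix n
  show "tpot (D / real (Suc (Suc n))) \<mu> z \<le> tpot (D / real (Suc n)) \<mu> z"
    unfolding tpot_def
  proof (rule integral_mono)
    show "integrable \<mu> (\<lambda>w. ln (max (D / real (Suc (Suc n))) (cmod (z - w))))"
      "integrable \<mu> (\<lambda>w. ln (max (D / real (Suc n)) (cmod (z - w))))"
      by (rule integrable_ln_max[OF assms(1)], use assms in auto)+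
    fix w
    have "D / real (Suc (Suc n)) \<le> D / real (Suc n)" using assms by (intro divide_left_mono) auto
    moreover have "0 < D / real (Suc (Suc n))" using assms by simp
    ultimately show "ln (max (D / real (Suc (Suc n))) (cmod (z - w))) \<le> ln (max (D / real (Suc n)) (cmod (z - w)))"
      by (intro ln_mono) auto
  qed
qed

text \<open>For fixed \<open>\<nu>\<close> the truncated potentials are continuous functions below
  \<open>lpot D \<nu>\<close>, so their integrals pass to the weak limit with the bound
  \<open>c\<close>. Monotone convergence then removes the truncation.\<close>

lemma lenergy_lsc:
  assumes \<rho>: "0 < \<rho>" "2 * \<rho> \<le> D"
    and M: "\<And>k. borel_prob_on (cball 0 \<rho>) (M k)" and \<sigma>: "borel_prob_on (cball 0 \<rho>) \<sigma>"
    and \<nu>: "borel_prob_on (cball 0 \<rho>) \<nu>"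
    and lim: "weak_lim M \<sigma>" and le: "\<forall>\<^sub>F k in sequentially. lenergy D (M k) \<nu> \<le> c"
  shows "lenergy D \<sigma> \<nu> \<le> c"
proof -
  have D: "0 < D" using \<rho> by simp
  have s: "0 < D / real (Suc n)" "D / real (Suc n) \<le> D" for n using D by (auto simp: field_simps)
  have AEb: "AE z in \<mu>. cmod z \<le> \<rho>" if "borel_prob_on (cball 0 \<rho>) \<mu>" for \<mu>
    using borel_prob_on_AE[OF that borel_closed[OF closed_cball]] by simp
  have [measurable_cong]: "sets \<sigma> = sets borel" using borel_prob_onD[OF \<sigma>] by blast
  define P where "P n z = ln D - tpot (D / real (Suc n)) \<nu> z" for n z
  have Pc: "continuous_on UNIV (P n)" for n
    unfolding P_def by (intro continuous_intros continuous_tpot[OF \<nu> _ s(1)]) auto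
  have [measurable]: "P n \<in> borel_measurable borel" for n by (rule borel_measurable_continuous_UNIV[OF Pc])
  have P0: "0 \<le> P n z" if "cmod z \<le> \<rho>" for n z
    unfolding P_def using tpot_le_ln[OF \<nu> that \<rho>(2) s] by simp
  have eq: "(\<integral>\<^sup>+z. ennreal (P n z) \<partial>\<mu>) = ennreal (\<integral>z. P n z \<partial>\<mu>)" if "borel_prob_on (cball 0 \<rho>) \<mu>" for n \<mu>
    by (rule nn_integral_eq_integral)
       (use integrable_continuous[OF that _ Pc] AEb[OF that] P0 in \<open>auto elim!: eventually_mono\<close>)
  have fin: "(\<integral>\<^sup>+z. ennreal (P n z) \<partial>\<sigma>) \<le> c" for n
  proof -
    have "(\<lambda>k. ennreal (\<integral>z. P n z \<partial>M k)) \<longlonglongrightarrow> ennreal (\<integral>z. P n z \<partial>\<sigma>)"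
      by (intro tendsto_ennrealI weak_limD[OF lim Pc])
    moreover have "\<forall>\<^sub>F k in sequentially. ennreal (\<integral>z. P n z \<partial>M k) \<le> c"
      using le
    proof eventually_elim
      case (elim k)
      have "ennreal (\<integral>z. P n z \<partial>M k) = (\<integral>\<^sup>+z. ennreal (P n z) \<partial>M k)" using eq[OF M] by simp
      also have "\<dots> \<le> lenergy D (M k) \<nu>"
        unfolding lenergy_def
      proof (rule nn_integral_mono_AE)
        show "AE z in M k. ennreal (P n z) \<le> lpot D \<nu> z"
          using AEb[OF M[of k]] unfolding P_def by eventually_elim (rule lpot_ge_truncated[OF \<nu> _ \<rho>(2) s])
      qed
      finally show ?case using elim by simp
    qed
    ultimately have "ennreal (\<integral>z. P n z \<partial>\<sigma>) \<le> c"
      by (intro tendsto_upperbound[where F=sequentially]) auto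
    then show ?thesis using eq[OF \<sigma>] by simp
  qed
  have "lenergy D \<sigma> \<nu> = (\<integral>\<^sup>+z. (SUP n. ennreal (P n z)) \<partial>\<sigma>)"
    unfolding lenergy_def
    by (rule nn_integral_cong_AE)
       (use AEb[OF \<sigma>] in \<open>auto elim!: eventually_mono simp: P_def lpot_eq_SUP[OF \<nu> _ \<rho>(2,1)]\<close>)
  also have "\<dots> = (SUP n. \<integral>\<^sup>+z. ennreal (P n z) \<partial>\<sigma>)"
  proof (rule nn_integral_monotone_convergence_SUP)
    show "incseq (\<lambda>n z. ennreal (P n z))"
      using incseq_truncated_lpot[OF \<nu> D] unfolding incseq_def le_fun_def P_def by blast
  qed auto
  also have "\<dots> \<le> c" using fin by (intro SUP_least)
  finally show ?thesis .
qed

subsection \<open>Positive definiteness of the energy\<close>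

text \<open>Since \<open>|z - w|^2 = (1 + |z|^2) (1 + |w|^2) (1 - k)\<close> with a kernel \<open>0 \<le> k \<le> 1\<close> that is the squared
  modulus of a Hermitian positive definite one, expanding \<open>- ln (1 - k)\<close> in powers of \<open>k\<close> writes the
  logarithmic kernel, up to terms in one variable, as a sum of positive definite kernels.\<close>

definition sphker :: "complex \<Rightarrow> complex \<Rightarrow> real" where
  "sphker z w = (cmod (1 + cnj z * w))\<^sup>2 / ((1 + (cmod z)\<^sup>2) * (1 + (cmod w)\<^sup>2))"

lemma one_plus_norm_pos [simp]: "0 < 1 + (cmod z)\<^sup>2" "1 + (cmod z)\<^sup>2 \<noteq> 0"
  using zero_le_power2[of "cmod z"] by linarith+

text \<open>The identity of Lagrange for the vectors \<open>(1, z)\<close> and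
  \<open>(1, w)\<close>. The right side is the square of the chordal distance on the Riemann sphere
  of diameter 1.\<close>

lemma one_minus_sphker:
  "1 - sphker z w = (cmod (z - w))\<^sup>2 / ((1 + (cmod z)\<^sup>2) * (1 + (cmod w)\<^sup>2))"
proof -
  have "(1 + (cmod z)\<^sup>2) * (1 + (cmod w)\<^sup>2) - (cmod (1 + cnj z * w))\<^sup>2 = (cmod (z - w))\<^sup>2"
    unfolding cmod_power2 by (simp add: algebra_simps power2_eq_square)
  then show ?thesis
    unfolding sphker_def by (metis diff_divide_distrib divide_self mult_eq_0_iff one_plus_norm_pos(2))
qed

lemma sphker_bounds: "0 \<le> sphker z w" "sphker z w \<le> 1"
proof -
  have "0 < (1 + (cmod z)\<^sup>2) * (1 + (cmod w)\<^sup>2)" by simp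
  then show "0 \<le> sphker z w" unfolding sphker_def by (intro divide_nonneg_pos) auto
  have "0 \<le> 1 - sphker z w" unfolding one_minus_sphker by (intro divide_nonneg_pos) auto
  then show "sphker z w \<le> 1" by simp
qed

lemma sphker_eq_1_iff: "sphker z w = 1 \<longleftrightarrow> z = w"
proof -
  have "sphker z w = 1 \<longleftrightarrow> 1 - sphker z w = 0" by linarith
  then show ?thesis unfolding one_minus_sphker by simp
qed

lemma measurable_sphker [measurable]:
  assumes [measurable]: "f \<in> borel_measurable M" "g \<in> borel_measurable M"
  shows "(\<lambda>x. sphker (f x) (g x)) \<in> borel_measurable M"
proof -
  have "cnj \<in> borel_measurable borel" by (intro borel_measurable_continuous_onI continuous_intros)
  from measurable_compose[OF assms(1) this] have [measurable]: "(\<lambda>x. cnj (f x)) \<in> borel_measurable M" .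
  show ?thesis unfolding sphker_def by measurable
qed

text \<open>At \<open>k = 1\<close> the harmonic series diverges; this is the value that will match
  the infinite diagonal of \<open>lker\<close>.\<close>

lemma suminf_log_series:
  fixes k :: real
  assumes "0 \<le> k" "k \<le> 1"
  shows "(\<Sum>n. ennreal (k ^ Suc n / real (Suc n))) = (if k = 1 then \<infinity> else ennreal (- ln (1 - k)))"
proof (cases "k = 1")
  case True
  have "\<not> summable (\<lambda>n. inverse (real (Suc n)))"
    using not_summable_harmonic[where 'a=real] by (subst summable_Suc_iff)
  then have "(\<Sum>n. ennreal (inverse (real (Suc n)))) = \<infinity>"
    unfolding infinity_ennreal_def by (rule contrapos_np) (rule summable_suminf_not_top, simp)
  then show ?thesis using True by (simp add: field_simps)
next
  case False
  then have "cmod (of_real (-k)) < 1" using assms by simp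
  then have "(\<lambda>n. - ((k) ^ n) / of_nat n) sums ln (1 + - k)"
    using ln_series'[of "-k"] assms False by simp
  then have "(\<lambda>n. - (- (k ^ n) / real n)) sums - ln (1 + - k)" by (rule sums_minus)
  then have "(\<lambda>n. k ^ Suc n / real (Suc n)) sums - ln (1 - k)"
    by (subst sums_Suc_iff) simp
  then have "(\<Sum>n. ennreal (k ^ Suc n / real (Suc n))) = ennreal (- ln (1 - k))"
    using assms by (intro suminf_ennreal_eq) auto
  then show ?thesis using False by simp
qed

definition log_weight :: "complex \<Rightarrow> real" where
  "log_weight z = ln (1 + (cmod z)\<^sup>2) / 2"

lemma log_weight_nonneg: "0 \<le> log_weight z"
  by (simp add: log_weight_def)

text \<open>Half the logarithm of \<open>one_minus_sphker\<close>, expanded in powers of the kernel.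
  The one-variable weights are kept on the left so that all terms are nonnegative and nothing is
  subtracted in \<open>ennreal\<close>.\<close>

lemma lker_series:
  assumes D: "1 \<le> D" and zw: "cmod (z - w) \<le> D"
  shows "lker D z w + ennreal (log_weight z + log_weight w) =
         ennreal (ln D) + (\<Sum>n. ennreal (sphker z w ^ Suc n / (2 * real (Suc n))))"
proof -
  have "(\<Sum>n. ennreal (sphker z w ^ Suc n / (2 * real (Suc n)))) =
        (\<Sum>n. ennreal (1/2) * ennreal (sphker z w ^ Suc n / real (Suc n)))"
    by (intro suminf_cong) (subst ennreal_mult[symmetric], use sphker_bounds in auto)
  also have "\<dots> = ennreal (1/2) * (\<Sum>n. ennreal (sphker z w ^ Suc n / real (Suc n)))"
    by simp
  also have "\<dots> = ennreal (1/2) * (if sphker z w = 1 then \<infinity> else ennreal (- ln (1 - sphker z w)))"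
    by (subst suminf_log_series) (use sphker_bounds in auto)
  finally have S: "(\<Sum>n. ennreal (sphker z w ^ Suc n / (2 * real (Suc n)))) =
     ennreal (1/2) * (if z = w then \<infinity> else ennreal (- ln (1 - sphker z w)))"
    by (simp add: sphker_eq_1_iff)
  show ?thesis
  proof (cases "z = w")
    case True
    then show ?thesis unfolding S by (simp add: lker_def ennreal_mult_top)
  next
    case False
    then have zw0: "0 < cmod (z - w)" by simp
    have "ln (1 - sphker z w) = 2 * ln (cmod (z - w)) - 2 * log_weight z - 2 * log_weight w"
      unfolding one_minus_sphker log_weight_def using zw0
      by (simp add: ln_div ln_mult ln_realpow)
    then have eq: "- ln (1 - sphker z w) / 2 = log_weight z + log_weight w - ln (cmod (z - w))" by simp
    have "sphker z w < 1" using False sphker_bounds[of z w] sphker_eq_1_iff[of z w] by linarith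
    then have nn: "0 \<le> - ln (1 - sphker z w)" using sphker_bounds[of z w] by simp
    have "ennreal (1/2) * ennreal (- ln (1 - sphker z w)) = ennreal (log_weight z + log_weight w - ln (cmod (z - w)))"
      using nn by (subst ennreal_mult[symmetric]) (auto simp flip: eq)
    moreover have "0 \<le> log_weight z + log_weight w - ln (cmod (z - w))" using nn eq by linarith
    moreover have "0 \<le> ln D - ln (cmod (z - w))" using ln_mono[OF zw zw0] by simp
    moreover have "ln (D / cmod (z - w)) = ln D - ln (cmod (z - w))" using D zw0 by (subst ln_div) auto
    ultimately show ?thesis unfolding S using False D log_weight_nonneg[of z] log_weight_nonneg[of w]
      by (simp add: lker_def flip: ennreal_plus)
  qed
qed

text \<open>The one-variable factors of the binomial expansion of \<open>sphker z w ^ n\<close>.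
  They are the coordinates of the feature map that makes this kernel positive definite.\<close>

definition sphmon :: "nat \<Rightarrow> nat \<Rightarrow> nat \<Rightarrow> complex \<Rightarrow> complex" where
  "sphmon n a b z = cnj z ^ a * z ^ b / of_real ((1 + (cmod z)\<^sup>2) ^ n)"

definition sphmom :: "nat \<Rightarrow> nat \<Rightarrow> nat \<Rightarrow> complex measure \<Rightarrow> complex" where
  "sphmom n a b \<mu> = (\<integral>z. sphmon n a b z \<partial>\<mu>)"

lemma continuous_sphmon: "continuous_on A (sphmon n a b)"
proof -
  have "complex_of_real ((1 + (cmod z)\<^sup>2) ^ n) \<noteq> 0" for z
    unfolding of_real_eq_0_iff by simp
  then show ?thesis unfolding sphmon_def by (intro continuous_intros) auto
qed

lemma integrable_sphmon: "borel_prob_on C \<mu> \<Longrightarrow> compact C \<Longrightarrow> integrable \<mu> (sphmon n a b)"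
  by (rule integrable_continuous[OF _ _ continuous_sphmon])

lemma sphker_power_expand:
  "complex_of_real (sphker z w ^ n) =
     (\<Sum>a\<le>n. \<Sum>b\<le>n. of_nat (n choose a) * of_nat (n choose b) * (sphmon n a b z * cnj (sphmon n a b w)))"
proof -
  have "complex_of_real ((cmod (1 + cnj z * w))\<^sup>2) = (1 + cnj z * w) * (1 + z * cnj w)"
    by (subst complex_norm_square) simp
  then have "complex_of_real (sphker z w ^ n) = ((cnj z * w + 1) ^ n * (z * cnj w + 1) ^ n) /
      (of_real ((1 + (cmod z)\<^sup>2) ^ n) * of_real ((1 + (cmod w)\<^sup>2) ^ n))"
    unfolding sphker_def by (simp add: power_divide power_mult_distrib add.commute)
  also have "(cnj z * w + 1) ^ n * (z * cnj w + 1) ^ n =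
     (\<Sum>a\<le>n. \<Sum>b\<le>n. of_nat (n choose a) * of_nat (n choose b) * ((cnj z * w) ^ a * (z * cnj w) ^ b))"
    unfolding binomial_ring sum_product by (simp add: algebra_simps)
  finally show ?thesis
    by (simp add: sphmon_def sum_divide_distrib power_mult_distrib algebra_simps)
qed

definition sphform :: "nat \<Rightarrow> complex measure \<Rightarrow> complex measure \<Rightarrow> real" where
  "sphform n \<mu> \<nu> = (\<Sum>a\<le>n. \<Sum>b\<le>n. real (n choose a) * real (n choose b) * Re (sphmom n a b \<mu> * cnj (sphmom n a b \<nu>)))"

text \<open>The quadratic form of the \<open>n\<close>-th kernel power on the signed measure
  \<open>\<mu> - \<nu>\<close>, written as a sum of squares so that its sign is evident.\<close>

definition sphdist :: "nat \<Rightarrow> complex measure \<Rightarrow> complex measure \<Rightarrow> real" where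
  "sphdist n \<mu> \<nu> = (\<Sum>a\<le>n. \<Sum>b\<le>n. real (n choose a) * real (n choose b) * (cmod (sphmom n a b \<mu> - sphmom n a b \<nu>))\<^sup>2)"

lemma sphdist_nonneg: "0 \<le> sphdist n \<mu> \<nu>"
  unfolding sphdist_def by (intro sum_nonneg) auto

lemma sphform_polarization: "sphform n \<mu> \<mu> + sphform n \<nu> \<nu> = 2 * sphform n \<mu> \<nu> + sphdist n \<mu> \<nu>"
proof -
  have *: "Re (x * cnj x) + Re (y * cnj y) = 2 * Re (x * cnj y) + (cmod (x - y))\<^sup>2" for x y
    unfolding cmod_power2 by (simp add: algebra_simps power2_eq_square)
  have "real (n choose a) * real (n choose b) * Re (x * cnj x) + real (n choose a) * real (n choose b) * Re (y * cnj y) =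
      2 * (real (n choose a) * real (n choose b) * Re (x * cnj y)) + real (n choose a) * real (n choose b) * (cmod (x - y))\<^sup>2" for a b x y
    using *[of x y] by (metis (no_types, opaque_lifting) distrib_left mult.left_commute)
  then show ?thesis
    unfolding sphform_def sphdist_def by (simp add: sum_distrib_left flip: sum.distrib)
qed

text \<open>Each variable of the binomial expansion can be integrated separately, which leaves
  products of moments. The sign of the mixed form comes from \<open>sphker\<close> being
  nonnegative, not from the moments.\<close>

lemma nn_integral_sphker_power:
  assumes \<mu>: "borel_prob_on C \<mu>" "compact C" and \<nu>: "borel_prob_on C' \<nu>" "compact C'"
  shows "(\<integral>\<^sup>+z. \<integral>\<^sup>+w. ennreal (sphker z w ^ n) \<partial>\<nu> \<partial>\<mu>) = ennreal (sphform n \<mu> \<nu>)"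
    and "0 \<le> sphform n \<mu> \<nu>"
proof -
  interpret \<mu>: prob_space \<mu> using \<mu>(1) by (rule borel_prob_onD)
  interpret \<nu>: prob_space \<nu> using \<nu>(1) by (rule borel_prob_onD)
  have [measurable_cong]: "sets \<mu> = sets borel" "sets \<nu> = sets borel"
    using borel_prob_onD[OF \<mu>(1)] borel_prob_onD[OF \<nu>(1)] by blast+
  note im = integrable_sphmon[OF \<mu>] and in' = integrable_sphmon[OF \<nu>]
  have icn: "integrable \<nu> (\<lambda>w. cnj (sphmon n a b w))" for a b using in' by simp
  have k01: "0 \<le> sphker z w ^ n" "sphker z w ^ n \<le> 1" for z w using sphker_bounds by (auto intro: power_le_one)
  have ik: "integrable \<nu> (\<lambda>w. sphker z w ^ n)" for z
    by (rule \<nu>.integrable_const_bound[of _ 1]) (use k01 in auto)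
  define h where "h z = (\<integral>w. sphker z w ^ n \<partial>\<nu>)" for z
  have h0: "0 \<le> h z" for z unfolding h_def using k01 by (intro Bochner_Integration.integral_nonneg) auto
  have hc: "complex_of_real (h z) = (\<Sum>a\<le>n. \<Sum>b\<le>n. of_nat (n choose a) * of_nat (n choose b) * (sphmon n a b z * cnj (sphmom n a b \<nu>)))" for z
  proof -
    have "complex_of_real (h z) = (\<integral>w. complex_of_real (sphker z w ^ n) \<partial>\<nu>)"
      unfolding h_def by (rule integral_complex_of_real[symmetric])
    also have "\<dots> = (\<Sum>a\<le>n. \<Sum>b\<le>n. of_nat (n choose a) * of_nat (n choose b) * (sphmon n a b z * cnj (sphmom n a b \<nu>)))"
      unfolding sphker_power_expand sphmom_def using icn by (simp add: Bochner_Integration.integral_sum)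
    finally show ?thesis .
  qed
  have hi: "integrable \<mu> (\<lambda>z. complex_of_real (h z))"
    unfolding hc using im by simp
  then have hi': "integrable \<mu> h" by (simp add: complex_of_real_integrable_eq)
  have "complex_of_real (\<integral>z. h z \<partial>\<mu>) = (\<integral>z. complex_of_real (h z) \<partial>\<mu>)" by (rule integral_complex_of_real[symmetric])
  also have "\<dots> = (\<Sum>a\<le>n. \<Sum>b\<le>n. of_nat (n choose a) * of_nat (n choose b) * (sphmom n a b \<mu> * cnj (sphmom n a b \<nu>)))"
    unfolding hc sphmom_def using im by (simp add: Bochner_Integration.integral_sum)
  finally have "Re (complex_of_real (\<integral>z. h z \<partial>\<mu>)) = Re (\<Sum>a\<le>n. \<Sum>b\<le>n. of_nat (n choose a) * of_nat (n choose b) * (sphmom n a b \<mu> * cnj (sphmom n a b \<nu>)))"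
    by simp
  then have val: "(\<integral>z. h z \<partial>\<mu>) = sphform n \<mu> \<nu>"
    unfolding sphform_def by (simp add: Re_sum mult.assoc)
  have "(\<integral>\<^sup>+z. \<integral>\<^sup>+w. ennreal (sphker z w ^ n) \<partial>\<nu> \<partial>\<mu>) = (\<integral>\<^sup>+z. ennreal (h z) \<partial>\<mu>)"
    unfolding h_def by (intro nn_integral_cong nn_integral_eq_integral ik) (use k01 in auto)
  also have "\<dots> = ennreal (\<integral>z. h z \<partial>\<mu>)" using h0 by (intro nn_integral_eq_integral hi') auto
  finally show "(\<integral>\<^sup>+z. \<integral>\<^sup>+w. ennreal (sphker z w ^ n) \<partial>\<nu> \<partial>\<mu>) = ennreal (sphform n \<mu> \<nu>)" unfolding val .
  show "0 \<le> sphform n \<mu> \<nu>" unfolding val[symmetric] using h0 by (intro Bochner_Integration.integral_nonneg) auto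
qed

lemma integrable_log_weight: "borel_prob_on C \<mu> \<Longrightarrow> compact C \<Longrightarrow> integrable \<mu> log_weight"
proof (rule integrable_continuous)
  have "(1::real) + x\<^sup>2 \<noteq> 0" for x using zero_le_power2[of x] by linarith
  then show "continuous_on UNIV log_weight" unfolding log_weight_def by (intro continuous_intros) auto
qed

text \<open>\<open>lker_series\<close> is integrated against both measures. By Tonelli the series
  may be integrated term by term even where its sum is infinite.\<close>

lemma lenergy_series:
  assumes \<rho>: "2 * \<rho> \<le> D" "1 \<le> D"
    and \<mu>: "borel_prob_on (cball 0 \<rho>) \<mu>" and \<nu>: "borel_prob_on (cball 0 \<rho>) \<nu>"
  shows "lenergy D \<mu> \<nu> + ennreal ((\<integral>z. log_weight z \<partial>\<mu>) + (\<integral>z. log_weight z \<partial>\<nu>)) =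
         ennreal (ln D) + (\<Sum>n. ennreal (sphform (Suc n) \<mu> \<nu> / (2 * real (Suc n))))"
proof -
  interpret \<mu>: prob_space \<mu> using \<mu>(1) by (rule borel_prob_onD)
  interpret \<nu>: prob_space \<nu> using \<nu>(1) by (rule borel_prob_onD)
  have [measurable_cong]: "sets \<mu> = sets borel" "sets \<nu> = sets borel"
    using borel_prob_onD[OF \<mu>(1)] borel_prob_onD[OF \<nu>(1)] by blast+
  have iw: "integrable \<mu> log_weight" "integrable \<nu> log_weight"
    using integrable_log_weight[OF \<mu>] integrable_log_weight[OF \<nu>] by auto
  have [measurable]: "log_weight \<in> borel_measurable borel" unfolding log_weight_def by measurable
  note AE\<mu> = borel_prob_on_AE[OF \<mu> borel_closed[OF closed_cball]]
    and AE\<nu> = borel_prob_on_AE[OF \<nu> borel_closed[OF closed_cball]]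
  have [measurable]: "lpot D \<nu> \<in> borel_measurable borel" by (rule measurable_lpot[OF \<nu>])
  have inner: "lpot D \<nu> z + ennreal (log_weight z + (\<integral>w. log_weight w \<partial>\<nu>)) =
     ennreal (ln D) + (\<Sum>n. \<integral>\<^sup>+w. ennreal (sphker z w ^ Suc n / (2 * real (Suc n))) \<partial>\<nu>)"
    if z: "z \<in> cball 0 \<rho>" for z
  proof -
    have "(\<integral>\<^sup>+w. ennreal (log_weight z + log_weight w) \<partial>\<nu>) = ennreal (\<integral>w. log_weight z + log_weight w \<partial>\<nu>)"
      by (rule nn_integral_eq_integral) (use iw log_weight_nonneg in auto)
    also have "(\<integral>w. log_weight z + log_weight w \<partial>\<nu>) = log_weight z + (\<integral>w. log_weight w \<partial>\<nu>)"
      using iw by (simp add: \<nu>.prob_space)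
    finally have "lpot D \<nu> z + ennreal (log_weight z + (\<integral>w. log_weight w \<partial>\<nu>)) =
       (\<integral>\<^sup>+w. lker D z w + ennreal (log_weight z + log_weight w) \<partial>\<nu>)"
      unfolding lpot_def by (subst nn_integral_add) auto
    also have "\<dots> = (\<integral>\<^sup>+w. ennreal (ln D) + (\<Sum>n. ennreal (sphker z w ^ Suc n / (2 * real (Suc n)))) \<partial>\<nu>)"
    proof (rule nn_integral_cong_AE)
      show "AE w in \<nu>. lker D z w + ennreal (log_weight z + log_weight w) =
        ennreal (ln D) + (\<Sum>n. ennreal (sphker z w ^ Suc n / (2 * real (Suc n))))"
        using AE\<nu>
      proof eventually_elim
        case (elim w)
        then show ?case using z \<rho> norm_triangle_ineq4[of z w] by (intro lker_series) auto
      qed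
    qed
    also have "\<dots> = ennreal (ln D) + (\<Sum>n. \<integral>\<^sup>+w. ennreal (sphker z w ^ Suc n / (2 * real (Suc n))) \<partial>\<nu>)"
      by (subst nn_integral_add) (auto simp: \<nu>.emeasure_space_1 nn_integral_suminf simp del: power_Suc of_nat_Suc)
    finally show ?thesis .
  qed
  have tm: "(\<integral>\<^sup>+z. \<integral>\<^sup>+w. ennreal (sphker z w ^ Suc n / (2 * real (Suc n))) \<partial>\<nu> \<partial>\<mu>) =
      ennreal (sphform (Suc n) \<mu> \<nu> / (2 * real (Suc n)))" for n
  proof -
    have c: "ennreal (x / (2 * real (Suc n))) = ennreal (1 / (2 * real (Suc n))) * ennreal x" if "0 \<le> x" for x
      using that by (subst ennreal_mult[symmetric]) (auto simp: field_simps)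
    have "(\<integral>\<^sup>+z. \<integral>\<^sup>+w. ennreal (sphker z w ^ Suc n / (2 * real (Suc n))) \<partial>\<nu> \<partial>\<mu>) =
       ennreal (1 / (2 * real (Suc n))) * (\<integral>\<^sup>+z. \<integral>\<^sup>+w. ennreal (sphker z w ^ Suc n) \<partial>\<nu> \<partial>\<mu>)"
      by (subst c) (auto intro!: zero_le_power sphker_bounds mult_nonneg_nonneg simp: nn_integral_cmult simp del: of_nat_Suc power_Suc)
    also have "\<dots> = ennreal (sphform (Suc n) \<mu> \<nu> / (2 * real (Suc n)))"
      unfolding nn_integral_sphker_power(1)[OF \<mu> compact_cball \<nu> compact_cball]
      using nn_integral_sphker_power(2)[OF \<mu> compact_cball \<nu> compact_cball] by (rule c[symmetric])
    finally show ?thesis .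
  qed
  have "(\<integral>\<^sup>+z. ennreal (log_weight z + (\<integral>w. log_weight w \<partial>\<nu>)) \<partial>\<mu>) = ennreal (\<integral>z. log_weight z + (\<integral>w. log_weight w \<partial>\<nu>) \<partial>\<mu>)"
    by (rule nn_integral_eq_integral) (use iw log_weight_nonneg in \<open>auto intro!: add_nonneg_nonneg Bochner_Integration.integral_nonneg\<close>)
  also have "(\<integral>z. log_weight z + (\<integral>w. log_weight w \<partial>\<nu>) \<partial>\<mu>) = (\<integral>z. log_weight z \<partial>\<mu>) + (\<integral>z. log_weight z \<partial>\<nu>)"
    using iw by (simp add: \<mu>.prob_space)
  finally have "lenergy D \<mu> \<nu> + ennreal ((\<integral>z. log_weight z \<partial>\<mu>) + (\<integral>z. log_weight z \<partial>\<nu>)) =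
     (\<integral>\<^sup>+z. lpot D \<nu> z + ennreal (log_weight z + (\<integral>w. log_weight w \<partial>\<nu>)) \<partial>\<mu>)"
    unfolding lenergy_def by (subst nn_integral_add) auto
  also have "\<dots> = (\<integral>\<^sup>+z. ennreal (ln D) + (\<Sum>n. \<integral>\<^sup>+w. ennreal (sphker z w ^ Suc n / (2 * real (Suc n))) \<partial>\<nu>) \<partial>\<mu>)"
    by (rule nn_integral_cong_AE) (use AE\<mu> inner in \<open>auto elim!: eventually_mono\<close>)
  also have "\<dots> = ennreal (ln D) + (\<Sum>n. \<integral>\<^sup>+z. \<integral>\<^sup>+w. ennreal (sphker z w ^ Suc n / (2 * real (Suc n))) \<partial>\<nu> \<partial>\<mu>)"
    by (subst nn_integral_add) (auto simp: \<mu>.emeasure_space_1 nn_integral_suminf simp del: power_Suc of_nat_Suc)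
  also have "\<dots> = ennreal (ln D) + (\<Sum>n. ennreal (sphform (Suc n) \<mu> \<nu> / (2 * real (Suc n))))"
    by (simp only: tm)
  finally show ?thesis .
qed

text \<open>The energy of the signed measure \<open>\<mu> - \<nu>\<close> with respect to
  \<open>- ln |z - w|\<close>. As a series of squares it makes sense even when the energies of
  \<open>\<mu>\<close> and \<open>\<nu>\<close> are infinite and could not be subtracted.\<close>

definition energy_dist :: "complex measure \<Rightarrow> complex measure \<Rightarrow> ennreal" where
  "energy_dist \<mu> \<nu> = (\<Sum>n. ennreal (sphdist (Suc n) \<mu> \<nu> / (2 * real (Suc n))))"

text \<open>Polarization holds for every kernel power and hence for the series. The constant
  \<open>ln D\<close> and the weights occur equally on both sides and are finite, so they cancel
  even where the energies are infinite.\<close>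

theorem lenergy_polarization:
  assumes \<rho>: "2 * \<rho> \<le> D" "1 \<le> D"
    and \<mu>: "borel_prob_on (cball 0 \<rho>) \<mu>" and \<nu>: "borel_prob_on (cball 0 \<rho>) \<nu>"
  shows "lenergy D \<mu> \<mu> + lenergy D \<nu> \<nu> = 2 * lenergy D \<mu> \<nu> + energy_dist \<mu> \<nu>"
proof -
  define A where "A = (\<integral>z. log_weight z \<partial>\<mu>)"
  define B where "B = (\<integral>z. log_weight z \<partial>\<nu>)"
  have AB: "0 \<le> A" "0 \<le> B" unfolding A_def B_def by (auto intro!: Bochner_Integration.integral_nonneg log_weight_nonneg)
  define S where "S \<mu> \<nu> = (\<Sum>n. ennreal (sphform (Suc n) \<mu> \<nu> / (2 * real (Suc n))))" for \<mu> \<nu>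
  note ser = lenergy_series[OF \<rho>]
  have f0: "0 \<le> sphform (Suc n) \<alpha> \<beta> / (2 * real (Suc n))" if "borel_prob_on (cball 0 \<rho>) \<alpha>" "borel_prob_on (cball 0 \<rho>) \<beta>" for \<alpha> \<beta> n
    using nn_integral_sphker_power(2)[OF that(1) compact_cball that(2) compact_cball, of "Suc n"] by simp
  have add3: "ennreal a + ennreal b = ennreal c + ennreal c + ennreal d"
    if "a + b = c + c + d" "0 \<le> a" "0 \<le> b" "0 \<le> c" "0 \<le> d" for a b c d
    using that by (simp flip: ennreal_plus)
  have suminf3: "(\<Sum>n. f n + f n + g n) = (\<Sum>n. f n) + (\<Sum>n. f n) + (\<Sum>n. g n)" for f g :: "nat \<Rightarrow> ennreal"
  proof -
    have "(\<Sum>n. f n + f n + g n) = (\<Sum>n. f n + f n) + (\<Sum>n. g n)" by (rule suminf_add[symmetric]) auto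
    also have "(\<Sum>n. f n + f n) = (\<Sum>n. f n) + (\<Sum>n. f n)" by (rule suminf_add[symmetric]) auto
    finally show ?thesis .
  qed
  have "S \<mu> \<mu> + S \<nu> \<nu> = (\<Sum>n. ennreal (sphform (Suc n) \<mu> \<mu> / (2 * real (Suc n))) + ennreal (sphform (Suc n) \<nu> \<nu> / (2 * real (Suc n))))"
    unfolding S_def by (rule suminf_add) auto
  also have "\<dots> = (\<Sum>n. (ennreal (sphform (Suc n) \<mu> \<nu> / (2 * real (Suc n))) + ennreal (sphform (Suc n) \<mu> \<nu> / (2 * real (Suc n)))) + ennreal (sphdist (Suc n) \<mu> \<nu> / (2 * real (Suc n))))"
  proof (rule suminf_cong)
    fix n
    let ?c = "2 * real (Suc n)"
    have "sphform (Suc n) \<mu> \<mu> / ?c + sphform (Suc n) \<nu> \<nu> / ?c = sphform (Suc n) \<mu> \<nu> / ?c + sphform (Suc n) \<mu> \<nu> / ?c + sphdist (Suc n) \<mu> \<nu> / ?c"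
      using sphform_polarization[of "Suc n" \<mu> \<nu>] by (simp add: field_simps del: of_nat_Suc)
    then show "ennreal (sphform (Suc n) \<mu> \<mu> / ?c) + ennreal (sphform (Suc n) \<nu> \<nu> / ?c) =
      ennreal (sphform (Suc n) \<mu> \<nu> / ?c) + ennreal (sphform (Suc n) \<mu> \<nu> / ?c) + ennreal (sphdist (Suc n) \<mu> \<nu> / ?c)"
      by (intro add3 f0 \<mu> \<nu> divide_nonneg_nonneg sphdist_nonneg) auto
  qed
  also have "\<dots> = (S \<mu> \<nu> + S \<mu> \<nu>) + energy_dist \<mu> \<nu>"
    unfolding S_def energy_dist_def by (rule suminf3)
  finally have Seq: "S \<mu> \<mu> + S \<nu> \<nu> = (S \<mu> \<nu> + S \<mu> \<nu>) + energy_dist \<mu> \<nu>" .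
  have e1: "lenergy D \<mu> \<mu> + ennreal (A + A) = ennreal (ln D) + S \<mu> \<mu>"
    using ser[OF \<mu> \<mu>] by (simp add: A_def S_def)
  have e2: "lenergy D \<nu> \<nu> + ennreal (B + B) = ennreal (ln D) + S \<nu> \<nu>"
    using ser[OF \<nu> \<nu>] by (simp add: B_def S_def)
  have e3: "lenergy D \<mu> \<nu> + ennreal (A + B) = ennreal (ln D) + S \<mu> \<nu>"
    using ser[OF \<mu> \<nu>] by (simp add: A_def B_def S_def)
  have "(lenergy D \<mu> \<mu> + lenergy D \<nu> \<nu>) + (ennreal (A + A) + ennreal (B + B)) =
    (lenergy D \<mu> \<mu> + ennreal (A + A)) + (lenergy D \<nu> \<nu> + ennreal (B + B))" by (simp add: ac_simps)
  also have "\<dots> = (ennreal (ln D) + ennreal (ln D)) + (S \<mu> \<mu> + S \<nu> \<nu>)" unfolding e1 e2 by (simp add: ac_simps)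
  also have "\<dots> = (ennreal (ln D) + S \<mu> \<nu>) + (ennreal (ln D) + S \<mu> \<nu>) + energy_dist \<mu> \<nu>"
    unfolding Seq by (simp add: ac_simps)
  also have "\<dots> = (lenergy D \<mu> \<nu> + lenergy D \<mu> \<nu> + energy_dist \<mu> \<nu>) + (ennreal (A + B) + ennreal (A + B))"
    unfolding e3[symmetric] by (simp add: ac_simps)
  also have "ennreal (A + B) + ennreal (A + B) = ennreal (A + A) + ennreal (B + B)"
    using AB by (simp add: ac_simps flip: ennreal_plus)
  finally show ?thesis
    using ennreal_add_left_cancel[of "ennreal (A + A) + ennreal (B + B)"]
    by (auto simp: mult_2 ac_simps simp flip: ennreal_plus)
qed

text \<open>Inverse stereographic projection onto the sphere of radius 1/2 about
  \<open>(0, 1/2)\<close> in the product of the plane and the line. The point \<open>z\<close> is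
  recovered as the first component divided by the second.\<close>

definition sphemb :: "complex \<Rightarrow> complex \<times> real" where
  "sphemb z = (z / of_real (1 + (cmod z)\<^sup>2), 1 / (1 + (cmod z)\<^sup>2))"

lemma continuous_on_sphemb: "continuous_on A sphemb"
proof -
  have "complex_of_real (1 + (cmod z)\<^sup>2) \<noteq> 0" for z unfolding of_real_eq_0_iff by simp
  then show ?thesis unfolding sphemb_def by (intro continuous_intros) auto
qed

text \<open>Multiplying by a coordinate of \<open>sphemb\<close> raises \<open>n\<close> by one and
  each exponent by at most one, so the constraint \<open>a, b \<le> n\<close> survives.\<close>

lemma sphmon_mult:
  "of_real (Re (z / of_real (1 + (cmod z)\<^sup>2))) * sphmon n a b z = (sphmon (Suc n) a (Suc b) z + sphmon (Suc n) (Suc a) b z) / 2"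
  "of_real (Im (z / of_real (1 + (cmod z)\<^sup>2))) * sphmon n a b z = (sphmon (Suc n) a (Suc b) z - sphmon (Suc n) (Suc a) b z) / (2 * \<i>)"
  "of_real (1 / (1 + (cmod z)\<^sup>2)) * sphmon n a b z = sphmon (Suc n) a b z"
proof -
  have R: "complex_of_real (Re z) = (z + cnj z) / 2" and I: "complex_of_real (Im z) = (z - cnj z) / (2 * \<i>)"
    by (auto simp: complex_eq_iff)
  have nz: "complex_of_real (1 + (cmod z)\<^sup>2) \<noteq> 0" unfolding of_real_eq_0_iff by simp
  define c where "c = complex_of_real (1 + (cmod z)\<^sup>2)"
  have s: "sphmon n a b z = cnj z ^ a * z ^ b / c ^ n" for n a b
    by (simp add: sphmon_def c_def)
  have nz: "c \<noteq> 0" using nz by (simp add: c_def)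
  have Rd: "of_real (Re (z / of_real (1 + (cmod z)\<^sup>2))) = of_real (Re z) / c"
    "of_real (Im (z / of_real (1 + (cmod z)\<^sup>2))) = of_real (Im z) / c"
    "of_real (1 / (1 + (cmod z)\<^sup>2)) = 1 / c"
    unfolding c_def Re_divide_of_real Im_divide_of_real by simp_all
  show "of_real (Re (z / of_real (1 + (cmod z)\<^sup>2))) * sphmon n a b z = (sphmon (Suc n) a (Suc b) z + sphmon (Suc n) (Suc a) b z) / 2"
    unfolding Rd s R using nz by (simp add: field_simps)
  show "of_real (Im (z / of_real (1 + (cmod z)\<^sup>2))) * sphmon n a b z = (sphmon (Suc n) a (Suc b) z - sphmon (Suc n) (Suc a) b z) / (2 * \<i>)"
    unfolding Rd s I using nz by (simp add: field_simps)
  show "of_real (1 / (1 + (cmod z)\<^sup>2)) * sphmon n a b z = sphmon (Suc n) a b z"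
    unfolding Rd s using nz by (simp add: field_simps)
qed

text \<open>The functions \<open>sphmon n a b\<close> with \<open>a, b \<le> n\<close> span the polynomials on the sphere, read in
  stereographic coordinates.\<close>

lemma sphmom_determine_measure:
  assumes \<mu>: "borel_prob_on (cball 0 \<rho>) \<mu>" and \<nu>: "borel_prob_on (cball 0 \<rho>) \<nu>"
    and eq: "\<And>n a b. a \<le> n \<Longrightarrow> b \<le> n \<Longrightarrow> sphmom n a b \<mu> = sphmom n a b \<nu>"
  shows "\<mu> = \<nu>"
proof -
  \<comment> \<open>Equality is demanded for \<open>h\<close> times every \<open>sphmon\<close>, not
    just for \<open>h\<close>: only this stronger property is stable under multiplication by
    coordinates, and hence by polynomials on the sphere.\<close>
  define H where "H h \<longleftrightarrow> continuous_on UNIV h \<and>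
    (\<forall>n a b. a \<le> n \<longrightarrow> b \<le> n \<longrightarrow> (\<integral>z. of_real (h z) * sphmon n a b z \<partial>\<mu>) = (\<integral>z. of_real (h z) * sphmon n a b z \<partial>\<nu>))"
    for h :: "complex \<Rightarrow> real"
  have int: "integrable \<mu> (\<lambda>z. of_real (h z) * sphmon n a b z)" "integrable \<nu> (\<lambda>z. of_real (h z) * sphmon n a b z)"
    if "continuous_on UNIV h" for h n a b
    by (rule integrable_continuous[OF \<mu> compact_cball] integrable_continuous[OF \<nu> compact_cball],
        intro continuous_intros that continuous_sphmon)+
  have HD: "continuous_on UNIV h" "a \<le> n \<Longrightarrow> b \<le> n \<Longrightarrow> (\<integral>z. of_real (h z) * sphmon n a b z \<partial>\<mu>) = (\<integral>z. of_real (h z) * sphmon n a b z \<partial>\<nu>)"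
    if "H h" for h n a b using that by (auto simp: H_def)
  have Hadd: "H (\<lambda>z. f z + g z)" if "H f" "H g" for f g
    unfolding H_def using HD[OF that(1)] HD[OF that(2)] int
    by (auto intro!: continuous_intros simp: distrib_right)
  have Hscale: "H (\<lambda>z. c * f z)" if "H f" for f c
    unfolding H_def using HD[OF that] by (auto intro!: continuous_intros simp: mult.assoc)
  have c1: "continuous_on UNIV (\<lambda>z. Re (fst (sphemb z)))" "continuous_on UNIV (\<lambda>z. Im (fst (sphemb z)))" "continuous_on UNIV (\<lambda>z. snd (sphemb z))"
    by (intro continuous_intros continuous_on_sphemb)+
  have HRe: "H (\<lambda>z. Re (fst (sphemb z)) * h z)" if h: "H h" for h
    unfolding H_def
  proof (intro conjI allI impI)
    show "continuous_on UNIV (\<lambda>z. Re (fst (sphemb z)) * h z)" by (intro continuous_intros c1 HD[OF h])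
    fix n a b :: nat assume ab: "a \<le> n" "b \<le> n"
    have e: "of_real (Re (fst (sphemb z)) * h z) * sphmon n a b z = (of_real (h z) * sphmon (Suc n) a (Suc b) z + of_real (h z) * sphmon (Suc n) (Suc a) b z) / 2" for z
      using arg_cong[OF sphmon_mult(1)[of z n a b], of "\<lambda>u. of_real (h z) * u"]
      by (simp add: sphemb_def distrib_left mult.commute mult.left_commute)
    show "(\<integral>z. of_real (Re (fst (sphemb z)) * h z) * sphmon n a b z \<partial>\<mu>) = (\<integral>z. of_real (Re (fst (sphemb z)) * h z) * sphmon n a b z \<partial>\<nu>)"
      unfolding e using int[OF HD(1)[OF h]] HD(2)[OF h] ab by simp
  qed
  have HIm: "H (\<lambda>z. Im (fst (sphemb z)) * h z)" if h: "H h" for h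
    unfolding H_def
  proof (intro conjI allI impI)
    show "continuous_on UNIV (\<lambda>z. Im (fst (sphemb z)) * h z)" by (intro continuous_intros c1 HD[OF h])
    fix n a b :: nat assume ab: "a \<le> n" "b \<le> n"
    have e: "of_real (Im (fst (sphemb z)) * h z) * sphmon n a b z = (of_real (h z) * sphmon (Suc n) a (Suc b) z - of_real (h z) * sphmon (Suc n) (Suc a) b z) / (2 * \<i>)" for z
      using arg_cong[OF sphmon_mult(2)[of z n a b], of "\<lambda>u. of_real (h z) * u"]
      by (simp add: sphemb_def right_diff_distrib mult.commute mult.left_commute)
    show "(\<integral>z. of_real (Im (fst (sphemb z)) * h z) * sphmon n a b z \<partial>\<mu>) = (\<integral>z. of_real (Im (fst (sphemb z)) * h z) * sphmon n a b z \<partial>\<nu>)"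
      unfolding e using int[OF HD(1)[OF h]] HD(2)[OF h] ab by simp
  qed
  have HW: "H (\<lambda>z. snd (sphemb z) * h z)" if h: "H h" for h
    unfolding H_def
  proof (intro conjI allI impI)
    show "continuous_on UNIV (\<lambda>z. snd (sphemb z) * h z)" by (intro continuous_intros c1 HD[OF h])
    fix n a b :: nat assume ab: "a \<le> n" "b \<le> n"
    have e: "of_real (snd (sphemb z) * h z) * sphmon n a b z = of_real (h z) * sphmon (Suc n) a b z" for z
      using arg_cong[OF sphmon_mult(3)[of z n a b], of "\<lambda>u. of_real (h z) * u"]
      by (simp add: sphemb_def mult.commute mult.left_commute)
    show "(\<integral>z. of_real (snd (sphemb z) * h z) * sphmon n a b z \<partial>\<mu>) = (\<integral>z. of_real (snd (sphemb z) * h z) * sphmon n a b z \<partial>\<nu>)"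
      unfolding e using HD(2)[OF h] ab by simp
  qed
  have step: "H (\<lambda>z. P (sphemb z) * h z)" if "real_polynomial_function P" "H h" for P h
    using that
  proof (induction P arbitrary: h rule: real_polynomial_function.induct)
    case (linear P)
    have lin: "P (\<zeta>, w) = P (1, 0) * Re \<zeta> + P (\<i>, 0) * Im \<zeta> + P (0, 1) * w" for \<zeta> w
    proof -
      have "(\<zeta>, w) = Re \<zeta> *\<^sub>R (1, 0) + Im \<zeta> *\<^sub>R (\<i>, 0) + w *\<^sub>R (0, 1)"
        by (simp add: complex_eq_iff)
      then have "P (\<zeta>, w) = P (Re \<zeta> *\<^sub>R (1, 0) + Im \<zeta> *\<^sub>R (\<i>, 0) + w *\<^sub>R (0, 1))" by metis
      also have "\<dots> = Re \<zeta> * P (1, 0) + Im \<zeta> * P (\<i>, 0) + w * P (0, 1)"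
        using bounded_linear.linear[OF linear(1)] by (simp only: linear_add linear_cmul real_scaleR_def)
      finally show ?thesis by (simp add: mult.commute)
    qed
    have "P (sphemb z) * h z = P (1, 0) * (Re (fst (sphemb z)) * h z) + P (\<i>, 0) * (Im (fst (sphemb z)) * h z) + P (0, 1) * (snd (sphemb z) * h z)" for z
      using lin[of "fst (sphemb z)" "snd (sphemb z)"] by (simp add: distrib_right mult.assoc)
    then show ?case using Hadd[OF Hadd[OF Hscale[OF HRe[OF linear(2)]] Hscale[OF HIm[OF linear(2)]]] Hscale[OF HW[OF linear(2)]]]
      by presburger
  next
    case (const c)
    then show ?case by (rule Hscale)
  next
    case (add f g)
    then show ?case using Hadd[OF add.IH(1)[OF add.prems] add.IH(2)[OF add.prems]] by (simp add: distrib_right)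
  next
    case (mult f g)
    show ?case using mult.IH(1)[OF mult.IH(2)[OF mult.prems]] by (simp add: mult.assoc)
  qed
  have H1: "H (\<lambda>_. 1)" unfolding H_def using eq by (simp add: sphmom_def)
  have poly: "(\<integral>z. P (sphemb z) \<partial>\<mu>) = (\<integral>z. P (sphemb z) \<partial>\<nu>)" if "real_polynomial_function P" for P
  proof -
    have "sphmon 0 0 0 = (\<lambda>z. 1)" by (simp add: sphmon_def fun_eq_iff)
    then have "(\<integral>z. complex_of_real (P (sphemb z)) \<partial>\<mu>) = (\<integral>z. complex_of_real (P (sphemb z)) \<partial>\<nu>)"
      using HD(2)[OF step[OF that H1], of 0 0 0] by simp
    then show ?thesis by (simp add: integral_complex_of_real)
  qed
  show ?thesis
  proof (rule measure_eqI_continuous[OF \<mu> \<nu>])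
    fix f :: "complex \<Rightarrow> real" assume f: "continuous_on UNIV f"
    interpret \<mu>: prob_space \<mu> using \<mu> by (rule borel_prob_onD)
    interpret \<nu>: prob_space \<nu> using \<nu> by (rule borel_prob_onD)
    let ?S = "sphemb ` cball 0 \<rho>"
    have S: "compact ?S" by (intro compact_continuous_image continuous_on_sphemb) auto
    have snd0: "snd x \<noteq> 0" if "x \<in> ?S" for x using that by (auto simp: sphemb_def)
    \<comment> \<open>\<open>f\<close> is moved to the compact image on the sphere, where
      polynomials approximate it uniformly by Stone-Weierstrass.\<close>
    have F: "continuous_on ?S (\<lambda>x. f (fst x / of_real (snd x)))"
    proof (rule continuous_on_compose2[OF f])
      show "continuous_on ?S (\<lambda>x. fst x / complex_of_real (snd x))"
        by (intro continuous_intros) (use snd0 of_real_eq_0_iff in blast)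
    qed simp
    have Ff: "f (fst (sphemb z) / of_real (snd (sphemb z))) = f z" for z
    proof -
      have "complex_of_real (1 + (cmod z)\<^sup>2) \<noteq> 0" unfolding of_real_eq_0_iff by simp
      then show ?thesis by (simp add: sphemb_def)
    qed
    have "\<bar>(\<integral>z. f z \<partial>\<mu>) - (\<integral>z. f z \<partial>\<nu>)\<bar> \<le> 0 + e" if "0 < e" for e
    proof -
      obtain P where P: "real_polynomial_function P" and Pe: "\<And>x. x \<in> ?S \<Longrightarrow> \<bar>f (fst x / of_real (snd x)) - P x\<bar> < e / 2"
        using Stone_Weierstrass_real_polynomial_function[OF S F, of "e / 2"] \<open>0 < e\<close> by auto
      have Pz: "\<bar>f z - P (sphemb z)\<bar> \<le> e / 2" if "z \<in> cball 0 \<rho>" for z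
        using Pe[of "sphemb z"] that Ff[of z] by auto
      have cP: "continuous_on UNIV (\<lambda>z. P (sphemb z))"
        using HD(1)[OF step[OF P H1]] by simp
      have b: "\<bar>(\<integral>z. f z \<partial>N) - (\<integral>z. P (sphemb z) \<partial>N)\<bar> \<le> e / 2" if N: "borel_prob_on (cball 0 \<rho>) N" for N
      proof -
        interpret N: prob_space N using N by (rule borel_prob_onD)
        have i: "integrable N f" "integrable N (\<lambda>z. P (sphemb z))"
          using integrable_continuous[OF N compact_cball f] integrable_continuous[OF N compact_cball cP] by auto
        have "\<bar>(\<integral>z. f z \<partial>N) - (\<integral>z. P (sphemb z) \<partial>N)\<bar> = \<bar>\<integral>z. f z - P (sphemb z) \<partial>N\<bar>" using i by simp
        also have "\<dots> \<le> (\<integral>z. \<bar>f z - P (sphemb z)\<bar> \<partial>N)" by (rule integral_abs_bound)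
        also have "\<dots> \<le> (\<integral>z. e / 2 \<partial>N)"
          by (rule integral_mono_AE) (use i borel_prob_on_AE[OF N borel_closed[OF closed_cball]] Pz in \<open>auto elim!: eventually_mono\<close>)
        finally show ?thesis by (simp add: N.prob_space)
      qed
      show ?thesis using b[OF \<mu>] b[OF \<nu>] poly[OF P] by linarith
    qed
    then have "\<bar>(\<integral>z. f z \<partial>\<mu>) - (\<integral>z. f z \<partial>\<nu>)\<bar> \<le> 0" by (rule field_le_epsilon)
    then show "(\<integral>z. f z \<partial>\<mu>) = (\<integral>z. f z \<partial>\<nu>)" by simp
  qed
qed

lemma weak_lim_sphmom:
  assumes lim: "weak_lim M \<sigma>" and M: "\<And>k. borel_prob_on (cball 0 \<rho>) (M k)" and \<sigma>: "borel_prob_on (cball 0 \<rho>) \<sigma>"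
  shows "(\<lambda>k. sphmom n a b (M k)) \<longlonglongrightarrow> sphmom n a b \<sigma>"
proof -
  have c: "continuous_on UNIV (\<lambda>z. Re (sphmon n a b z))" "continuous_on UNIV (\<lambda>z. Im (sphmon n a b z))"
    by (intro continuous_intros continuous_sphmon)+
  have e: "sphmom n a b N = Complex (\<integral>z. Re (sphmon n a b z) \<partial>N) (\<integral>z. Im (sphmon n a b z) \<partial>N)"
    if "borel_prob_on (cball 0 \<rho>) N" for N
    unfolding sphmom_def using integrable_sphmon[OF that compact_cball, of n a b]
    by (simp add: complex_eq_iff)
  show ?thesis unfolding e[OF M] e[OF \<sigma>]
    by (intro tendsto_Complex weak_limD[OF lim] c)
qed

text \<open>All terms of the double sum and of the series are nonnegative and the binomial
  coefficients are at least 1, so one moment difference can be singled out.\<close>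

lemma sphmom_le_energy_dist:
  assumes "a \<le> n" "b \<le> n" "0 < n"
  shows "ennreal ((cmod (sphmom n a b \<mu> - sphmom n a b \<nu>))\<^sup>2 / (2 * real n)) \<le> energy_dist \<mu> \<nu>"
proof -
  let ?t = "\<lambda>a b. real (n choose a) * real (n choose b) * (cmod (sphmom n a b \<mu> - sphmom n a b \<nu>))\<^sup>2"
  have Suc_n: "Suc (n - 1) = n" using assms by simp
  have "1 \<le> n choose a" "1 \<le> n choose b" using assms by (auto simp: Suc_le_eq)
  then have "1 * 1 \<le> real (n choose a) * real (n choose b)" by (intro mult_mono) auto
  then have "(cmod (sphmom n a b \<mu> - sphmom n a b \<nu>))\<^sup>2 \<le> ?t a b" using mult_right_mono[of 1 "real (n choose a) * real (n choose b)" "(cmod (sphmom n a b \<mu> - sphmom n a b \<nu>))\<^sup>2"] by simp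
  also have "\<dots> \<le> (\<Sum>b\<le>n. ?t a b)" by (rule member_le_sum) (use assms in auto)
  also have "\<dots> \<le> sphdist n \<mu> \<nu>" unfolding sphdist_def
    by (rule member_le_sum[where f="\<lambda>a. \<Sum>b\<le>n. ?t a b"]) (use assms in \<open>auto intro!: sum_nonneg\<close>)
  finally have "ennreal ((cmod (sphmom n a b \<mu> - sphmom n a b \<nu>))\<^sup>2 / (2 * real n)) \<le> ennreal (sphdist (Suc (n - 1)) \<mu> \<nu> / (2 * real (Suc (n - 1))))"
    unfolding Suc_n by (intro ennreal_leI divide_right_mono) auto
  also have "\<dots> \<le> energy_dist \<mu> \<nu>"
    unfolding energy_dist_def
    using sum_le_suminf[of "\<lambda>n. ennreal (sphdist (Suc n) \<mu> \<nu> / (2 * real (Suc n)))" "{n - 1}"] by (simp del: of_nat_Suc)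
  finally show ?thesis .
qed

text \<open>The energy distance dominates every moment difference and moments are weakly continuous,
  so the two limits share all moments.\<close>

lemma energy_dist_tendsto_0_imp_eq:
  assumes M: "\<And>k. borel_prob_on (cball 0 \<rho>) (M k)" "\<And>k. borel_prob_on (cball 0 \<rho>) (N k)"
    and \<sigma>: "borel_prob_on (cball 0 \<rho>) \<sigma>" "borel_prob_on (cball 0 \<rho>) \<tau>"
    and lim: "weak_lim M \<sigma>" "weak_lim N \<tau>"
    and d: "(\<lambda>k. energy_dist (M k) (N k)) \<longlonglongrightarrow> 0"
  shows "\<sigma> = \<tau>"
proof (rule sphmom_determine_measure[OF \<sigma>])
  fix n a b :: nat assume ab: "a \<le> n" "b \<le> n"
  show "sphmom n a b \<sigma> = sphmom n a b \<tau>"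
  \<comment> \<open>The series in \<open>energy_dist\<close> starts with the first kernel power. The
    only moment for \<open>n = 0\<close> is the total mass, which is 1 for both limits.\<close>
  proof (cases "n = 0")
    case True
    interpret \<sigma>: prob_space \<sigma> using \<sigma>(1) by (rule borel_prob_onD)
    interpret \<tau>: prob_space \<tau> using \<sigma>(2) by (rule borel_prob_onD)
    show ?thesis using True ab by (simp add: sphmom_def sphmon_def \<sigma>.prob_space \<tau>.prob_space)
  next
    case False
    let ?x = "\<lambda>k. (cmod (sphmom n a b (M k) - sphmom n a b (N k)))\<^sup>2 / (2 * real n)"
    have "(\<lambda>k. ennreal (?x k)) \<longlonglongrightarrow> 0"
      by (rule tendsto_sandwich[OF _ _ tendsto_const d]) (use sphmom_le_energy_dist[OF ab] False in auto)
    moreover have "(\<lambda>k. ennreal (?x k)) \<longlonglongrightarrow> ennreal ((cmod (sphmom n a b \<sigma> - sphmom n a b \<tau>))\<^sup>2 / (2 * real n))"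
      by (intro tendsto_ennrealI tendsto_intros weak_lim_sphmom[OF lim(1) M(1) \<sigma>(1)] weak_lim_sphmom[OF lim(2) M(2) \<sigma>(2)])
         (use False in auto)
    ultimately have "ennreal ((cmod (sphmom n a b \<sigma> - sphmom n a b \<tau>))\<^sup>2 / (2 * real n)) = 0"
      using LIMSEQ_unique by blast
    then have "(cmod (sphmom n a b \<sigma> - sphmom n a b \<tau>))\<^sup>2 / (2 * real n) \<le> 0"
      by (simp add: ennreal_eq_0_iff)
    then have "(cmod (sphmom n a b \<sigma> - sphmom n a b \<tau>))\<^sup>2 \<le> 0" using False by (simp add: divide_le_0_iff)
    then show ?thesis by simp
  qed
qed

lemma energy_dist_eq_0_imp_eq:
  assumes "borel_prob_on (cball 0 \<rho>) \<mu>" "borel_prob_on (cball 0 \<rho>) \<nu>" "energy_dist \<mu> \<nu> = 0"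
  shows "\<mu> = \<nu>"
  by (rule energy_dist_tendsto_0_imp_eq[of \<rho> "\<lambda>_. \<mu>" "\<lambda>_. \<nu>"]) (use assms in \<open>auto simp: weak_lim_def\<close>)

section \<open>Energy and support of weak limits\<close>

lemma lenergy_mutual_le:
  assumes "2 * \<rho> \<le> D" "1 \<le> D" "borel_prob_on (cball 0 \<rho>) \<mu>" "borel_prob_on (cball 0 \<rho>) \<nu>"
    and "lenergy D \<mu> \<mu> \<le> c" "lenergy D \<nu> \<nu> \<le> c"
  shows "lenergy D \<mu> \<nu> \<le> c"
proof -
  have "2 * lenergy D \<mu> \<nu> \<le> lenergy D \<mu> \<mu> + lenergy D \<nu> \<nu>"
    unfolding lenergy_polarization[OF assms(1-4)] by simp
  also have "\<dots> \<le> 2 * c" using add_mono[OF assms(5,6)] by (simp add: mult_2)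
  finally show ?thesis by (subst (asm) ennreal_mult_le_mult_iff) auto
qed

text \<open>The hypothesis concerns only distinct indices, so it can hold for measures with atoms, whose own
  energy is infinite.\<close>

lemma lenergy_lsc_diagonal:
  assumes \<rho>: "0 < \<rho>" "2 * \<rho> \<le> D" "1 \<le> D"
    and M: "\<And>k. borel_prob_on (cball 0 \<rho>) (M k)" and \<sigma>: "borel_prob_on (cball 0 \<rho>) \<sigma>"
    and lim: "weak_lim M \<sigma>"
    and le: "\<And>j. \<forall>\<^sub>F k in sequentially. lenergy D (M k) (M j) \<le> c"
  shows "lenergy D \<sigma> \<sigma> \<le> c"
proof -
  \<comment> \<open>The limit is taken in one variable at a time: first \<open>k\<close> with
    \<open>j\<close> fixed, then \<open>j\<close> after exchanging the arguments.\<close>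
  have "lenergy D \<sigma> (M j) \<le> c" for j
    by (rule lenergy_lsc[OF \<rho>(1,2) M \<sigma> M lim le])
  then have "lenergy D (M j) \<sigma> \<le> c" for j using lenergy_commute[OF M \<sigma>] by simp
  then show ?thesis by (intro lenergy_lsc[OF \<rho>(1,2) M \<sigma> \<sigma> lim]) auto
qed

lemma weak_lim_shift: "weak_lim M \<sigma> \<Longrightarrow> weak_lim (\<lambda>k. M (k + N)) \<sigma>"
  using weak_lim_subseq[of M \<sigma> "\<lambda>k. k + N"] by (simp add: strict_mono_def o_def)

text \<open>A bound for the self-energies bounds the mutual energies, by
  \<open>lenergy_mutual_le\<close>, so the version for distinct indices applies after finitely many
  terms have been dropped.\<close>

lemma lenergy_lsc_self:
  assumes \<rho>: "0 < \<rho>" "2 * \<rho> \<le> D" "1 \<le> D"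
    and M: "\<And>k. borel_prob_on (cball 0 \<rho>) (M k)" and \<sigma>: "borel_prob_on (cball 0 \<rho>) \<sigma>"
    and lim: "weak_lim M \<sigma>"
    and le: "\<forall>\<^sub>F k in sequentially. lenergy D (M k) (M k) \<le> c"
  shows "lenergy D \<sigma> \<sigma> \<le> c"
proof -
  obtain N where N: "\<And>k. k \<ge> N \<Longrightarrow> lenergy D (M k) (M k) \<le> c"
    using le unfolding eventually_sequentially by blast
  show ?thesis
  proof (rule lenergy_lsc_diagonal[OF \<rho> _ \<sigma> weak_lim_shift[OF lim, of N]])
    show "borel_prob_on (cball 0 \<rho>) (M (k + N))" for k by (rule M)
    show "\<forall>\<^sub>F k in sequentially. lenergy D (M (k + N)) (M (j + N)) \<le> c" for j
      by (rule always_eventually, rule allI, rule lenergy_mutual_le[OF \<rho>(2,3) M M]) (simp_all add: N)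
  qed
qed

text \<open>The distance to \<open>C\<close> is a continuous test function whose integrals
  eventually vanish.\<close>

lemma weak_lim_support:
  assumes lim: "weak_lim M \<sigma>" and \<sigma>: "borel_prob_on (cball 0 \<rho>) \<sigma>"
    and M: "\<forall>\<^sub>F k in sequentially. borel_prob_on C (M k)" and C: "closed C" "C \<noteq> {}"
  shows "borel_prob_on C \<sigma>"
proof -
  let ?f = "\<lambda>z. infdist z C"
  have fc: "continuous_on UNIV ?f" by (intro continuous_intros)
  have "\<forall>\<^sub>F k in sequentially. (\<integral>z. ?f z \<partial>M k) = 0"
    using M
  proof eventually_elim
    case (elim k)
    have "AE z in M k. ?f z = 0"
      using borel_prob_on_AE[OF elim borel_closed[OF C(1)]] by eventually_elim simp
    then show ?case by (rule integral_eq_zero_AE)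
  qed
  then have "(\<lambda>k. \<integral>z. ?f z \<partial>M k) \<longlonglongrightarrow> 0" by (rule tendsto_eventually)
  with weak_limD[OF lim fc] have "(\<integral>z. ?f z \<partial>\<sigma>) = 0" using LIMSEQ_unique by blast
  then have "AE z in \<sigma>. ?f z = 0"
    by (subst (asm) integral_nonneg_eq_0_iff_AE)
       (auto intro: integrable_continuous[OF \<sigma> compact_cball fc] simp: infdist_nonneg)
  then have "AE z in \<sigma>. z \<in> C" by eventually_elim (use C in_closed_iff_infdist_zero in blast)
  then show ?thesis using borel_prob_onD[OF \<sigma>] C by (subst borel_prob_on_iff_AE) auto
qed

subsection \<open>Equilibrium measures\<close>

text \<open>The convex combination \<open>(1 - s) \<mu> + s \<nu>\<close>, realised by drawing one
  of the two measures with a Bernoulli variable so that the integral formula comes from the monadic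
  bind.\<close>

definition mixture :: "real \<Rightarrow> complex measure \<Rightarrow> complex measure \<Rightarrow> complex measure" where
  "mixture s \<mu> \<nu> = measure_pmf (bernoulli_pmf s) \<bind> (\<lambda>b. if b then \<nu> else \<mu>)"

lemma mixture_kernel:
  assumes "borel_prob_on C \<mu>" "borel_prob_on C' \<nu>"
  shows "(\<lambda>b. if b then \<nu> else \<mu>) \<in> measurable (measure_pmf p) (subprob_algebra borel)"
proof -
  have "\<mu> \<in> space (subprob_algebra borel)" "\<nu> \<in> space (subprob_algebra borel)"
    using borel_prob_onD[OF assms(1)] borel_prob_onD[OF assms(2)]
    by (auto simp: space_subprob_algebra intro: prob_space_imp_subprob_space)
  then show ?thesis by (auto simp: measurable_def)
qed

lemma nn_integral_mixture:
  assumes "borel_prob_on C \<mu>" "borel_prob_on C' \<nu>" "0 \<le> s" "s \<le> 1" "f \<in> borel_measurable borel"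
  shows "(\<integral>\<^sup>+z. f z \<partial>mixture s \<mu> \<nu>) = ennreal s * (\<integral>\<^sup>+z. f z \<partial>\<nu>) + ennreal (1 - s) * (\<integral>\<^sup>+z. f z \<partial>\<mu>)"
  unfolding mixture_def nn_integral_bind[OF assms(5) mixture_kernel[OF assms(1,2)]]
  using assms by (simp add: mult.commute)

lemma borel_prob_on_mixture:
  assumes \<mu>: "borel_prob_on C \<mu>" and \<nu>: "borel_prob_on C \<nu>" and s: "0 \<le> s" "s \<le> 1" and C: "C \<in> sets borel"
  shows "borel_prob_on C (mixture s \<mu> \<nu>)"
proof -
  have sets: "sets (mixture s \<mu> \<nu>) = sets borel"
    unfolding mixture_def by (rule sets_bind) (use borel_prob_onD[OF \<mu>] borel_prob_onD[OF \<nu>] in auto)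
  have em: "emeasure (mixture s \<mu> \<nu>) A = 1" if "A \<in> sets borel" "emeasure \<mu> A = 1" "emeasure \<nu> A = 1" for A
  proof -
    have s': "sets \<mu> = sets borel" "sets \<nu> = sets borel" using borel_prob_onD[OF \<mu>] borel_prob_onD[OF \<nu>] by auto
    have "emeasure (mixture s \<mu> \<nu>) A = (\<integral>\<^sup>+z. indicator A z \<partial>mixture s \<mu> \<nu>)"
      using that sets by (intro nn_integral_indicator[symmetric]) simp
    also have "\<dots> = ennreal s * 1 + ennreal (1 - s) * 1"
      using that s' by (subst nn_integral_mixture[OF \<mu> \<nu> s]) auto
    also have "\<dots> = 1" using s by (simp flip: ennreal_plus)
    finally show ?thesis .
  qed
  interpret \<mu>: prob_space \<mu> using \<mu> by (rule borel_prob_onD)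
  interpret \<nu>: prob_space \<nu> using \<nu> by (rule borel_prob_onD)
  have sp: "space (mixture s \<mu> \<nu>) = UNIV" using sets_eq_imp_space_eq[OF sets] by simp
  have "emeasure (mixture s \<mu> \<nu>) UNIV = 1"
    by (rule em) (use \<mu>.emeasure_space_1 \<nu>.emeasure_space_1 borel_prob_onD(2)[OF \<mu>] borel_prob_onD(2)[OF \<nu>] in auto)
  then interpret m: prob_space "mixture s \<mu> \<nu>" by (intro prob_spaceI) (simp add: sp)
  have "emeasure (mixture s \<mu> \<nu>) C = 1"
    by (rule em) (use C borel_prob_onD(4)[OF \<mu>] borel_prob_onD(4)[OF \<nu>] in \<open>auto simp: \<mu>.emeasure_eq_measure \<nu>.emeasure_eq_measure\<close>)
  then show ?thesis
    using sets m.prob_space_axioms by (simp add: borel_prob_on_def m.emeasure_eq_measure)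
qed

lemma lenergy_mixture:
  assumes \<mu>: "borel_prob_on C \<mu>" and \<nu>: "borel_prob_on C' \<nu>" and s: "0 \<le> s" "s \<le> 1"
  shows "lenergy D (mixture s \<mu> \<nu>) (mixture s \<mu> \<nu>) =
    ennreal s * (ennreal s * lenergy D \<nu> \<nu> + ennreal (1 - s) * lenergy D \<mu> \<nu>) +
    ennreal (1 - s) * (ennreal s * lenergy D \<mu> \<nu> + ennreal (1 - s) * lenergy D \<mu> \<mu>)"
proof -
  have [measurable]: "lpot D \<mu> \<in> borel_measurable borel" "lpot D \<nu> \<in> borel_measurable borel"
    using measurable_lpot \<mu> \<nu> by blast+
  have [measurable_cong]: "sets \<mu> = sets borel" "sets \<nu> = sets borel" using borel_prob_onD[OF \<mu>] borel_prob_onD[OF \<nu>] by auto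
  have pot: "lpot D (mixture s \<mu> \<nu>) z = ennreal s * lpot D \<nu> z + ennreal (1 - s) * lpot D \<mu> z" for z
    unfolding lpot_def by (rule nn_integral_mixture[OF \<mu> \<nu> s]) measurable
  have c: "lenergy D \<nu> \<mu> = lenergy D \<mu> \<nu>" by (rule lenergy_commute[OF \<nu> \<mu>])
  have "lenergy D (mixture s \<mu> \<nu>) (mixture s \<mu> \<nu>) =
     ennreal s * (\<integral>\<^sup>+z. ennreal s * lpot D \<nu> z + ennreal (1 - s) * lpot D \<mu> z \<partial>\<nu>) +
     ennreal (1 - s) * (\<integral>\<^sup>+z. ennreal s * lpot D \<nu> z + ennreal (1 - s) * lpot D \<mu> z \<partial>\<mu>)"
    unfolding lenergy_def[of D "mixture s \<mu> \<nu>"] pot by (rule nn_integral_mixture[OF \<mu> \<nu> s]) measurable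
  also have "(\<integral>\<^sup>+z. ennreal s * lpot D \<nu> z + ennreal (1 - s) * lpot D \<mu> z \<partial>\<nu>) = ennreal s * lenergy D \<nu> \<nu> + ennreal (1 - s) * lenergy D \<nu> \<mu>"
    unfolding lenergy_def by (simp add: nn_integral_add nn_integral_cmult)
  also have "(\<integral>\<^sup>+z. ennreal s * lpot D \<nu> z + ennreal (1 - s) * lpot D \<mu> z \<partial>\<mu>) = ennreal s * lenergy D \<mu> \<nu> + ennreal (1 - s) * lenergy D \<mu> \<mu>"
    unfolding lenergy_def by (simp add: nn_integral_add nn_integral_cmult)
  finally show ?thesis unfolding c .
qed

text \<open>\<open>lenergy\<close> has the opposite sign of the logarithmic energy, so equilibrium
  measures become minimisers. Finiteness excludes the polar case, in which every measure would be a
  minimiser.\<close>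

definition min_energy :: "real \<Rightarrow> complex set \<Rightarrow> complex measure \<Rightarrow> bool" where
  "min_energy D C \<omega> \<longleftrightarrow> borel_prob_on C \<omega> \<and> lenergy D \<omega> \<omega> < \<infinity> \<and>
     (\<forall>\<nu>. borel_prob_on C \<nu> \<longrightarrow> lenergy D \<omega> \<omega> \<le> lenergy D \<nu> \<nu>)"

text \<open>First variation: along the segment from \<open>\<omega>\<close> to \<open>\<nu>\<close>
  the energy is a quadratic polynomial in \<open>s\<close> with a minimum at \<open>s = 0\<close>,
  so its derivative there is nonnegative. In terms of the logarithmic potential of
  \<open>\<omega>\<close>, its mean under \<open>\<nu>\<close> is at most the equilibrium
  energy.\<close>

lemma min_energy_variation:
  assumes D: "2 * \<rho> \<le> D" "1 \<le> D" and C: "C \<subseteq> cball 0 \<rho>" "C \<in> sets borel"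
    and \<omega>: "min_energy D C \<omega>" and \<nu>: "borel_prob_on C \<nu>" and fin: "lenergy D \<nu> \<nu> < \<infinity>"
  shows "lenergy D \<omega> \<omega> \<le> lenergy D \<omega> \<nu>"
proof -
  have \<omega>C: "borel_prob_on C \<omega>" and \<omega>fin: "lenergy D \<omega> \<omega> < \<infinity>"
    and min: "\<And>\<nu>. borel_prob_on C \<nu> \<Longrightarrow> lenergy D \<omega> \<omega> \<le> lenergy D \<nu> \<nu>"
    using \<omega> by (auto simp: min_energy_def)
  have b: "borel_prob_on (cball 0 \<rho>) \<omega>" "borel_prob_on (cball 0 \<rho>) \<nu>"
    using borel_prob_on_mono[OF \<omega>C C] borel_prob_on_mono[OF \<nu> C] by auto
  have "2 * lenergy D \<omega> \<nu> \<le> lenergy D \<omega> \<omega> + lenergy D \<nu> \<nu>"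
    unfolding lenergy_polarization[OF D b] by simp
  also have "\<dots> < \<infinity>" using fin \<omega>fin by simp
  finally have xfin: "lenergy D \<omega> \<nu> < \<infinity>" by (auto simp: ennreal_mult_less_top)
  obtain e where e: "lenergy D \<omega> \<omega> = ennreal e" "0 \<le> e" using \<omega>fin by (cases "lenergy D \<omega> \<omega>") auto
  obtain x where x: "lenergy D \<omega> \<nu> = ennreal x" "0 \<le> x" using xfin by (cases "lenergy D \<omega> \<nu>") auto
  obtain v where v: "lenergy D \<nu> \<nu> = ennreal v" "0 \<le> v" using fin by (cases "lenergy D \<nu> \<nu>") auto
  \<comment> \<open>Minimality at the mixture with weight \<open>s\<close>, expanded and divided by
    \<open>s\<close>; letting \<open>s\<close> tend to 0 leaves \<open>e \<le> x\<close>.\<close>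
  have key: "2 * (e - x) \<le> s * (e - 2 * x + v)" if s: "0 < s" "s \<le> 1" for s
  proof -
    have "ennreal e \<le> lenergy D (mixture s \<omega> \<nu>) (mixture s \<omega> \<nu>)"
      unfolding e(1)[symmetric] using s by (intro min borel_prob_on_mixture[OF \<omega>C \<nu> _ _ C(2)]) auto
    also have "\<dots> = ennreal s * (ennreal s * ennreal v + ennreal (1 - s) * ennreal x) +
        ennreal (1 - s) * (ennreal s * ennreal x + ennreal (1 - s) * ennreal e)"
      unfolding e(1)[symmetric] x(1)[symmetric] v(1)[symmetric]
      using s by (intro lenergy_mixture[OF \<omega>C \<nu>]) auto
    also have "\<dots> = ennreal (s * (s * v + (1 - s) * x) + (1 - s) * (s * x + (1 - s) * e))"
      using s e(2) x(2) v(2) by (simp add: ennreal_mult ennreal_plus)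
    finally have "e \<le> s * (s * v + (1 - s) * x) + (1 - s) * (s * x + (1 - s) * e)"
      by (subst (asm) ennreal_le_iff) (use s e(2) x(2) v(2) in auto)
    then have "s * (2 * (e - x)) \<le> s * (s * (e - 2 * x + v))" by (simp add: algebra_simps)
    then show ?thesis using s by simp
  qed
  have "(\<lambda>n. 1 / real (Suc n) * (e - 2 * x + v)) \<longlonglongrightarrow> 0 * (e - 2 * x + v)"
    by (intro tendsto_intros lim_1_over_n[THEN LIMSEQ_Suc])
  moreover have "2 * (e - x) \<le> 1 / real (Suc n) * (e - 2 * x + v)" for n
    by (rule key) auto
  ultimately have "2 * (e - x) \<le> 0" by (intro LIMSEQ_le_const) auto
  then show ?thesis unfolding e(1) x(1) by (intro ennreal_leI) simp
qed

text \<open>Polarization shows that a mutual energy at least as large as both self-energies leaves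
  nothing for \<open>energy_dist\<close>. Finiteness is what permits the cancellation.\<close>

lemma energy_dist_eq_0I:
  assumes D: "2 * \<rho> \<le> D" "1 \<le> D"
    and \<mu>: "borel_prob_on (cball 0 \<rho>) \<mu>" and \<nu>: "borel_prob_on (cball 0 \<rho>) \<nu>"
    and le: "lenergy D \<mu> \<mu> \<le> lenergy D \<mu> \<nu>" "lenergy D \<nu> \<nu> \<le> lenergy D \<mu> \<nu>"
    and fin: "lenergy D \<mu> \<mu> < \<infinity>" "lenergy D \<nu> \<nu> < \<infinity>"
  shows "\<mu> = \<nu>"
proof -
  have eq: "lenergy D \<mu> \<mu> + lenergy D \<nu> \<nu> = 2 * lenergy D \<mu> \<nu> + energy_dist \<mu> \<nu>"
    by (rule lenergy_polarization[OF D \<mu> \<nu>])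
  have "2 * lenergy D \<mu> \<nu> \<le> lenergy D \<mu> \<mu> + lenergy D \<nu> \<nu>" unfolding eq by simp
  also have "\<dots> < \<infinity>" using fin by simp
  finally have x: "2 * lenergy D \<mu> \<nu> < \<infinity>" .
  have "2 * lenergy D \<mu> \<nu> + energy_dist \<mu> \<nu> \<le> 2 * lenergy D \<mu> \<nu> + 0"
    unfolding eq[symmetric] using add_mono[OF le] by (simp add: mult_2)
  then have "energy_dist \<mu> \<nu> \<le> 0" using x by (subst (asm) ennreal_add_left_cancel_le) auto
  then show ?thesis by (intro energy_dist_eq_0_imp_eq[OF \<mu> \<nu>]) simp
qed

lemma min_energy_unique:
  assumes D: "2 * \<rho> \<le> D" "1 \<le> D" and C: "C \<subseteq> cball 0 \<rho>" "C \<in> sets borel"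
    and \<omega>: "min_energy D C \<omega>" and \<omega>': "min_energy D C \<omega>'"
  shows "\<omega> = \<omega>'"
proof -
  have c: "borel_prob_on C \<omega>" "borel_prob_on C \<omega>'" "lenergy D \<omega> \<omega> < \<infinity>" "lenergy D \<omega>' \<omega>' < \<infinity>"
    "lenergy D \<omega> \<omega> = lenergy D \<omega>' \<omega>'"
    using \<omega> \<omega>' by (auto simp: min_energy_def intro: antisym)
  have "lenergy D \<omega> \<omega> \<le> lenergy D \<omega> \<omega>'"
    by (rule min_energy_variation[OF D C \<omega> c(2,4)])
  then show ?thesis
    by (intro energy_dist_eq_0I[OF D borel_prob_on_mono[OF c(1) C] borel_prob_on_mono[OF c(2) C]])
       (use c in auto)
qed

text \<open>Direct method: a weak limit of a minimising sequence stays on the closed set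
  \<open>C\<close>, and lower semicontinuity makes its energy minimal.\<close>

lemma min_energy_exists:
  assumes D: "0 < \<rho>" "2 * \<rho> \<le> D" "1 \<le> D" and C: "C \<subseteq> cball 0 \<rho>" "closed C"
    and \<nu>: "borel_prob_on C \<nu>" "lenergy D \<nu> \<nu> < \<infinity>"
  shows "\<exists>\<omega>. min_energy D C \<omega>"
proof -
  define m where "m = (INF \<nu>\<in>{\<nu>. borel_prob_on C \<nu>}. lenergy D \<nu> \<nu>)"
  have Cb: "C \<in> sets borel" using C by auto
  have C0: "C \<noteq> {}" using borel_prob_onD(4)[OF \<nu>(1)] by auto
  have "m \<le> lenergy D \<nu> \<nu>" unfolding m_def using \<nu> by (intro INF_lower) auto
  then have mfin: "m < \<infinity>" using \<nu>(2) by simp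
  have "\<exists>\<mu>. borel_prob_on C \<mu> \<and> lenergy D \<mu> \<mu> < m + ennreal (1 / real (Suc k))" for k
  proof -
    have "m < m + ennreal (1 / real (Suc k))"
      using mfin ennreal_add_left_cancel_less[of m 0] by (simp add: less_top[symmetric] del: of_nat_Suc)
    then show ?thesis unfolding m_def INF_less_iff by auto
  qed
  then obtain M where M: "\<And>k. borel_prob_on C (M k)" "\<And>k. lenergy D (M k) (M k) < m + ennreal (1 / real (Suc k))"
    by metis
  have Mb: "borel_prob_on (cball 0 \<rho>) (M k)" for k using borel_prob_on_mono[OF M(1) C(1) Cb] by simp
  obtain r \<sigma> where r: "strict_mono r" and \<sigma>: "borel_prob_on (cball 0 \<rho>) \<sigma>" and lim: "weak_lim (M \<circ> r) \<sigma>"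
    using weak_compactness[of \<rho> M, OF D(1) Mb] by (elim exE conjE) (rule that)
  have \<sigma>C: "borel_prob_on C \<sigma>"
    by (rule weak_lim_support[OF lim \<sigma> _ C(2) C0]) (simp add: M)
  have "lenergy D \<sigma> \<sigma> \<le> m + ennreal (1 / real (Suc j))" for j
  proof (rule lenergy_lsc_self[OF D _ \<sigma> lim])
    show "borel_prob_on (cball 0 \<rho>) ((M \<circ> r) k)" for k using Mb by simp
    show "\<forall>\<^sub>F k in sequentially. lenergy D ((M \<circ> r) k) ((M \<circ> r) k) \<le> m + ennreal (1 / real (Suc j))"
      using eventually_ge_at_top[of j]
    proof eventually_elim
      case (elim k)
      then have "j \<le> r k" using seq_suble[OF r, of k] by linarith
      then have "ennreal (1 / real (Suc (r k))) \<le> ennreal (1 / real (Suc j))"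
        by (intro ennreal_leI divide_left_mono) auto
      then show ?case using M(2)[of "r k"] unfolding o_def
        by (meson add_left_mono less_imp_le order_trans)
    qed
  qed
  moreover have "(\<lambda>j. m + ennreal (1 / real (Suc j))) \<longlonglongrightarrow> m + ennreal 0"
    by (intro tendsto_add tendsto_const tendsto_ennrealI lim_1_over_n[THEN LIMSEQ_Suc])
  ultimately have "lenergy D \<sigma> \<sigma> \<le> m" by (intro LIMSEQ_le_const[of "\<lambda>j. m + ennreal (1 / real (Suc j))"]) auto
  then have "min_energy D C \<sigma>"
    using \<sigma>C mfin unfolding min_energy_def m_def by (auto intro: INF_lower2 le_less_trans order_trans)
  then show ?thesis by blast
qed

section \<open>Translation between the extended logarithmic energy and the nonnegative
  kernel\<close>

lemma ext_integral_cong_AE: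
  assumes "AE x in \<mu>. f x = g x"
  shows "ext_integral \<mu> f = ext_integral \<mu> g"
proof -
  have "(\<integral>\<^sup>+x. e2ennreal (f x) \<partial>\<mu>) = (\<integral>\<^sup>+x. e2ennreal (g x) \<partial>\<mu>)"
    "(\<integral>\<^sup>+x. e2ennreal (- f x) \<partial>\<mu>) = (\<integral>\<^sup>+x. e2ennreal (- g x) \<partial>\<mu>)"
    using assms by (auto intro!: nn_integral_cong_AE elim!: eventually_mono)
  then show ?thesis by (simp add: ext_integral_def)
qed

text \<open>Positive part plus \<open>g\<close> equals \<open>c\<close> plus negative part,
  pointwise and hence after integration. The positive part is at most \<open>c\<close>, so the final
  difference makes sense even if \<open>g\<close> has infinite integral.\<close>

lemma ext_integral_const_minus:
  assumes "prob_space \<mu>" and [measurable]: "g \<in> borel_measurable \<mu>" and c: "0 \<le> c"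
  shows "ext_integral \<mu> (\<lambda>x. ereal c - enn2ereal (g x)) = ereal c - enn2ereal (\<integral>\<^sup>+x. g x \<partial>\<mu>)"
proof -
  interpret prob_space \<mu> by fact
  let ?p = "\<lambda>x. e2ennreal (ereal c - enn2ereal (g x))" and ?n = "\<lambda>x. e2ennreal (- (ereal c - enn2ereal (g x)))"
  have pw: "?p x + g x = ennreal c + ?n x" for x
  proof (cases "g x")
    case (real r)
    then show ?thesis using c
      by (cases "r \<le> c") (auto simp: e2ennreal_ereal ennreal_neg simp flip: ennreal_plus)
  next
    case top
    then show ?thesis by simp
  qed
  have [measurable]: "?p \<in> borel_measurable \<mu>" "?n \<in> borel_measurable \<mu>" by measurable
  have "(\<integral>\<^sup>+x. ?p x \<partial>\<mu>) + (\<integral>\<^sup>+x. g x \<partial>\<mu>) = (\<integral>\<^sup>+x. ?p x + g x \<partial>\<mu>)" by (rule nn_integral_add[symmetric]) auto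
  also have "\<dots> = ennreal c + (\<integral>\<^sup>+x. ?n x \<partial>\<mu>)"
    unfolding pw by (subst nn_integral_add) (auto simp: emeasure_space_1)
  finally have eq: "(\<integral>\<^sup>+x. ?p x \<partial>\<mu>) + (\<integral>\<^sup>+x. g x \<partial>\<mu>) = ennreal c + (\<integral>\<^sup>+x. ?n x \<partial>\<mu>)" .
  have "?p x \<le> ennreal c" for x
    using c by (cases "g x") (auto simp: e2ennreal_ereal e2ennreal_neg intro!: ennreal_leI)
  then have "(\<integral>\<^sup>+x. ?p x \<partial>\<mu>) \<le> (\<integral>\<^sup>+x. ennreal c \<partial>\<mu>)" by (intro nn_integral_mono)
  then have pf: "(\<integral>\<^sup>+x. ?p x \<partial>\<mu>) \<le> ennreal c" by (simp add: emeasure_space_1)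
  then obtain p where p: "(\<integral>\<^sup>+x. ?p x \<partial>\<mu>) = ennreal p" "0 \<le> p"
    by (cases "\<integral>\<^sup>+x. ?p x \<partial>\<mu>") (auto simp: top_unique)
  show ?thesis
  proof (cases "\<integral>\<^sup>+x. g x \<partial>\<mu>")
    case (real r)
    then have "(\<integral>\<^sup>+x. ?n x \<partial>\<mu>) \<noteq> \<infinity>" using eq p by (auto simp flip: ennreal_plus)
    then obtain n where n: "(\<integral>\<^sup>+x. ?n x \<partial>\<mu>) = ennreal n" "0 \<le> n" by (cases "\<integral>\<^sup>+x. ?n x \<partial>\<mu>") auto
    have "p + r = c + n" using eq unfolding p(1) n(1) real(2)
      using p(2) n(2) real(1) c by (simp flip: ennreal_plus)
    then show ?thesis unfolding ext_integral_def p(1) n(1) real(2)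
      using p(2) n(2) real(1) by (simp add: enn2ereal_ennreal)
  next
    case top
    then have "(\<integral>\<^sup>+x. ?n x \<partial>\<mu>) = \<infinity>"
      using eq by (cases "\<integral>\<^sup>+x. ?n x \<partial>\<mu>") (use c in \<open>auto simp flip: ennreal_plus\<close>)
    then show ?thesis unfolding ext_integral_def p(1) top using p(2) by (simp add: enn2ereal_ennreal)
  qed
qed

lemma log_dist_eq_lker:
  assumes "0 < D" "cmod (z - w) \<le> D"
  shows "log_dist z w = ereal (ln D) - enn2ereal (lker D z w)"
proof (cases "z = w")
  case False
  then have "0 \<le> ln D - ln (cmod (z - w))" "ln (D / cmod (z - w)) = ln D - ln (cmod (z - w))"
    using assms by (auto simp: ln_div)
  then show ?thesis using False by (simp add: log_dist_def lker_def enn2ereal_ennreal)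
qed (simp add: log_dist_def lker_def)

lemma log_potential_eq_lpot:
  assumes D: "2 * \<rho> \<le> D" "1 \<le> D" and \<mu>: "borel_prob_on (cball 0 \<rho>) \<mu>" and z: "cmod z \<le> \<rho>"
  shows "log_potential \<mu> z = ereal (ln D) - enn2ereal (lpot D \<mu> z)"
proof -
  have [measurable_cong]: "sets \<mu> = sets borel" using borel_prob_onD[OF \<mu>] by auto
  have "AE w in \<mu>. log_dist z w = ereal (ln D) - enn2ereal (lker D z w)"
    using borel_prob_on_AE[OF \<mu> borel_closed[OF closed_cball]]
  proof eventually_elim
    case (elim w)
    then show ?case using z D norm_triangle_ineq4[of z w] by (intro log_dist_eq_lker) auto
  qed
  then have "log_potential \<mu> z = ext_integral \<mu> (\<lambda>w. ereal (ln D) - enn2ereal (lker D z w))"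
    unfolding log_potential_def by (rule ext_integral_cong_AE)
  also have "\<dots> = ereal (ln D) - enn2ereal (lpot D \<mu> z)"
    unfolding lpot_def by (rule ext_integral_const_minus[OF borel_prob_onD(3)[OF \<mu>]]) (use D in auto)
  finally show ?thesis .
qed

lemma log_energy_eq_lenergy:
  assumes D: "2 * \<rho> \<le> D" "1 \<le> D" and \<mu>: "borel_prob_on (cball 0 \<rho>) \<mu>"
  shows "log_energy \<mu> = ereal (ln D) - enn2ereal (lenergy D \<mu> \<mu>)"
proof -
  have [measurable_cong]: "sets \<mu> = sets borel" using borel_prob_onD[OF \<mu>] by auto
  have [measurable]: "lpot D \<mu> \<in> borel_measurable borel" by (rule measurable_lpot[OF \<mu>])
  have "AE z in \<mu>. log_potential \<mu> z = ereal (ln D) - enn2ereal (lpot D \<mu> z)"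
    using borel_prob_on_AE[OF \<mu> borel_closed[OF closed_cball]]
    by eventually_elim (rule log_potential_eq_lpot[OF D \<mu>], simp)
  then have "log_energy \<mu> = ext_integral \<mu> (\<lambda>z. ereal (ln D) - enn2ereal (lpot D \<mu> z))"
    unfolding log_energy_def by (rule ext_integral_cong_AE)
  also have "\<dots> = ereal (ln D) - enn2ereal (lenergy D \<mu> \<mu>)"
    unfolding lenergy_def by (rule ext_integral_const_minus[OF borel_prob_onD(3)[OF \<mu>]]) (use D in auto)
  finally show ?thesis .
qed

lemma log_energy_le_iff:
  assumes D: "2 * \<rho> \<le> D" "1 \<le> D" and \<mu>: "borel_prob_on (cball 0 \<rho>) \<mu>" "borel_prob_on (cball 0 \<rho>) \<nu>"
  shows "log_energy \<mu> \<le> log_energy \<nu> \<longleftrightarrow> lenergy D \<nu> \<nu> \<le> lenergy D \<mu> \<mu>"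
  unfolding log_energy_eq_lenergy[OF D \<mu>(1)] log_energy_eq_lenergy[OF D \<mu>(2)]
  by (cases "lenergy D \<mu> \<mu>"; cases "lenergy D \<nu> \<nu>")
     (auto simp: enn2ereal_ennreal top_unique)

text \<open>A maximiser of the logarithmic energy inherits finite energy from
  \<open>\<omega>\<close>, so uniqueness of \<open>min_energy\<close> resolves the description
  operator. Since the left side does not mention \<open>D\<close>, the minimiser is the same for all
  admissible \<open>D\<close>.\<close>

lemma equilibrium_measure_eqI:
  assumes D: "2 * \<rho> \<le> D" "1 \<le> D" and C: "C \<subseteq> cball 0 \<rho>" "C \<in> sets borel"
    and \<omega>: "min_energy D C \<omega>"
  shows "equilibrium_measure C = \<omega>"
proof -
  have b: "borel_prob_on (cball 0 \<rho>) \<nu>" if "borel_prob_on C \<nu>" for \<nu>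
    using borel_prob_on_mono[OF that C] by simp
  have char: "borel_prob_on C \<mu> \<and> (\<forall>\<nu>. borel_prob_on C \<nu> \<longrightarrow> log_energy \<nu> \<le> log_energy \<mu>) \<longleftrightarrow>
     borel_prob_on C \<mu> \<and> (\<forall>\<nu>. borel_prob_on C \<nu> \<longrightarrow> lenergy D \<mu> \<mu> \<le> lenergy D \<nu> \<nu>)" for \<mu>
    using log_energy_le_iff[OF D b b] by blast
  show ?thesis
    unfolding equilibrium_measure_def char
  proof (rule the_equality)
    show "borel_prob_on C \<omega> \<and> (\<forall>\<nu>. borel_prob_on C \<nu> \<longrightarrow> lenergy D \<omega> \<omega> \<le> lenergy D \<nu> \<nu>)"
      using \<omega> by (simp add: min_energy_def)
    fix \<mu> assume \<mu>: "borel_prob_on C \<mu> \<and> (\<forall>\<nu>. borel_prob_on C \<nu> \<longrightarrow> lenergy D \<mu> \<mu> \<le> lenergy D \<nu> \<nu>)"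
    with \<omega> have "min_energy D C \<mu>" unfolding min_energy_def by (meson le_less_trans)
    then show "\<mu> = \<omega>" by (rule min_energy_unique[OF D C _ \<omega>])
  qed
qed

lemma nonpolar_finite_energy:
  assumes D: "2 * \<rho> \<le> D" "1 \<le> D" and C: "C \<subseteq> cball 0 \<rho>" "C \<in> sets borel" and np: "\<not> polar C"
  shows "\<exists>\<nu>. borel_prob_on C \<nu> \<and> lenergy D \<nu> \<nu> < \<infinity>"
proof -
  obtain C' \<nu> where C': "compact C'" "C' \<subseteq> C" and \<nu>: "borel_prob_on C' \<nu>" and e: "log_energy \<nu> \<noteq> - \<infinity>"
    using np unfolding polar_def by blast
  have \<nu>C: "borel_prob_on C \<nu>" by (rule borel_prob_on_mono[OF \<nu> C'(2) borel_compact[OF C'(1)] C(2)])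
  have "lenergy D \<nu> \<nu> < \<infinity>"
    using e unfolding log_energy_eq_lenergy[OF D borel_prob_on_mono[OF \<nu>C C borel_closed[OF closed_cball]]]
    by (cases "lenergy D \<nu> \<nu>") auto
  with \<nu>C show ?thesis by blast
qed

subsection \<open>Uniform measures on circles\<close>

definition circle_measure :: "complex \<Rightarrow> real \<Rightarrow> complex measure" where
  "circle_measure z r = distr (restrict_space lborel {0..1}) borel (circlepath z r)"

lemma continuous_on_circlepath: "continuous_on A (circlepath z r)"
  unfolding circlepath by (intro continuous_intros)

lemma measurable_circlepath: "circlepath z r \<in> borel_measurable (restrict_space lborel {0..1})"
proof -
  have "circlepath z r \<in> borel_measurable borel"
    by (intro borel_measurable_continuous_onI continuous_on_circlepath)
  then show ?thesis by (intro measurable_restrict_space1) simp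
qed

lemma circlepath_in_sphere: "0 \<le> r \<Longrightarrow> circlepath z r t \<in> sphere z r"
  by (simp add: circlepath dist_norm norm_mult)

lemma borel_prob_on_circle_measure:
  assumes "0 \<le> r"
  shows "borel_prob_on (sphere z r) (circle_measure z r)"
proof -
  interpret prob_space "restrict_space lborel {0..1::real}" by (rule prob_space_restrict_space) auto
  have "AE t in restrict_space lborel {0..1}. circlepath z r t \<in> sphere z r"
    using circlepath_in_sphere[OF assms] by (intro AE_I2) auto
  then show ?thesis
    unfolding circle_measure_def
    by (subst borel_prob_on_iff_AE)
       (auto intro!: prob_space_distr measurable_circlepath simp: AE_distr_iff[OF measurable_circlepath])
qed

text \<open>Cauchy's formula at the centre: the derivative of the path is
  \<open>2 * pi * \<i>\<close> times \<open>circlepath z r t - z\<close>, which cancels the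
  denominator.\<close>

lemma circle_mean_holomorphic:
  assumes f: "f holomorphic_on cball z r" and r: "0 < r"
    and m: "f \<in> borel_measurable borel"
  shows "(\<integral>w. f w \<partial>circle_measure z r) = f z"
proof -
  have c: "continuous_on {0..1} (\<lambda>t. f (circlepath z r t))"
    by (rule continuous_on_compose2[OF holomorphic_on_imp_continuous_on[OF f] continuous_on_circlepath])
       (use circlepath_in_sphere[of r z] r in fastforce)
  have "((\<lambda>u. f u / (u - z)) has_contour_integral (2 * of_real pi * \<i> * f z)) (circlepath z r)"
    by (rule Cauchy_integral_circlepath_simple[OF f]) (use r in simp)
  then have "((\<lambda>t. f (circlepath z r t) / (circlepath z r t - z) * vector_derivative (circlepath z r) (at t within {0..1}))
      has_integral (2 * of_real pi * \<i> * f z)) {0..1}"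
    by (simp add: has_contour_integral_def)
  then have "((\<lambda>t. (2 * of_real pi * \<i>) * f (circlepath z r t)) has_integral (2 * of_real pi * \<i>) * f z) {0..1}"
  proof (rule has_integral_eq[rotated])
    fix t :: real assume "t \<in> {0..1}"
    then have "vector_derivative (circlepath z r) (at t within {0..1}) = 2 * pi * \<i> * (circlepath z r t - z)"
      by (simp add: vector_derivative_circlepath01) (simp add: circlepath)
    moreover have "circlepath z r t - z \<noteq> 0" using r by (simp add: circlepath)
    ultimately show "f (circlepath z r t) / (circlepath z r t - z) * vector_derivative (circlepath z r) (at t within {0..1}) =
        (2 * of_real pi * \<i>) * f (circlepath z r t)"
      by simp
  qed
  then have "((\<lambda>t. inverse (2 * of_real pi * \<i>) * ((2 * of_real pi * \<i>) * f (circlepath z r t))) has_integral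
      inverse (2 * of_real pi * \<i>) * ((2 * of_real pi * \<i>) * f z)) {0..1}"
    by (rule has_integral_mult_right)
  then have "((\<lambda>t. f (circlepath z r t)) has_integral f z) {0..1}"
    by (simp add: field_simps)
  then have "integral {0..1} (\<lambda>t. f (circlepath z r t)) = f z" by (rule integral_unique)
  moreover have "(\<integral>w. f w \<partial>circle_measure z r) = (\<integral>t. f (circlepath z r t) \<partial>restrict_space lborel {0..1})"
    unfolding circle_measure_def by (rule integral_distr[OF measurable_circlepath m])
  moreover have "\<dots> = (LINT t:{0..1}|lborel. f (circlepath z r t))"
    unfolding set_lebesgue_integral_def by (rule integral_restrict_space) simp
  moreover have "\<dots> = integral {0..1} (\<lambda>t. f (circlepath z r t))"
    by (rule set_borel_integral_eq_integral(2)[OF borel_integrable_atLeastAtMost'[OF c]])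
  ultimately show ?thesis by simp
qed

text \<open>On the closed disc \<open>1 - b * (w - z)\<close> has positive real part, so the
  integrand is the real part of a principal logarithm that vanishes at the centre.\<close>

lemma circle_mean_ln_aux:
  assumes r: "0 < r" and b: "cmod b * r < 1"
  shows "(\<integral>w. ln (cmod (1 - b * (w - z))) \<partial>circle_measure z r) = 0"
proof -
  have pos: "0 < Re (1 - b * (w - z))" if "w \<in> cball z r" for w
  proof -
    have "cmod (b * (w - z)) \<le> cmod b * r"
      using that by (auto simp: norm_mult dist_norm norm_minus_commute intro!: mult_left_mono)
    then show ?thesis using b abs_Re_le_cmod[of "b * (w - z)"] by simp
  qed
  have npos: "1 - b * (w - z) \<notin> \<real>\<^sub>\<le>\<^sub>0" if "w \<in> cball z r" for w
    using pos[OF that] by (auto simp: complex_nonpos_Reals_iff)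
  \<comment> \<open>Cutting off outside the closed disc makes \<open>f\<close> Borel on the whole
    plane without changing it where the circle measure lives.\<close>
  define f where "f w = (if w \<in> cball z r then Ln (1 - b * (w - z)) else 0)" for w
  have h: "(\<lambda>w. Ln (1 - b * (w - z))) holomorphic_on cball z r"
    by (intro holomorphic_intros) (use npos in auto)
  then have hf: "f holomorphic_on cball z r"
    by (rule holomorphic_transform) (simp add: f_def)
  have "(\<lambda>w. indicator (cball z r) w *\<^sub>R Ln (1 - b * (w - z))) \<in> borel_measurable borel"
    using holomorphic_on_imp_continuous_on[OF h] by (intro borel_measurable_continuous_on_indicator) auto
  moreover have "(\<lambda>w. indicator (cball z r) w *\<^sub>R Ln (1 - b * (w - z))) = f"
    by (auto simp: f_def fun_eq_iff)
  ultimately have m[measurable]: "f \<in> borel_measurable borel" by simp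
  have "(\<integral>w. f w \<partial>circle_measure z r) = f z" by (rule circle_mean_holomorphic[OF hf r m])
  also have "f z = 0" using r by (simp add: f_def)
  finally have 0: "(\<integral>w. f w \<partial>circle_measure z r) = 0" .
  have AE: "AE w in circle_measure z r. w \<in> sphere z r"
    by (rule borel_prob_on_AE[OF borel_prob_on_circle_measure]) (use r in auto)
  have sets[measurable_cong]: "sets (circle_measure z r) = sets borel" by (simp add: circle_measure_def)
  have int: "integrable (circle_measure z r) f"
    by (rule integrable_continuous_on_compact[OF borel_prob_on_circle_measure])
       (use r m holomorphic_on_imp_continuous_on[OF hf] in \<open>auto intro: continuous_on_subset\<close>)
  have "(\<integral>w. ln (cmod (1 - b * (w - z))) \<partial>circle_measure z r) = (\<integral>w. Re (f w) \<partial>circle_measure z r)"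
  proof (rule integral_cong_AE)
    show "AE w in circle_measure z r. ln (cmod (1 - b * (w - z))) = Re (f w)"
      using AE
    proof eventually_elim
      case (elim w)
      then have "w \<in> cball z r" by auto
      moreover have "1 - b * (w - z) \<noteq> 0" using pos[OF \<open>w \<in> cball z r\<close>] by (metis less_irrefl zero_complex.sel(1))
      ultimately show ?case by (simp add: f_def)
    qed
  qed measurable
  also have "\<dots> = Re (\<integral>w. f w \<partial>circle_measure z r)" using int by simp
  finally show ?thesis using 0 by simp
qed

text \<open>In each case a constant is pulled out of \<open>|x - w|\<close> so that
  \<open>circle_mean_ln_aux\<close> applies: \<open>|x - z|\<close> for \<open>x\<close> outside the
  circle, and \<open>r\<close> for \<open>x\<close> inside, where reflection in the circle turns the
  distance into one from an outer point.\<close>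

lemma circle_mean_ln:
  assumes r: "0 < r" and ne: "cmod (x - z) \<noteq> r"
  shows "(\<integral>w. ln (cmod (x - w)) \<partial>circle_measure z r) = ln (max r (cmod (z - x)))"
proof -
  have AE: "AE w in circle_measure z r. w \<in> sphere z r"
    by (rule borel_prob_on_AE[OF borel_prob_on_circle_measure]) (use r in auto)
  have sets[measurable_cong]: "sets (circle_measure z r) = sets borel" by (simp add: circle_measure_def)
  interpret prob_space "circle_measure z r" using borel_prob_onD(3)[OF borel_prob_on_circle_measure] r by simp
  have *: "(\<integral>w. ln (cmod (x - w)) \<partial>circle_measure z r) = ln c"
    if c: "0 < c" "cmod b * r < 1" and eq: "\<And>w. w \<in> sphere z r \<Longrightarrow> cmod (x - w) = c * cmod (1 - b * (w - z))" for b c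
  proof -
    have nz: "1 - b * (w - z) \<noteq> 0" if "w \<in> sphere z r" for w
      using that c(2) by (metis dist_commute dist_norm less_irrefl mem_sphere norm_mult norm_one right_minus_eq)
    have int: "integrable (circle_measure z r) (\<lambda>w. ln (cmod (1 - b * (w - z))))"
      by (rule integrable_continuous_on_compact[OF borel_prob_on_circle_measure])
         (use r nz in \<open>auto intro!: continuous_intros\<close>)
    have "(\<integral>w. ln (cmod (x - w)) \<partial>circle_measure z r) = (\<integral>w. ln c + ln (cmod (1 - b * (w - z))) \<partial>circle_measure z r)"
    proof (rule integral_cong_AE)
      show "AE w in circle_measure z r. ln (cmod (x - w)) = ln c + ln (cmod (1 - b * (w - z)))"
        using AE by eventually_elim (use c nz in \<open>simp add: eq ln_mult\<close>)
    qed measurable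
    also have "\<dots> = ln c" using int circle_mean_ln_aux[OF r c(2), of z] by (simp add: prob_space)
    finally show ?thesis .
  qed
  show ?thesis
  proof (cases "r < cmod (x - z)")
    case True
    then have xz: "x - z \<noteq> 0" using r by auto
    have "(\<integral>w. ln (cmod (x - w)) \<partial>circle_measure z r) = ln (cmod (x - z))"
    proof (rule *[of _ "1 / (x - z)"])
      show "cmod (1 / (x - z)) * r < 1" using True r xz divide_less_eq_1_pos[of "cmod (x - z)" r] by (simp add: norm_divide)
      fix w
      have "x - w = (x - z) * (1 - 1 / (x - z) * (w - z))" using xz by (simp add: field_simps)
      then show "cmod (x - w) = cmod (x - z) * cmod (1 - 1 / (x - z) * (w - z))" by (metis norm_mult)
    qed (use xz in simp)
    then show ?thesis using True by (simp add: norm_minus_commute max_def)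
  next
    case False
    then have lt: "cmod (x - z) < r" using ne by simp
    have "(\<integral>w. ln (cmod (x - w)) \<partial>circle_measure z r) = ln r"
    \<comment> \<open>\<open>b\<close> is the reciprocal of \<open>x' - z\<close> for the point
      \<open>x'\<close> reflected in the circle; if \<open>x\<close> is the centre, \<open>b\<close>
      is 0.\<close>
    proof (rule *[of _ "cnj (x - z) / complex_of_real (r\<^sup>2)"])
      show "cmod (cnj (x - z) / complex_of_real (r\<^sup>2)) * r < 1"
        using lt r by (simp add: norm_divide norm_mult power2_eq_square del: complex_cnj_diff of_real_power)
      fix w assume w: "w \<in> sphere z r"
      have "(w - z) * cnj (w - z) = of_real (r\<^sup>2)"
        using w by (subst complex_norm_square[symmetric]) (simp add: dist_norm norm_minus_commute)
      moreover have "cnj (w - x) * (w - z) = (w - z) * cnj (w - z) - cnj (x - z) * (w - z)"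
        by (simp add: algebra_simps)
      moreover have "of_real (r\<^sup>2) * (1 - cnj (x - z) / complex_of_real (r\<^sup>2) * (w - z)) = of_real (r\<^sup>2) - cnj (x - z) * (w - z)"
        using r by (simp add: right_diff_distrib del: of_real_power complex_cnj_diff)
      ultimately have "cnj (w - x) * (w - z) = of_real (r\<^sup>2) * (1 - cnj (x - z) / complex_of_real (r\<^sup>2) * (w - z))"
        by simp
      then have "cmod (cnj (w - x) * (w - z)) = r\<^sup>2 * cmod (1 - cnj (x - z) / complex_of_real (r\<^sup>2) * (w - z))"
        by (simp add: norm_mult norm_power)
      moreover have "cmod (cnj (w - x) * (w - z)) = cmod (x - w) * r"
        using w by (simp add: norm_mult dist_norm norm_minus_commute del: complex_cnj_diff)
      ultimately show "cmod (x - w) = r * cmod (1 - cnj (x - z) / complex_of_real (r\<^sup>2) * (w - z))"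
        using r by (simp add: power2_eq_square)
    qed (use r in simp)
    then show ?thesis using lt by (simp add: norm_minus_commute max_def)
  qed
qed

text \<open>On the circle itself the potential is obtained as a limit from the outside.\<close>

lemma tpot_circle_measure_ge:
  assumes r: "0 < r" and s: "0 < s"
  shows "ln (max r (cmod (z - x))) \<le> tpot s (circle_measure z r) x"
proof -
  have cm: "borel_prob_on (sphere z r) (circle_measure z r)" using borel_prob_on_circle_measure r by simp
  have sets[measurable_cong]: "sets (circle_measure z r) = sets borel" by (simp add: circle_measure_def)
  have off: "ln (max r (cmod (z - x))) \<le> tpot s (circle_measure z r) x" if ne: "cmod (x - z) \<noteq> r" for x
    unfolding circle_mean_ln[OF r ne, symmetric] tpot_def
  proof (rule integral_mono_AE)
    have nz: "x - w \<noteq> 0" if "w \<in> sphere z r" for w using that ne by (auto simp: dist_norm norm_minus_commute)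
    show "integrable (circle_measure z r) (\<lambda>w. ln (cmod (x - w)))"
      by (rule integrable_continuous_on_compact[OF cm]) (use r nz in \<open>auto intro!: continuous_intros\<close>)
    show "integrable (circle_measure z r) (\<lambda>w. ln (max s (cmod (x - w))))"
      by (rule integrable_ln_max[OF cm _ s]) simp
    show "AE w in circle_measure z r. ln (cmod (x - w)) \<le> ln (max s (cmod (x - w)))"
      using borel_prob_on_AE[OF cm borel_closed[OF closed_sphere]]
    proof eventually_elim
      case (elim w)
      then have "0 < cmod (x - w)" using nz[of w] by simp
      then show ?case using s by simp
    qed
  qed
  show ?thesis
  proof (cases "cmod (x - z) = r")
    case True
    define y where "y n = x + of_real (1 / real (Suc n)) * (x - z)" for n
    have "(\<lambda>n. complex_of_real (1 / real (Suc n))) \<longlonglongrightarrow> of_real 0"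
      by (intro tendsto_of_real lim_1_over_n[THEN LIMSEQ_Suc])
    then have "y \<longlonglongrightarrow> x + of_real 0 * (x - z)"
      unfolding y_def by (rule tendsto_add[OF tendsto_const tendsto_mult[OF _ tendsto_const]])
    then have y: "y \<longlonglongrightarrow> x" by simp
    have yne: "cmod (y n - z) \<noteq> r" for n
    proof -
      have "y n - z = of_real (1 + 1 / real (Suc n)) * (x - z)" by (simp add: y_def algebra_simps)
      then have "cmod (y n - z) = (1 + 1 / real (Suc n)) * r" using True by (simp only: norm_mult norm_of_real) simp
      then show ?thesis using r by simp
    qed
    have "continuous_on UNIV (\<lambda>x. ln (max r (cmod (z - x))))" using r by (rule continuous_ln_max)
    then have 1: "(\<lambda>n. ln (max r (cmod (z - y n)))) \<longlonglongrightarrow> ln (max r (cmod (z - x)))"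
      by (rule continuous_on_tendsto_compose[OF _ y]) auto
    have 2: "(\<lambda>n. tpot s (circle_measure z r) (y n)) \<longlonglongrightarrow> tpot s (circle_measure z r) x"
      by (rule continuous_on_tendsto_compose[OF continuous_tpot[OF cm _ s, of UNIV] y]) auto
    show ?thesis by (rule LIMSEQ_le[OF 1 2]) (use off yne in auto)
  qed (rule off)
qed

text \<open>By symmetry of the mutual energy, averaging the potential of \<open>\<mu>\<close> over
  the circle amounts to integrating the potential of the circle against \<open>\<mu>\<close>, and
  the latter is the kernel truncated at \<open>r\<close>.\<close>

lemma lenergy_circle_le:
  assumes D: "0 < \<rho>" "2 * \<rho> \<le> D" and \<mu>: "borel_prob_on (cball 0 \<rho>) \<mu>"
    and r: "0 < r" "cmod z + r \<le> \<rho>"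
  shows "lenergy D (circle_measure z r) \<mu> \<le> ennreal (ln D - tpot r \<mu> z)"
proof -
  have cm: "borel_prob_on (sphere z r) (circle_measure z r)" using borel_prob_on_circle_measure r by simp
  have "sphere z r \<subseteq> cball 0 \<rho>"
  proof
    fix w assume "w \<in> sphere z r"
    then show "w \<in> cball 0 \<rho>" using r norm_triangle_ineq[of z "w - z"] by (simp add: dist_norm norm_minus_commute)
  qed
  then have cb: "borel_prob_on (cball 0 \<rho>) (circle_measure z r)"
    by (intro borel_prob_on_mono[OF cm]) auto
  have "lpot D (circle_measure z r) x \<le> ennreal (ln (D / max r (cmod (z - x))))" if x: "x \<in> cball 0 \<rho>" for x
  proof -
    have "ln (D / max r (cmod (z - x))) = ln D - ln (max r (cmod (z - x)))"
      using D r by (subst ln_div) (auto simp: less_max_iff_disj)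
    then show ?thesis
      using x D r tpot_circle_measure_ge[OF r(1), of "D / real (Suc _)" z x]
      by (subst lpot_eq_SUP[OF cb]) (auto intro!: SUP_least ennreal_leI simp del: of_nat_Suc)
  qed
  then have "lenergy D \<mu> (circle_measure z r) \<le> (\<integral>\<^sup>+x. ennreal (ln (D / max r (cmod (z - x)))) \<partial>\<mu>)"
    unfolding lenergy_def
    by (intro nn_integral_mono_AE) (use borel_prob_on_AE[OF \<mu> borel_closed[OF closed_cball]] in \<open>auto elim!: eventually_mono\<close>)
  also have "\<dots> = ennreal (ln D - tpot r \<mu> z)"
    by (rule nn_integral_truncated[OF \<mu>]) (use r D norm_ge_zero[of z] in \<open>auto simp del: norm_ge_zero\<close>)
  finally show ?thesis by (simp add: lenergy_commute[OF cb \<mu>])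
qed

text \<open>The circle mean of the logarithmic potential of \<open>\<mu>\<close> is at least
  \<open>tpot r \<mu> z\<close> by \<open>lenergy_circle_le\<close>, so an upper bound
  \<open>G\<close> on the circle passes to the centre. The hypothesis on \<open>G\<close> is an
  inequality in \<open>ennreal\<close> and therefore holds trivially at zeros of a polynomial, where
  \<open>lpot\<close> is infinite.\<close>

lemma tpot_le_circle_mean:
  assumes D: "0 < \<rho>" "2 * \<rho> \<le> D" and \<mu>: "borel_prob_on (cball 0 \<rho>) \<mu>"
    and r: "0 < r" "cmod z + r \<le> \<rho>"
    and G: "integrable (circle_measure z r) G"
    and le: "\<And>w. w \<in> sphere z r \<Longrightarrow> ennreal (ln D - G w) \<le> lpot D \<mu> w"
  shows "tpot r \<mu> z \<le> (\<integral>w. G w \<partial>circle_measure z r)"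
proof -
  have cm: "borel_prob_on (sphere z r) (circle_measure z r)" using borel_prob_on_circle_measure r by simp
  interpret prob_space "circle_measure z r" using borel_prob_onD(3)[OF cm] .
  have i: "integrable (circle_measure z r) (\<lambda>w. ln D - G w)" using G by simp
  have "ennreal (\<integral>w. ln D - G w \<partial>circle_measure z r) \<le> (\<integral>\<^sup>+w. ennreal (ln D - G w) \<partial>circle_measure z r)"
  proof -
    have "ennreal (\<integral>w. ln D - G w \<partial>circle_measure z r) \<le> ennreal (\<integral>w. max 0 (ln D - G w) \<partial>circle_measure z r)"
      by (intro ennreal_leI integral_mono) (use i in auto)
    also have "\<dots> = (\<integral>\<^sup>+w. ennreal (max 0 (ln D - G w)) \<partial>circle_measure z r)"
      by (rule nn_integral_eq_integral[symmetric]) (use i in auto)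
    finally show ?thesis by simp
  qed
  also have "\<dots> \<le> lenergy D (circle_measure z r) \<mu>"
    unfolding lenergy_def
    by (intro nn_integral_mono_AE) (use borel_prob_on_AE[OF cm borel_closed[OF closed_sphere]] le in \<open>auto elim!: eventually_mono\<close>)
  also have "\<dots> \<le> ennreal (ln D - tpot r \<mu> z)" by (rule lenergy_circle_le[OF D \<mu> r])
  finally have "ennreal (ln D - (\<integral>w. G w \<partial>circle_measure z r)) \<le> ennreal (ln D - tpot r \<mu> z)"
    using G by (simp add: prob_space)
  moreover have "tpot r \<mu> z \<le> ln D"
    by (rule tpot_le_ln[OF \<mu>]) (use r D norm_ge_zero[of z] in \<open>auto simp del: norm_ge_zero\<close>)
  ultimately show ?thesis by (subst (asm) ennreal_le_iff) auto
qed

subsection \<open>Zero measures of polynomials\<close>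

text \<open>A uniformly random position in a list of the roots counts multiplicities. The choice of
  the list is harmless, because integrals depend only on the multiset.\<close>

definition zero_measure :: "complex poly \<Rightarrow> complex measure" where
  "zero_measure p = distr (measure_pmf (pmf_of_set {..<degree p})) borel (\<lambda>i. (SOME xs. mset xs = proots p) ! i)"

lemma integral_zero_measure:
  fixes f :: "complex \<Rightarrow> real"
  assumes p: "0 < degree p" and [measurable]: "f \<in> borel_measurable borel"
  shows "(\<integral>z. f z \<partial>zero_measure p) = (\<Sum>z\<in>#proots p. f z) / real (degree p)"
proof -
  define xs where "xs = (SOME xs. mset xs = proots p)"
  have xs: "mset xs = proots p" unfolding xs_def by (rule someI_ex) (rule ex_mset)
  have len: "length xs = degree p" using xs size_proots_complex[of p] by (metis size_mset)
  have "(\<integral>z. f z \<partial>zero_measure p) = (\<integral>i. f (xs ! i) \<partial>measure_pmf (pmf_of_set {..<degree p}))"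
    unfolding zero_measure_def xs_def[symmetric] by (rule integral_distr) auto
  also have "\<dots> = (\<Sum>i<degree p. f (xs ! i)) / real (card {..<degree p})"
    by (rule integral_pmf_of_set) (use p in auto)
  also have "(\<Sum>i<degree p. f (xs ! i)) = (\<Sum>z\<leftarrow>xs. f z)"
    by (simp add: sum_list_sum_nth len atLeast0LessThan)
  also have "(\<Sum>z\<leftarrow>xs. f z) = (\<Sum>z\<in>#proots p. f z)"
    unfolding xs[symmetric] mset_map[symmetric] sum_mset_sum_list ..
  finally show ?thesis by simp
qed

lemma borel_prob_on_zero_measure:
  assumes p: "0 < degree p" and C: "{z. poly p z = 0} \<subseteq> C" "C \<in> sets borel"
  shows "borel_prob_on C (zero_measure p)"
proof -
  define xs where "xs = (SOME xs. mset xs = proots p)"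
  have xs: "mset xs = proots p" unfolding xs_def by (rule someI_ex) (rule ex_mset)
  have len: "length xs = degree p" using xs size_proots_complex[of p] by (metis size_mset)
  have p0: "p \<noteq> 0" using p by auto
  have "set xs = {z. poly p z = 0}" using set_count_proots[OF p0] by (simp flip: xs)
  then have "xs ! i \<in> C" if "i < degree p" for i using that C(1) len nth_mem[of i xs] by auto
  then have AE: "AE i in measure_pmf (pmf_of_set {..<degree p}). xs ! i \<in> C"
    using p by (subst AE_measure_pmf_iff) (auto simp: set_pmf_of_set lessThan_empty_iff)
  have "prob_space (zero_measure p)"
    unfolding zero_measure_def by (rule prob_space.prob_space_distr) (auto intro: prob_space_measure_pmf)
  moreover have "AE z in zero_measure p. z \<in> C"
    using AE C unfolding zero_measure_def xs_def[symmetric] by (subst AE_distr_iff) auto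
  ultimately show ?thesis by (subst borel_prob_on_iff_AE[OF C(2)]) (simp add: zero_measure_def)
qed

lemma closed_zero_set: "closed {z. poly p z = (0::complex)}"
  using continuous_closed_vimage[of "{0}" "poly p"] by (simp add: vimage_def)

lemma norm_poly_eq_prod_mset:
  fixes p :: "complex poly"
  shows "cmod (poly p z) = cmod (lead_coeff p) * (\<Prod>x\<in>#proots p. cmod (z - x))"
proof -
  have *: "cmod (poly (\<Prod>x\<in>#A. [:-x, 1:]) z) = (\<Prod>x\<in>#A. cmod (z - x))" for A
    by (induction A) (simp_all add: norm_mult flip: left_diff_distrib)
  have "cmod (poly p z) = cmod (poly (smult (lead_coeff p) (\<Prod>x\<in>#proots p. [:-x, 1:])) z)"
    by (simp add: complex_poly_decompose_multiset)
  then show ?thesis by (simp add: norm_mult *)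
qed

lemma ln_prod_mset:
  assumes "\<And>x. x \<in># A \<Longrightarrow> 0 < f x"
  shows "ln (\<Prod>x\<in>#A. f x) = (\<Sum>x\<in>#A. ln (f x :: real)) \<and> 0 < (\<Prod>x\<in>#A. f x)"
  using assms
proof (induction A)
  case (add x A)
  have "0 < f x" "ln (\<Prod>x\<in>#A. f x) = (\<Sum>x\<in>#A. ln (f x))" "0 < (\<Prod>x\<in>#A. f x)" using add by auto
  then show ?case using ln_mult_pos[of "f x" "\<Prod>x\<in>#A. f x"] by simp
qed simp

lemma ln_norm_poly:
  fixes p :: "complex poly"
  assumes "poly p z \<noteq> 0"
  shows "ln (cmod (poly p z)) = ln (cmod (lead_coeff p)) + (\<Sum>x\<in>#proots p. ln (cmod (z - x)))"
proof -
  have p0: "p \<noteq> 0" using assms by auto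
  have pos: "0 < cmod (z - x)" if "x \<in># proots p" for x
    using that assms p0 by auto
  have *: "ln (\<Prod>x\<in>#proots p. cmod (z - x)) = (\<Sum>x\<in>#proots p. ln (cmod (z - x)))" "0 < (\<Prod>x\<in>#proots p. cmod (z - x))"
    using ln_prod_mset[of "proots p" "\<lambda>x. cmod (z - x)"] pos by auto
  show ?thesis unfolding norm_poly_eq_prod_mset[of p z]
    using * p0 ln_mult_pos[of "cmod (lead_coeff p)" "\<Prod>x\<in>#proots p. cmod (z - x)"] by simp
qed

lemma tpot_zero_measure_ge:
  assumes p: "0 < degree p" and z: "poly p z \<noteq> 0" and s: "0 < s"
  shows "(ln (cmod (poly p z)) - ln (cmod (lead_coeff p))) / real (degree p) \<le> tpot s (zero_measure p) z"
proof -
  have p0: "p \<noteq> 0" using p by auto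
  have "(\<Sum>x\<in>#proots p. ln (cmod (z - x))) \<le> (\<Sum>x\<in>#proots p. ln (max s (cmod (z - x))))"
  proof (rule sum_mset_mono)
    fix x assume "x \<in># proots p"
    then have "0 < cmod (z - x)" using z p0 by auto
    then show "ln (cmod (z - x)) \<le> ln (max s (cmod (z - x)))" using s by simp
  qed
  then show ?thesis
    unfolding tpot_def integral_zero_measure[OF p borel_measurable_continuous_UNIV[OF continuous_ln_max[OF s]]] ln_norm_poly[OF z]
    using p by (simp add: divide_right_mono)
qed

lemma tpot_zero_measure_eq:
  assumes p: "0 < degree p" and s: "0 < s" and off: "\<And>x. poly p x = 0 \<Longrightarrow> s \<le> cmod (z - x)"
  shows "tpot s (zero_measure p) z = (ln (cmod (poly p z)) - ln (cmod (lead_coeff p))) / real (degree p)"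
proof -
  have p0: "p \<noteq> 0" using p by auto
  have z: "poly p z \<noteq> 0" using off[of z] s by auto
  have "(\<Sum>x\<in>#proots p. ln (max s (cmod (z - x)))) = (\<Sum>x\<in>#proots p. ln (cmod (z - x)))"
    by (rule arg_cong[where f=sum_mset], rule image_mset_cong) (use off p0 in \<open>auto simp: max_def\<close>)
  then show ?thesis
    unfolding tpot_def integral_zero_measure[OF p borel_measurable_continuous_UNIV[OF continuous_ln_max[OF s]]] ln_norm_poly[OF z]
    by simp
qed

lemma lpot_off_support:
  assumes D: "2 * \<rho> \<le> D" and \<mu>: "borel_prob_on C \<mu>" and C: "C \<subseteq> cball 0 \<rho>" "closed C"
    and z: "cmod z \<le> \<rho>" and s: "0 < s" "s \<le> D" and off: "\<And>x. x \<in> C \<Longrightarrow> s \<le> cmod (z - x)"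
  shows "lpot D \<mu> z = ennreal (ln D - tpot s \<mu> z)"
proof -
  have Cb: "C \<in> sets borel" using C by auto
  have \<mu>': "borel_prob_on (cball 0 \<rho>) \<mu>" using borel_prob_on_mono[OF \<mu> C(1) Cb] by simp
  have "lpot D \<mu> z = (\<integral>\<^sup>+w. ennreal (ln (D / max s (cmod (z - w)))) \<partial>\<mu>)"
    unfolding lpot_def
  proof (rule nn_integral_cong_AE)
    show "AE w in \<mu>. lker D z w = ennreal (ln (D / max s (cmod (z - w))))"
      using borel_prob_on_AE[OF \<mu> Cb]
    proof eventually_elim
      case (elim w)
      then show ?case using off[of w] s by (auto simp: lker_def max_def)
    qed
  qed
  then show ?thesis using nn_integral_truncated[OF \<mu>' z D s] by simp
qed

lemma zero_measure_atom:
  assumes p: "0 < degree p" and z: "poly p z = 0"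
  shows "0 < measure (zero_measure p) {z}"
proof -
  have p0: "p \<noteq> 0" using p by auto
  have cnt: "(\<Sum>x\<in>#A. indicat_real {z} x) = real (count A z)" for A
    by (induction A) (auto simp: indicator_def)
  have "measure (zero_measure p) {z} = (\<integral>x. indicat_real {z} x \<partial>zero_measure p)"
    by (simp add: zero_measure_def)
  also have "\<dots> = (\<Sum>x\<in>#proots p. indicat_real {z} x) / real (degree p)"
    by (rule integral_zero_measure[OF p]) auto
  also have "(\<Sum>x\<in>#proots p. indicat_real {z} x) = real (count (proots p) z)"
    by (rule cnt)
  finally have "measure (zero_measure p) {z} = real (order z p) / real (degree p)" using p0 by simp
  moreover have "0 < order z p" using order_root[of p z] z p0 by auto
  ultimately show ?thesis using p by simp
qed

lemma lpot_zero_measure: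
  assumes D: "2 * \<rho> \<le> D" "0 < \<rho>" and p: "0 < degree p" and roots: "{z. poly p z = 0} \<subseteq> cball 0 \<rho>"
    and z: "cmod z \<le> \<rho>"
  shows "lpot D (zero_measure p) z = (if poly p z = 0 then \<infinity> else
     ennreal (ln D - (ln (cmod (poly p z)) - ln (cmod (lead_coeff p))) / real (degree p)))"
proof (cases "poly p z = 0")
  case True
  have zm: "borel_prob_on (cball 0 \<rho>) (zero_measure p)" by (rule borel_prob_on_zero_measure[OF p roots]) simp
  interpret prob_space "zero_measure p" using borel_prob_onD(3)[OF zm] .
  have [measurable_cong]: "sets (zero_measure p) = sets borel" by (simp add: zero_measure_def)
  have "\<infinity> * emeasure (zero_measure p) {z} = (\<integral>\<^sup>+w. \<infinity> * indicator {z} w \<partial>zero_measure p)"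
    by (rule nn_integral_cmult_indicator[symmetric]) (simp add: zero_measure_def)
  also have "\<dots> \<le> lpot D (zero_measure p) z"
    unfolding lpot_def by (rule nn_integral_mono) (auto simp: lker_def indicator_def)
  finally show ?thesis using True zero_measure_atom[OF p True]
    by (simp add: emeasure_eq_measure ennreal_top_mult top_unique)
next
  case False
  have p0: "p \<noteq> 0" using p by auto
  have zs: "z \<notin> {z. poly p z = 0}" using False by simp
  obtain s where s: "0 < s" "\<And>x. x \<in> {z. poly p z = 0} \<Longrightarrow> s \<le> dist z x"
    using separate_point_closed[OF closed_zero_set zs] by blast
  define t where "t = min s D"
  have t: "0 < t" "t \<le> D" "\<And>x. poly p x = 0 \<Longrightarrow> t \<le> cmod (z - x)"
    using s D by (auto simp: t_def dist_norm min_le_iff_disj)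
  have "lpot D (zero_measure p) z = ennreal (ln D - tpot t (zero_measure p) z)"
    by (rule lpot_off_support[OF D(1) borel_prob_on_zero_measure[OF p order_refl] roots closed_zero_set z t(1,2)])
       (use t closed_zero_set in auto)
  then show ?thesis using False tpot_zero_measure_eq[OF p t(1,3)] by simp
qed

subsection \<open>Lemniscates\<close>

definition lem_pot :: "complex poly \<Rightarrow> real \<Rightarrow> complex \<Rightarrow> real" where
  "lem_pot P c z = (ln (max c (cmod (poly P z))) - ln (cmod (lead_coeff P))) / real (degree P)"

lemma continuous_lem_pot: "0 < c \<Longrightarrow> continuous_on A (lem_pot P c)"
  unfolding lem_pot_def by (cases "degree P = 0") (auto intro!: continuous_intros)

text \<open>The measure is a weak limit of the zero measures of \<open>P ^ N + c ^ N\<close> with \<open>N = 2 ^ s\<close>. A root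
  \<open>x\<close> of one of these polynomials satisfies \<open>P x ^ N = c ^ N\<close> for all larger exponents \<open>N\<close>, so the
  mutual energies are known exactly.\<close>

theorem lemniscate_measure:
  assumes D: "0 < \<rho>" "2 * \<rho> \<le> D" "1 \<le> D"
    and P: "0 < degree P" and c: "0 < c" and sub: "{z. cmod (poly P z) \<le> c} \<subseteq> cball 0 \<rho>"
  obtains \<kappa> where "borel_prob_on {z. cmod (poly P z) = c} \<kappa>"
    and "lenergy D \<kappa> \<kappa> \<le> ennreal (ln D - (ln c - ln (cmod (lead_coeff P))) / real (degree P))"
    and "\<And>z. cmod z < \<rho> \<Longrightarrow> ennreal (ln D - lem_pot P c z) \<le> lpot D \<kappa> z"
    and "\<And>z. cmod z \<le> \<rho> \<Longrightarrow> c < cmod (poly P z) \<Longrightarrow> lpot D \<kappa> z \<le> ennreal (ln D - lem_pot P c z)"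
proof -
  define n where "n = degree P"
  define a where "a = lead_coeff P"
  have n: "0 < n" using P by (simp add: n_def)
  have P0: "P \<noteq> 0" using P by auto
  have a: "a \<noteq> 0" using P0 by (simp add: a_def)
  define Q where "Q s = P ^ (2 ^ s) + [:complex_of_real (c ^ (2 ^ s)):]" for s :: nat
  have degP: "degree (P ^ (2 ^ s)) = n * 2 ^ s" for s by (simp add: degree_power_eq[OF P0] n_def mult.commute)
  have degQ: "degree (Q s) = n * 2 ^ s" for s
    unfolding Q_def degP[symmetric] using n degP by (intro degree_add_eq_left) simp
  have leadQ: "lead_coeff (Q s) = a ^ (2 ^ s)" for s
  proof -
    have "lead_coeff ([:complex_of_real (c ^ (2 ^ s)):] + P ^ (2 ^ s)) = lead_coeff (P ^ (2 ^ s))"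
      by (rule lead_coeff_add_le) (use n degP in simp)
    then have "lead_coeff (Q s) = lead_coeff (P ^ (2 ^ s))" by (simp add: Q_def add.commute)
    then show ?thesis by (simp add: lead_coeff_power a_def)
  qed
  have polyQ: "poly (Q s) z = poly P z ^ (2 ^ s) + of_real (c ^ (2 ^ s))" for s z
    by (simp add: Q_def)
  have degQ0: "0 < degree (Q s)" for s using n by (simp add: degQ)
  have onc: "cmod (poly P z) = c" if "poly (Q s) z = 0" for s z
  proof -
    have "cmod (poly P z ^ (2 ^ s)) = cmod (- of_real (c ^ (2 ^ s)))"
      using that unfolding polyQ by (metis add_eq_0_iff2)
    then have "cmod (poly P z) ^ (2 ^ s) = c ^ (2 ^ s)" using c by (simp add: norm_power)
    then show ?thesis using c by (simp add: power_eq_iff_eq_base)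
  qed
  let ?C = "{z. cmod (poly P z) = c}"
  have Cc: "closed ?C" by (intro closed_Collect_eq continuous_intros)
  have Csub: "?C \<subseteq> cball 0 \<rho>" using sub by auto
  define M where "M s = zero_measure (Q s)" for s
  have MC: "borel_prob_on ?C (M s)" for s
    unfolding M_def by (rule borel_prob_on_zero_measure[OF degQ0]) (use onc Cc in auto)
  have Mb: "borel_prob_on (cball 0 \<rho>) (M s)" for s
    by (rule borel_prob_on_mono[OF MC Csub]) (use Cc in auto)
  have C0: "?C \<noteq> {}"
  proof
    assume "?C = {}"
    then show False using borel_prob_onD(4)[OF MC[of 0]] by (simp only: measure_empty)
  qed
  obtain r \<sigma> where r: "strict_mono r" and \<sigma>: "borel_prob_on (cball 0 \<rho>) \<sigma>" and lim: "weak_lim (M \<circ> r) \<sigma>"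
    using weak_compactness[of \<rho> M, OF D(1) Mb] by (elim exE conjE) (rule that)
  have \<sigma>C: "borel_prob_on ?C \<sigma>" by (rule weak_lim_support[OF lim \<sigma> _ Cc C0]) (use MC in auto)
  have rootsQ: "{z. poly (Q s) z = 0} \<subseteq> cball 0 \<rho>" for s using onc Csub by auto
  define V where "V z = lem_pot P c z" for z
  define V0 where "V0 = (ln c - ln (cmod a)) / real n"
  have lnlead: "ln (cmod (a ^ (2 ^ s))) = 2 ^ s * ln (cmod a)" for s
    using a by (simp add: norm_power ln_realpow)
  have potQ: "lpot D (M s) z = ennreal (ln D - (ln (cmod (poly (Q s) z)) / 2 ^ s - ln (cmod a)) / real n)"
    if "cmod z \<le> \<rho>" "poly (Q s) z \<noteq> 0" for s z
    unfolding M_def lpot_zero_measure[OF D(2,1) degQ0 rootsQ that(1)] leadQ lnlead unfolding degQ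
    using that(2) n by (simp add: field_simps)
  have mutual: "lenergy D (M s) (M t) \<le> ennreal (ln D - V0)" if "t < s" for s t
  proof -
    obtain d where d: "s = t + Suc d" using \<open>t < s\<close> less_iff_Suc_add by auto
    have pot: "lpot D (M s) z \<le> ennreal (ln D - V0)" if z: "poly (Q t) z = 0" for z
    proof -
      have "poly P z ^ (2 ^ t) = - of_real (c ^ (2 ^ t))" using z unfolding polyQ by (simp add: add_eq_0_iff2)
      then have "(poly P z ^ (2 ^ t)) ^ (2 ^ Suc d) = of_real (c ^ (2 ^ t)) ^ (2 ^ Suc d)"
        by (simp add: power_minus_even)
      then have "poly P z ^ (2 ^ s) = of_real (c ^ (2 ^ s))"
        by (simp add: d power_add mult.left_commute mult.commute flip: power_mult of_real_power)
      then have Qz: "poly (Q s) z = of_real (2 * c ^ (2 ^ s))" by (simp add: polyQ)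
      have zr: "cmod z \<le> \<rho>" using rootsQ[of t] z by auto
      have "ln (cmod (poly (Q s) z)) = ln 2 + 2 ^ s * ln c"
        unfolding Qz norm_of_real using c by (simp add: ln_mult ln_realpow)
      moreover have "poly (Q s) z \<noteq> 0" unfolding Qz of_real_eq_0_iff using c by simp
      ultimately have "lpot D (M s) z = ennreal (ln D - ((ln 2 + 2 ^ s * ln c) / 2 ^ s - ln (cmod a)) / real n)"
        using potQ[OF zr] by simp
      \<comment> \<open>The surplus \<open>ln 2 / (n * 2 ^ s)\<close> makes the logarithmic
        potential larger and may be dropped.\<close>
      also have "\<dots> \<le> ennreal (ln D - V0)"
        unfolding V0_def using n by (intro ennreal_leI diff_mono divide_right_mono) (auto simp: field_simps)
      finally show ?thesis .
    qed
    interpret Mt: prob_space "M t" using borel_prob_onD(3)[OF MC] .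
    have AE: "AE z in M t. z \<in> {z. poly (Q t) z = 0}"
      unfolding M_def by (rule borel_prob_on_AE[OF borel_prob_on_zero_measure[OF degQ0 order_refl]]) (use closed_zero_set in auto)
    have "lenergy D (M t) (M s) \<le> (\<integral>\<^sup>+z. ennreal (ln D - V0) \<partial>M t)"
      unfolding lenergy_def
      by (rule nn_integral_mono_AE) (use AE pot in \<open>auto elim!: eventually_mono\<close>)
    also have "\<dots> = ennreal (ln D - V0)" by (simp add: Mt.emeasure_space_1)
    finally show ?thesis by (simp add: lenergy_commute[OF Mb Mb])
  qed
  have E: "lenergy D \<sigma> \<sigma> \<le> ennreal (ln D - V0)"
  proof (rule lenergy_lsc_diagonal[OF D _ \<sigma> lim])
    show "borel_prob_on (cball 0 \<rho>) ((M \<circ> r) k)" for k using Mb by simp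
    show "\<forall>\<^sub>F k in sequentially. lenergy D ((M \<circ> r) k) ((M \<circ> r) j) \<le> ennreal (ln D - V0)" for j
      using eventually_gt_at_top[of j]
      by eventually_elim (use mutual r in \<open>simp add: strict_mono_def\<close>)
  qed
  \<comment> \<open>Only truncated potentials pass to the weak limit. Hence the pointwise bound
    \<open>2 * max c |P| ^ N\<close> for \<open>|Q s|\<close>, with \<open>N = 2 ^ s\<close>, is
    averaged over a circle so small that \<open>V\<close> varies by less than \<open>e\<close> on
    it; the factor 2 costs \<open>ln 2 / (n * N)\<close>, which vanishes in the limit.\<close>
  have upper: "ennreal (ln D - V z) \<le> lpot D \<sigma> z" if z: "cmod z < \<rho>" for z
  proof -
    have "ennreal (ln D - V z - e) \<le> lpot D \<sigma> z" if e: "0 < e" for e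
    proof -
      have "isCont V z" using continuous_lem_pot[OF c, of UNIV P] unfolding V_def by (simp add: continuous_on_eq_continuous_at)
      then obtain d where d: "0 < d" "\<And>w. dist w z < d \<Longrightarrow> dist (V w) (V z) < e"
        using e unfolding continuous_at_eps_delta by blast
      define h where "h = min (d/2) (\<rho> - cmod z)"
      have h: "0 < h" "cmod z + h \<le> \<rho>" "h < d" using d z by (auto simp: h_def min_def)
      have hD: "h \<le> D" using h D norm_ge_zero[of z] by linarith
      have "tpot h (M s) z \<le> V z + e + ln 2 / (real n * 2 ^ s)" for s
      proof -
        have cm: "borel_prob_on (sphere z h) (circle_measure z h)" using borel_prob_on_circle_measure h by simp
        interpret cm: prob_space "circle_measure z h" using borel_prob_onD(3)[OF cm] .
        have "tpot h (M s) z \<le> (\<integral>w. V z + e + ln 2 / (real n * 2 ^ s) \<partial>circle_measure z h)"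
        proof (rule tpot_le_circle_mean[OF D(1,2) Mb h(1,2)])
          fix w assume w: "w \<in> sphere z h"
          have wr: "cmod w \<le> \<rho>" using w h norm_triangle_ineq[of z "w - z"] by (simp add: dist_norm norm_minus_commute)
          have "V w \<le> V z + e" using d(2)[of w] w h by (auto simp: dist_real_def dist_commute)
          show "ennreal (ln D - (V z + e + ln 2 / (real n * 2 ^ s))) \<le> lpot D (M s) w"
          proof (cases "poly (Q s) w = 0")
            case True
            then show ?thesis unfolding M_def using lpot_zero_measure[OF D(2,1) degQ0 rootsQ wr] by simp
          next
            case False
            let ?m = "max c (cmod (poly P w))"
            have m: "0 < ?m" using c by simp
            have "cmod (poly (Q s) w) \<le> cmod (poly P w) ^ (2 ^ s) + c ^ (2 ^ s)"
              unfolding polyQ using norm_triangle_ineq[of "poly P w ^ (2 ^ s)" "of_real (c ^ (2 ^ s))"] c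
              by (simp add: norm_power)
            also have "\<dots> \<le> ?m ^ (2 ^ s) + ?m ^ (2 ^ s)" using c by (intro add_mono power_mono) auto
            finally have "ln (cmod (poly (Q s) w)) \<le> ln (2 * ?m ^ (2 ^ s))" using False m by (subst ln_le_cancel_iff) auto
            also have "\<dots> = ln 2 + 2 ^ s * ln ?m" using m by (simp add: ln_mult ln_realpow)
            finally have "ln (cmod (poly (Q s) w)) / 2 ^ s \<le> (ln 2 + 2 ^ s * ln ?m) / 2 ^ s" by (intro divide_right_mono) auto
            then have "(ln (cmod (poly (Q s) w)) / 2 ^ s - ln (cmod a)) / real n \<le> ((ln 2 + 2 ^ s * ln ?m) / 2 ^ s - ln (cmod a)) / real n"
              by (intro divide_right_mono) auto
            also have "\<dots> = V w + ln 2 / (real n * 2 ^ s)"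
              unfolding V_def lem_pot_def a_def[symmetric] unfolding n_def[symmetric] using n by (simp add: field_simps)
            finally show ?thesis unfolding potQ[OF wr False] using \<open>V w \<le> V z + e\<close> by (intro ennreal_leI) linarith
          qed
        qed simp
        then show ?thesis by (simp add: cm.prob_space)
      qed
      then have le: "tpot h ((M \<circ> r) k) z \<le> V z + e + ln 2 / real n * (1 / 2) ^ (r k)" for k
        by (simp add: power_one_over field_simps)
      have "(\<lambda>k. V z + e + ln 2 / real n * (1 / 2) ^ (r k)) \<longlonglongrightarrow> V z + e + ln 2 / real n * 0"
        using LIMSEQ_subseq_LIMSEQ[OF LIMSEQ_power_zero[of "1/2::real"] r] by (intro tendsto_intros) (simp_all add: o_def)
      then have "tpot h \<sigma> z \<le> V z + e"
        using LIMSEQ_le[OF weak_lim_tpot[OF lim h(1), of z]] le by fastforce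
      then have "ennreal (ln D - V z - e) \<le> ennreal (ln D - tpot h \<sigma> z)" by (intro ennreal_leI) simp
      also have "\<dots> \<le> lpot D \<sigma> z" by (rule lpot_ge_truncated[OF \<sigma> _ D(2) h(1) hD]) (use z in simp)
      finally show ?thesis .
    qed
    then have *: "ennreal (ln D - V z - 1 / real (Suc k)) \<le> lpot D \<sigma> z" for k by simp
    have "(\<lambda>k. ennreal (ln D - V z - 1 / real (Suc k))) \<longlonglongrightarrow> ennreal (ln D - V z - 0)"
      by (intro tendsto_ennrealI tendsto_diff tendsto_const lim_1_over_n[THEN LIMSEQ_Suc])
    then show ?thesis using * by (intro LIMSEQ_le_const2[of "\<lambda>k. ennreal (ln D - V z - 1 / real (Suc k))"]) auto
  qed
  have lower: "lpot D \<sigma> z \<le> ennreal (ln D - V z)" if z: "cmod z \<le> \<rho>" and Pz: "c < cmod (poly P z)" for z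
  proof -
    have "z \<notin> ?C" using Pz by simp
    then obtain s where s: "0 < s" "\<And>x. x \<in> ?C \<Longrightarrow> s \<le> dist z x"
      using separate_point_closed[OF Cc] by blast
    define t where "t = min s D"
    have t: "0 < t" "t \<le> D" and toff: "\<And>x. x \<in> ?C \<Longrightarrow> t \<le> cmod (z - x)"
      using s D by (auto simp: t_def dist_norm min_le_iff_disj)
    have eq: "tpot t (M k) z = (ln (cmod (poly (Q k) z)) / 2 ^ k - ln (cmod a)) / real n" for k
    proof -
      have "tpot t (M k) z = (ln (cmod (poly (Q k) z)) - ln (cmod (lead_coeff (Q k)))) / real (degree (Q k))"
        unfolding M_def by (rule tpot_zero_measure_eq[OF degQ0 t(1)]) (use toff onc in auto)
      then show ?thesis unfolding leadQ lnlead unfolding degQ using n by (simp add: field_simps)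
    qed
    \<comment> \<open>Outside the lemniscate \<open>P ^ N\<close> dominates: \<open>Q k\<close>
      equals \<open>P ^ N\<close> times \<open>1 + u ^ N\<close> with \<open>N = 2 ^ k\<close>, and
      \<open>|u| < 1\<close>.\<close>
    define u where "u = complex_of_real c / poly P z"
    have Pz0: "poly P z \<noteq> 0" using Pz c by auto
    have u: "cmod u < 1"
      using Pz c divide_less_eq_1_pos[of "cmod (poly P z)" c] Pz0 by (simp add: u_def norm_divide)
    have "(\<lambda>k. u ^ k) \<longlonglongrightarrow> 0" by (rule LIMSEQ_power_zero[OF u])
    moreover have "strict_mono (\<lambda>k::nat. (2::nat) ^ k)" by (simp add: strict_mono_def)
    ultimately have u0: "(\<lambda>k. u ^ (2 ^ k)) \<longlonglongrightarrow> 0" using LIMSEQ_subseq_LIMSEQ by (fastforce simp: o_def)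
    have "(\<lambda>k. cmod (1 + u ^ (2 ^ k))) \<longlonglongrightarrow> cmod (1 + 0)" by (intro tendsto_intros u0)
    then have "(\<lambda>k. ln (cmod (1 + u ^ (2 ^ k)))) \<longlonglongrightarrow> ln (cmod (1 + 0))" by (intro tendsto_ln) auto
    then have "(\<lambda>k. ln (cmod (poly P z)) + ln (cmod (1 + u ^ (2 ^ k))) * (1/2) ^ k) \<longlonglongrightarrow> ln (cmod (poly P z)) + ln (cmod (1 + 0)) * 0"
      by (intro tendsto_add tendsto_const tendsto_mult LIMSEQ_power_zero) simp_all
    moreover have "ln (cmod (poly P z)) + ln (cmod (1 + u ^ (2 ^ k))) * (1/2) ^ k = ln (cmod (poly (Q k) z)) / 2 ^ k" for k
    proof -
      have "poly (Q k) z = poly P z ^ (2 ^ k) * (1 + u ^ (2 ^ k))"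
        using Pz0 by (simp add: polyQ u_def power_divide distrib_left)
      moreover have "1 + u ^ (2 ^ k) \<noteq> 0"
      proof
        assume "1 + u ^ (2 ^ k) = 0"
        then have "u ^ (2 ^ k) = -1" by (simp add: eq_neg_iff_add_eq_0 add.commute)
        then have "cmod u ^ (2 ^ k) = 1" by (metis norm_minus_cancel norm_one norm_power)
        then show False using u power_less_one_iff[of "cmod u" "2 ^ k"] by simp
      qed
      ultimately have "ln (cmod (poly (Q k) z)) = 2 ^ k * ln (cmod (poly P z)) + ln (cmod (1 + u ^ (2 ^ k)))"
        using Pz0 by (simp add: norm_mult norm_power ln_mult ln_realpow)
      then show ?thesis by (simp add: field_simps power_one_over)
    qed
    ultimately have "(\<lambda>k. ln (cmod (poly (Q k) z)) / 2 ^ k) \<longlonglongrightarrow> ln (cmod (poly P z))" by simp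
    then have "(\<lambda>k. tpot t (M k) z) \<longlonglongrightarrow> (ln (cmod (poly P z)) - ln (cmod a)) / real n"
      unfolding eq using n by (intro tendsto_intros) auto
    from LIMSEQ_subseq_LIMSEQ[OF this r] have "(\<lambda>k. tpot t ((M \<circ> r) k) z) \<longlonglongrightarrow> V z"
      using Pz by (simp add: o_def V_def lem_pot_def a_def n_def)
    then have "tpot t \<sigma> z = V z" using weak_lim_tpot[OF lim t(1), of z] LIMSEQ_unique by blast
    moreover have "lpot D \<sigma> z = ennreal (ln D - tpot t \<sigma> z)"
      by (rule lpot_off_support[OF D(2) \<sigma>C Csub Cc z t]) (use toff in auto)
    ultimately show ?thesis by simp
  qed
  show thesis
    by (rule that[OF \<sigma>C]) (use E upper lower in \<open>auto simp: V_def V0_def a_def n_def\<close>)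
qed

subsection \<open>Filled Julia sets\<close>

definition iter_poly :: "complex poly \<Rightarrow> nat \<Rightarrow> complex poly" where
  "iter_poly p j = (pcompose p ^^ j) [:0, 1:]"

lemma iter_poly_simps: "iter_poly p 0 = [:0, 1:]" "iter_poly p (Suc j) = pcompose p (iter_poly p j)"
  by (auto simp: iter_poly_def)

lemma poly_iter_poly: "poly (iter_poly p j) z = (poly p ^^ j) z"
  by (induction j) (auto simp: iter_poly_simps poly_pcompose)

lemma degree_iter_poly: "degree (iter_poly p j) = degree p ^ j"
  by (induction j) (auto simp: iter_poly_simps degree_pcompose)

text \<open>The leading coefficient of the next iterate is \<open>a\<close> times the
  \<open>n\<close>-th power of the previous one, so the exponent of \<open>a\<close> is a geometric
  sum.\<close>

lemma ln_lead_coeff_iter_poly: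
  assumes "2 \<le> degree p"
  shows "ln (cmod (lead_coeff (iter_poly p j))) =
    (real (degree p) ^ j - 1) / (real (degree p) - 1) * ln (cmod (lead_coeff p))"
proof (induction j)
  case (Suc j)
  let ?n = "degree p"
  have "0 < degree (iter_poly p j)" using assms by (simp add: degree_iter_poly)
  then have p0: "p \<noteq> 0" "iter_poly p j \<noteq> 0" using assms by auto
  from \<open>0 < degree (iter_poly p j)\<close> have "lead_coeff (iter_poly p (Suc j)) = lead_coeff p * lead_coeff (iter_poly p j) ^ ?n"
    unfolding iter_poly_simps by (rule lead_coeff_comp)
  then have "ln (cmod (lead_coeff (iter_poly p (Suc j)))) = ln (cmod (lead_coeff p)) + real ?n * ln (cmod (lead_coeff (iter_poly p j)))"
    using p0 by (simp add: norm_mult norm_power ln_mult_pos ln_realpow)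
  also have "\<dots> = (1 + real ?n * ((real ?n ^ j - 1) / (real ?n - 1))) * ln (cmod (lead_coeff p))"
    unfolding Suc.IH by (simp add: algebra_simps)
  also have "1 + real ?n * ((real ?n ^ j - 1) / (real ?n - 1)) = (real ?n ^ Suc j - 1) / (real ?n - 1)"
    using assms by (simp add: field_simps)
  finally show ?case .
qed (simp add: iter_poly_simps)

definition escape_radius :: "complex poly \<Rightarrow> real \<Rightarrow> bool" where
  "escape_radius p c \<longleftrightarrow> 0 < c \<and> (\<forall>z. c \<le> cmod z \<longrightarrow> 2 * cmod z \<le> cmod (poly p z))"

text \<open>An orbit that reaches modulus \<open>c\<close> at least doubles in modulus from then on
  and is unbounded; hence the strict and the non-strict descriptions agree. The non-strict one gives
  closedness, the strict one places the set inside the region \<open>|p| < c\<close>.\<close>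

lemma filled_julia_eq:
  assumes er: "escape_radius p c"
  shows "filled_julia p = {z. \<forall>j. cmod (poly (iter_poly p j) z) < c}"
    and "filled_julia p = (\<Inter>j. {z. cmod (poly (iter_poly p j) z) \<le> c})"
proof -
  have c: "0 < c" and esc: "\<And>z. c \<le> cmod z \<Longrightarrow> 2 * cmod z \<le> cmod (poly p z)"
    using er by (auto simp: escape_radius_def)
  have step: "c * 2 ^ i \<le> cmod ((poly p ^^ (j + i)) z)" if "c \<le> cmod ((poly p ^^ j) z)" for i j z
  proof (induction i)
    case (Suc i)
    have "c * 1 \<le> c * 2 ^ i" using c by (intro mult_left_mono) auto
    then have "2 * cmod ((poly p ^^ (j + i)) z) \<le> cmod (poly p ((poly p ^^ (j + i)) z))"
      using Suc by (intro esc) simp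
    then show ?case using Suc by simp
  qed (use that in simp)
  have unb: "\<not> bounded (range (\<lambda>j. (poly p ^^ j) z))" if le: "c \<le> cmod ((poly p ^^ j) z)" for j z
  proof
    assume "bounded (range (\<lambda>j. (poly p ^^ j) z))"
    then obtain B where B: "\<And>j. cmod ((poly p ^^ j) z) \<le> B" by (auto simp: bounded_iff)
    obtain i where "B / c < 2 ^ i" using real_arch_pow[of 2] by auto
    then have "B < c * 2 ^ i" using c by (simp add: field_simps)
    then show False using step[OF le, of i] B[of "j + i"] by simp
  qed
  have A: "filled_julia p \<subseteq> {z. \<forall>j. cmod (poly (iter_poly p j) z) < c}"
    using unb unfolding filled_julia_def poly_iter_poly by (auto simp: not_less[symmetric])
  have B: "{z. \<forall>j. cmod (poly (iter_poly p j) z) < c} \<subseteq> (\<Inter>j. {z. cmod (poly (iter_poly p j) z) \<le> c})"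
    by (auto intro: less_imp_le)
  have C: "(\<Inter>j. {z. cmod (poly (iter_poly p j) z) \<le> c}) \<subseteq> filled_julia p"
    unfolding filled_julia_def poly_iter_poly by (auto simp: bounded_iff)
  from A B C show "filled_julia p = {z. \<forall>j. cmod (poly (iter_poly p j) z) < c}"
    "filled_julia p = (\<Inter>j. {z. cmod (poly (iter_poly p j) z) \<le> c})" by blast+
qed

lemma closed_filled_julia:
  assumes "escape_radius p c"
  shows "closed (filled_julia p)" "filled_julia p \<subseteq> cball 0 c" "z \<in> filled_julia p \<Longrightarrow> cmod (poly p z) < c"
proof -
  have "closed {z. cmod (poly (iter_poly p j) z) \<le> c}" for j
    by (intro closed_Collect_le continuous_intros)
  then show "closed (filled_julia p)" unfolding filled_julia_eq(2)[OF assms] by auto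
  show "filled_julia p \<subseteq> cball 0 c"
  proof
    fix z assume "z \<in> filled_julia p"
    then have "cmod (poly (iter_poly p 0) z) \<le> c" unfolding filled_julia_eq(2)[OF assms] by blast
    then show "z \<in> cball 0 c" by (simp add: iter_poly_simps)
  qed
  assume "z \<in> filled_julia p"
  then have "cmod (poly (iter_poly p (Suc 0)) z) < c" using filled_julia_eq(1)[OF assms] by blast
  then show "cmod (poly p z) < c" by (simp add: poly_iter_poly)
qed

text \<open>The Julia set is the intersection of the decreasing lemniscates of the iterates, whose
  energies are known. A weak limit of their measures lives on the intersection and inherits the
  limit of the energy bounds, and a minimiser can only do better. The bound corresponds to the
  capacity \<open>|a|\<close> to the power \<open>-1 / (n - 1)\<close>.\<close>

theorem filled_julia_min_energy:
  assumes D: "0 < \<rho>" "2 * \<rho> \<le> D" "1 \<le> D" and er: "escape_radius p c" "c \<le> \<rho>" and n: "2 \<le> degree p"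
  shows "\<exists>\<omega>. min_energy D (filled_julia p) \<omega> \<and>
    lenergy D \<omega> \<omega> \<le> ennreal (ln D + ln (cmod (lead_coeff p)) / (real (degree p) - 1))"
proof -
  let ?n = "degree p" and ?J = "filled_julia p"
  have c: "0 < c" "c \<le> \<rho>" and esc: "\<And>z. c \<le> cmod z \<Longrightarrow> 2 * cmod z \<le> cmod (poly p z)"
    using er by (auto simp: escape_radius_def)
  define F where "F j = {z. cmod (poly (iter_poly p j) z) \<le> c}" for j
  define e where "e j = ln D - (ln c - ln (cmod (lead_coeff (iter_poly p j)))) / real (degree (iter_poly p j))" for j
  have Fdec: "F (j + i) \<subseteq> F j" for i j
  proof (induction i)
    case (Suc i)
    have "F (Suc (j + i)) \<subseteq> F (j + i)"
      unfolding F_def poly_iter_poly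
    proof (rule subsetI, rule ccontr)
      fix z assume a: "z \<in> {z. cmod ((poly p ^^ Suc (j + i)) z) \<le> c}" "z \<notin> {z. cmod ((poly p ^^ (j + i)) z) \<le> c}"
      then show False using esc[of "(poly p ^^ (j + i)) z"] c by auto
    qed
    then show ?case using Suc by simp
  qed simp
  have Fc: "closed (F j)" for j unfolding F_def by (intro closed_Collect_le continuous_intros)
  have Fb: "F j \<subseteq> cball 0 \<rho>" for j
  proof -
    have "F (0 + j) \<subseteq> F 0" by (rule Fdec)
    also have "F 0 \<subseteq> cball 0 \<rho>" using c by (auto simp: F_def iter_poly_simps)
    finally show ?thesis by simp
  qed
  have "\<exists>\<kappa>. borel_prob_on (F j) \<kappa> \<and> lenergy D \<kappa> \<kappa> \<le> ennreal (e j)" for j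
  proof -
    obtain \<kappa> where \<kappa>: "borel_prob_on {z. cmod (poly (iter_poly p j) z) = c} \<kappa>"
      "lenergy D \<kappa> \<kappa> \<le> ennreal (ln D - (ln c - ln (cmod (lead_coeff (iter_poly p j)))) / real (degree (iter_poly p j)))"
      by (rule lemniscate_measure[OF D _ c(1), of "iter_poly p j"])
         (use Fb[of j] n in \<open>auto simp: degree_iter_poly F_def\<close>)
    have "closed {z. cmod (poly (iter_poly p j) z) = c}" by (intro closed_Collect_eq continuous_intros)
    then have "borel_prob_on (F j) \<kappa>"
      by (intro borel_prob_on_mono[OF \<kappa>(1) _ borel_closed borel_closed[OF Fc]]) (auto simp: F_def)
    then show ?thesis using \<kappa>(2) unfolding e_def by blast
  qed
  then obtain M where M: "\<And>j. borel_prob_on (F j) (M j)" "\<And>j. lenergy D (M j) (M j) \<le> ennreal (e j)" by metis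
  have Mb: "borel_prob_on (cball 0 \<rho>) (M j)" for j
    by (rule borel_prob_on_mono[OF M(1) Fb]) (use Fc in auto)
  obtain r \<sigma> where r: "strict_mono r" and \<sigma>: "borel_prob_on (cball 0 \<rho>) \<sigma>" and lim: "weak_lim (M \<circ> r) \<sigma>"
    using weak_compactness[of \<rho> M, OF D(1) Mb] by (elim exE conjE) (rule that)
  have Fne: "F j \<noteq> {}" for j
  proof
    assume "F j = {}"
    then show False using borel_prob_onD(4)[OF M(1)[of j]] by (simp only: measure_empty)
  qed
  have \<sigma>F: "borel_prob_on (F i) \<sigma>" for i
  proof (rule weak_lim_support[OF lim \<sigma> _ Fc Fne])
    show "\<forall>\<^sub>F k in sequentially. borel_prob_on (F i) ((M \<circ> r) k)"
      using eventually_ge_at_top[of i]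
    proof eventually_elim
      case (elim k)
      then have "i \<le> r k" using seq_suble[OF r, of k] by linarith
      then obtain d where "r k = i + d" using le_Suc_ex by blast
      then have "F (r k) \<subseteq> F i" using Fdec by simp
      then show ?case unfolding o_def by (rule borel_prob_on_mono[OF M(1)]) (use Fc in auto)
    qed
  qed
  have "AE z in \<sigma>. \<forall>i. z \<in> F i"
    unfolding AE_all_countable using borel_prob_on_AE[OF \<sigma>F borel_closed[OF Fc]] by blast
  then have "AE z in \<sigma>. z \<in> ?J" using filled_julia_eq(2)[OF er(1)] by (auto simp: F_def)
  then have \<sigma>J: "borel_prob_on ?J \<sigma>"
    using borel_prob_onD[OF \<sigma>] closed_filled_julia(1)[OF er(1)] by (subst borel_prob_on_iff_AE) auto
  \<comment> \<open>The limit of \<open>e\<close>: the exponent of the leading coefficient of the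
    iterate, divided by its degree \<open>n ^ j\<close>, tends to \<open>1 / (n - 1)\<close>, and
    \<open>ln c / n ^ j\<close> vanishes.\<close>
  define A where "A = ln D + ln (cmod (lead_coeff p)) / (real ?n - 1)"
  have n1: "1 < real ?n" using n by simp
  have "(\<lambda>j. (1 / real ?n) ^ j) \<longlonglongrightarrow> 0" by (rule LIMSEQ_power_zero) (use n1 in simp)
  then have "(\<lambda>j. ln D - ln c * (1 / real ?n) ^ j + (1 - (1 / real ?n) ^ j) / (real ?n - 1) * ln (cmod (lead_coeff p)))
     \<longlonglongrightarrow> ln D - ln c * 0 + (1 - 0) / (real ?n - 1) * ln (cmod (lead_coeff p))"
    using n1 by (intro tendsto_intros) auto
  moreover have "ln D - ln c * (1 / real ?n) ^ j + (1 - (1 / real ?n) ^ j) / (real ?n - 1) * ln (cmod (lead_coeff p)) = e j" for j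
  proof -
    have alg: "d - l * (1 / x) + (1 - 1 / x) / y * L = d - (l - (x - 1) / y * L) / x" if "x \<noteq> 0" "y \<noteq> 0" for d l x y L :: real
      using that by (simp add: field_simps)
    show ?thesis
      unfolding e_def ln_lead_coeff_iter_poly[OF n] unfolding degree_iter_poly power_one_over of_nat_power
      by (rule alg) (use n1 in auto)
  qed
  ultimately have elim: "e \<longlonglongrightarrow> A" by (simp add: A_def)
  have "lenergy D \<sigma> \<sigma> \<le> ennreal (A + 1 / real (Suc i))" for i
  proof (rule lenergy_lsc_self[OF D _ \<sigma> lim])
    show "borel_prob_on (cball 0 \<rho>) ((M \<circ> r) k)" for k using Mb by simp
    have "\<forall>\<^sub>F k in sequentially. (e \<circ> r) k < A + 1 / real (Suc i)"
      using LIMSEQ_subseq_LIMSEQ[OF elim r] by (rule order_tendstoD) simp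
    then show "\<forall>\<^sub>F k in sequentially. lenergy D ((M \<circ> r) k) ((M \<circ> r) k) \<le> ennreal (A + 1 / real (Suc i))"
    proof eventually_elim
      case (elim k)
      show ?case unfolding o_def by (rule order_trans[OF M(2) ennreal_leI]) (use elim in simp)
    qed
  qed
  moreover have "(\<lambda>i. ennreal (A + 1 / real (Suc i))) \<longlonglongrightarrow> ennreal (A + 0)"
    by (intro tendsto_ennrealI tendsto_add tendsto_const lim_1_over_n[THEN LIMSEQ_Suc])
  ultimately have E: "lenergy D \<sigma> \<sigma> \<le> ennreal A"
    by (intro LIMSEQ_le_const[of "\<lambda>i. ennreal (A + 1 / real (Suc i))"]) auto
  have "?J \<subseteq> cball 0 \<rho>" using closed_filled_julia(2)[OF er(1)] c(2) by fastforce
  then obtain \<omega> where \<omega>: "min_energy D ?J \<omega>"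
    using min_energy_exists[OF D _ closed_filled_julia(1)[OF er(1)] \<sigma>J] E
    by (metis ennreal_less_top le_less_trans infinity_ennreal_def)
  moreover have "lenergy D \<omega> \<omega> \<le> ennreal A" using \<omega> \<sigma>J E unfolding min_energy_def by (meson order_trans)
  ultimately show ?thesis unfolding A_def by blast
qed

text \<open>With \<open>A\<close> and \<open>B\<close> the two energy bounds, the Julia set lies
  where \<open>lem_pot\<close> is constant, so the mutual energy is at least \<open>B\<close>.
  Polarization then leaves at most \<open>A + B - 2 B\<close> for the distance.\<close>

lemma energy_dist_julia_lemniscate:
  assumes D: "0 < \<rho>" "2 * \<rho> \<le> D" "1 \<le> D" and er: "escape_radius p c" "c < \<rho>" and n: "2 \<le> degree p"
    and \<omega>: "borel_prob_on (filled_julia p) \<omega>"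
      "lenergy D \<omega> \<omega> \<le> ennreal (ln D + ln (cmod (lead_coeff p)) / (real (degree p) - 1))"
    and \<kappa>: "borel_prob_on (cball 0 \<rho>) \<kappa>"
      "lenergy D \<kappa> \<kappa> \<le> ennreal (ln D - (ln c - ln (cmod (lead_coeff p))) / real (degree p))"
      "\<And>z. cmod z < \<rho> \<Longrightarrow> ennreal (ln D - lem_pot p c z) \<le> lpot D \<kappa> z"
    and V0: "(ln c - ln (cmod (lead_coeff p))) / real (degree p) \<le> ln D"
      "- ln D \<le> ln (cmod (lead_coeff p)) / (real (degree p) - 1)"
  shows "energy_dist \<omega> \<kappa> \<le> ennreal (ln (cmod (lead_coeff p)) / (real (degree p) - 1) + (ln c - ln (cmod (lead_coeff p))) / real (degree p))"
proof -
  let ?J = "filled_julia p"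
  have c: "0 < c" "c < \<rho>" using er by (auto simp: escape_radius_def)
  define A where "A = ln D + ln (cmod (lead_coeff p)) / (real (degree p) - 1)"
  define B where "B = ln D - (ln c - ln (cmod (lead_coeff p))) / real (degree p)"
  \<comment> \<open>The two assumptions in \<open>V0\<close> ensure that \<open>ennreal\<close> does
    not clip \<open>A\<close> or \<open>B\<close>.\<close>
  have AB: "0 \<le> A" "0 \<le> B" using V0 by (auto simp: A_def B_def)
  note J = closed_filled_julia[OF er(1)]
  have Jb: "?J \<in> sets borel" using J(1) by auto
  have "?J \<subseteq> cball 0 \<rho>" using J(2) c(2) by fastforce
  then have \<omega>b: "borel_prob_on (cball 0 \<rho>) \<omega>" by (intro borel_prob_on_mono[OF \<omega>(1)] Jb) auto
  interpret prob_space \<omega> using borel_prob_onD(3)[OF \<omega>(1)] .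
  have "ennreal B = (\<integral>\<^sup>+z. ennreal B \<partial>\<omega>)" by (simp add: emeasure_space_1)
  also have "\<dots> \<le> lenergy D \<omega> \<kappa>"
    unfolding lenergy_def
  proof (rule nn_integral_mono_AE)
    show "AE z in \<omega>. ennreal B \<le> lpot D \<kappa> z"
      using borel_prob_on_AE[OF \<omega>(1) Jb]
    proof eventually_elim
      case (elim z)
      have "lem_pot p c z = ln D - B" using J(3)[OF elim] by (simp add: lem_pot_def B_def max_def)
      moreover have "cmod z < \<rho>" using elim J(2) c(2) by fastforce
      ultimately show ?case using \<kappa>(3)[of z] by simp
    qed
  qed
  finally have "2 * ennreal B + energy_dist \<omega> \<kappa> \<le> 2 * lenergy D \<omega> \<kappa> + energy_dist \<omega> \<kappa>"
    by (intro add_right_mono mult_left_mono) auto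
  also have "\<dots> = lenergy D \<omega> \<omega> + lenergy D \<kappa> \<kappa>" by (rule lenergy_polarization[OF D(2,3) \<omega>b \<kappa>(1), symmetric])
  also have "\<dots> \<le> ennreal A + ennreal B" unfolding A_def B_def by (intro add_mono \<omega>(2) \<kappa>(2))
  finally have le: "2 * ennreal B + energy_dist \<omega> \<kappa> \<le> ennreal A + ennreal B" .
  then have "energy_dist \<omega> \<kappa> \<noteq> \<infinity>" by (auto simp: top_unique simp flip: ennreal_plus)
  then obtain d where d: "energy_dist \<omega> \<kappa> = ennreal d" "0 \<le> d" by (cases "energy_dist \<omega> \<kappa>") auto
  have "ennreal (B + B + d) = ennreal (B + B) + ennreal d" by (rule ennreal_plus) (use AB d(2) in auto)
  moreover have "ennreal (B + B) = ennreal B + ennreal B" by (rule ennreal_plus) (use AB in auto)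
  moreover have "ennreal (A + B) = ennreal A + ennreal B" by (rule ennreal_plus) (use AB in auto)
  ultimately have "ennreal (B + B + d) \<le> ennreal (A + B)"
    using le unfolding d(1) mult_2 by (simp only:)
  then have "d \<le> A - B" using AB by (subst (asm) ennreal_le_iff) auto
  then show ?thesis unfolding d(1) A_def B_def by (intro ennreal_leI) simp
qed

subsection \<open>Potentials off the support\<close>

lemma tendsto_by_subsequences:
  fixes X :: "nat \<Rightarrow> 'a::metric_space"
  assumes "\<And>s. strict_mono s \<Longrightarrow> \<exists>r::nat \<Rightarrow> nat. strict_mono r \<and> (X \<circ> s \<circ> r) \<longlonglongrightarrow> L"
  shows "X \<longlonglongrightarrow> L"
proof (rule ccontr)
  assume "\<not> X \<longlonglongrightarrow> L"
  then obtain e where e: "e > 0" and "infinite {n. \<not> dist (X n) L < e}"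
    by (auto simp: tendsto_iff not_eventually INFM_iff_infinite cofinite_eq_sequentially[symmetric])
  then obtain s :: "nat \<Rightarrow> nat" where s: "\<And>n. \<not> dist (X (s n)) L < e" and sm: "strict_mono s"
    using enumerate_in_set enumerate_mono by (fastforce simp: strict_mono_def)
  obtain r :: "nat \<Rightarrow> nat" where "(X \<circ> s \<circ> r) \<longlonglongrightarrow> L" using assms[OF sm] by blast
  from tendstoD[OF this e] s show False by simp
qed

text \<open>Identity theorem for harmonic functions, with harmonicity expressed as being locally the
  real part of a holomorphic function. If \<open>V\<close> vanishes near a point of a disc,
  \<open>F\<close> maps an open set into the imaginary axis and is constant by the open mapping
  theorem. So the points near which \<open>V\<close> vanishes form a set that is open and relatively
  closed.\<close>

lemma locally_Re_holomorphic_identity: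
  fixes V :: "complex \<Rightarrow> real"
  assumes \<Omega>: "open \<Omega>" "connected \<Omega>"
    and loc: "\<And>z. z \<in> \<Omega> \<Longrightarrow> \<exists>r F. 0 < r \<and> ball z r \<subseteq> \<Omega> \<and> F holomorphic_on ball z r \<and> (\<forall>w\<in>ball z r. V w = Re (F w))"
    and z1: "z1 \<in> \<Omega>" "0 < e1" "\<And>w. w \<in> ball z1 e1 \<Longrightarrow> V w = 0" and z: "z \<in> \<Omega>"
  shows "V z = 0"
proof -
  define S where "S = {z \<in> \<Omega>. \<exists>e>0. \<forall>w\<in>ball z e. V w = 0}"
  have dich: "\<exists>r>0. ball z r \<subseteq> \<Omega> \<and> (ball z r \<subseteq> S \<or> ball z r \<inter> S = {})" if z: "z \<in> \<Omega>" for z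
  proof -
    obtain r F where r: "0 < r" "ball z r \<subseteq> \<Omega>" and F: "F holomorphic_on ball z r" "\<And>w. w \<in> ball z r \<Longrightarrow> V w = Re (F w)"
      using loc[OF z] by blast
    have "ball z r \<subseteq> S" if ne: "ball z r \<inter> S \<noteq> {}"
    proof -
      obtain y e where y: "y \<in> ball z r" and e: "0 < e" "\<And>w. w \<in> ball y e \<Longrightarrow> V w = 0"
        using ne unfolding S_def by blast
      define U where "U = ball y e \<inter> ball z r"
      have U: "open U" "y \<in> U" "U \<subseteq> ball z r" using y e by (auto simp: U_def)
      have "F constant_on ball z r"
      proof (rule ccontr)
        assume "\<not> F constant_on ball z r"
        then have "open (F ` U)"
          by (intro open_mapping_thm[OF F(1) _ _ U(1,3)]) auto
        then obtain d where d: "0 < d" "ball (F y) d \<subseteq> F ` U"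
          using U(2) by (meson imageI openE)
        have "F y + of_real (d/2) \<in> ball (F y) d" using d by (simp add: dist_norm)
        then obtain u where "u \<in> U" "F u = F y + of_real (d/2)" using d by (metis image_iff subsetD)
        then have "V u = V y + d/2" using F(2)[of u] F(2)[OF y] U(3) by auto
        moreover have "V u = 0" "V y = 0" using e \<open>u \<in> U\<close> U(2) by (auto simp: U_def)
        ultimately show False using d by simp
      qed
      then obtain c where c: "\<And>w. w \<in> ball z r \<Longrightarrow> F w = c" by (auto simp: constant_on_def)
      have "V y = 0" using e by simp
      then have V0: "V w = 0" if "w \<in> ball z r" for w using F(2)[OF that] F(2)[OF y] c[OF that] c[OF y] by simp
      show ?thesis
      proof
        fix w assume w: "w \<in> ball z r"
        then obtain d where d: "0 < d" "ball w d \<subseteq> ball z r" using open_ball openE by blast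
        then have "\<forall>u\<in>ball w d. V u = 0" using V0 by blast
        then show "w \<in> S" using w d(1) r(2) unfolding S_def by blast
      qed
    qed
    then show ?thesis using r by blast
  qed
  have "open S"
    unfolding open_contains_ball
  proof
    fix z assume "z \<in> S"
    then have "z \<in> \<Omega>" by (simp add: S_def)
    from dich[OF this] obtain r where r: "r > 0" "ball z r \<subseteq> S \<or> ball z r \<inter> S = {}" by blast
    have "z \<in> ball z r" using r by simp
    then show "\<exists>e>0. ball z e \<subseteq> S" using \<open>z \<in> S\<close> r by blast
  qed
  moreover have "open (\<Omega> - S)"
    unfolding open_contains_ball
  proof
    fix z assume "z \<in> \<Omega> - S"
    then have "z \<in> \<Omega>" by simp
    from dich[OF this] obtain r where r: "r > 0" "ball z r \<subseteq> \<Omega>" "ball z r \<subseteq> S \<or> ball z r \<inter> S = {}" by blast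
    have "z \<in> ball z r" using r by simp
    then show "\<exists>e>0. ball z e \<subseteq> \<Omega> - S" using \<open>z \<in> \<Omega> - S\<close> r by blast
  qed
  ultimately have "S \<inter> \<Omega> = {} \<or> (\<Omega> - S) \<inter> \<Omega> = {}"
    by (intro connectedD[OF \<Omega>(2)]) auto
  moreover have "z1 \<in> S" using z1 by (auto simp: S_def)
  ultimately have "z \<in> S" using z z1 by blast
  then show ?thesis by (auto simp: S_def)
qed

text \<open>A real-valued potential for points off the support, where the integrand is bounded and
  the convention \<open>ln 0 = 0\<close> does not interfere.\<close>

definition upot :: "complex measure \<Rightarrow> complex \<Rightarrow> real" where
  "upot \<mu> z = (\<integral>w. ln (cmod (z - w)) \<partial>\<mu>)"

lemma upot_eq_tpot:
  assumes \<mu>: "borel_prob_on K \<mu>" and K: "K \<in> sets borel" and off: "\<And>w. w \<in> K \<Longrightarrow> s \<le> cmod (z - w)"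
  shows "upot \<mu> z = tpot s \<mu> z"
proof -
  have [measurable_cong]: "sets \<mu> = sets borel" using borel_prob_onD[OF \<mu>] by blast
  show ?thesis unfolding upot_def tpot_def
    by (rule integral_cong_AE)
       (use borel_prob_on_AE[OF \<mu> K] off in \<open>auto elim!: eventually_mono simp: max_def\<close>)
qed

text \<open>For \<open>w\<close> in \<open>K\<close>, \<open>z - w\<close> is \<open>z0 - w\<close>
  times \<open>1 + (z - z0) / (z0 - w)\<close>. The power series of the logarithm of the second
  factor converges uniformly in \<open>w\<close> and is integrated term by term, so holomorphy in
  \<open>z\<close> comes from a power series.\<close>

lemma upot_locally_Re:
  assumes \<mu>: "borel_prob_on K \<mu>" and K: "compact K" and r: "0 < r" and disj: "ball z0 r \<inter> K = {}"
  shows "\<exists>F. F holomorphic_on ball z0 r \<and> (\<forall>z\<in>ball z0 r. upot \<mu> z = Re (F z))"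
proof -
  have Kb: "K \<in> sets borel" using K by (rule borel_compact)
  interpret prob_space \<mu> using \<mu> by (rule borel_prob_onD)
  have [measurable_cong]: "sets \<mu> = sets borel" using borel_prob_onD[OF \<mu>] by blast
  note AEK = borel_prob_on_AE[OF \<mu> Kb]
  have far: "r \<le> cmod (z0 - w)" if "w \<in> K" for w
    using disj that by (force simp: dist_norm)
  \<comment> \<open>For \<open>n = 0\<close> the division by zero gives coefficient 0, in accordance
    with the library form of the logarithmic series.\<close>
  define a where "a n = (\<integral>w. - ((- inverse (z0 - w)) ^ n) / of_nat n \<partial>\<mu>)" for n
  define F where "F z = (\<Sum>n. a n * (z - z0) ^ n)" for z
  have main: "(\<lambda>n. a n * (z - z0) ^ n) sums (\<integral>w. Ln (1 + (z - z0) / (z0 - w)) \<partial>\<mu>) \<and>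
      integrable \<mu> (\<lambda>w. Ln (1 + (z - z0) / (z0 - w)))" if z: "z \<in> ball z0 r" for z
  proof -
    define t where "t = cmod (z - z0) / r"
    have t: "0 \<le> t" "t < 1" using z r by (auto simp: t_def dist_norm norm_minus_commute)
    have q: "cmod ((z - z0) / (z0 - w)) \<le> t" if "w \<in> K" for w
      unfolding t_def norm_divide using far[OF that] r by (intro divide_left_mono mult_pos_pos) auto
    define f where "f n w = - ((- ((z - z0) / (z0 - w))) ^ n) / of_nat n" for n w
    have [measurable]: "f n \<in> borel_measurable borel" for n unfolding f_def by measurable
    have fn: "cmod (f n w) \<le> t ^ n" if "w \<in> K" for n w
    proof -
      have "cmod (f n w) = cmod ((z - z0) / (z0 - w)) ^ n / real n" by (simp add: f_def norm_divide norm_power)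
      also have "\<dots> \<le> t ^ n"
      proof (cases n)
        case (Suc m)
        have "cmod ((z - z0) / (z0 - w)) ^ n / real n \<le> t ^ n / real n"
          by (intro divide_right_mono power_mono q that) auto
        also have "\<dots> \<le> t ^ n / 1" using t Suc by (intro divide_left_mono) auto
        finally show ?thesis by simp
      qed (use t in simp)
      finally show ?thesis .
    qed
    have fi: "integrable \<mu> (f n)" for n
      by (rule integrable_const_bound[of _ "t ^ n"]) (use AEK fn in \<open>auto elim!: eventually_mono\<close>)
    have st: "summable (\<lambda>n. t ^ n)" using t by (intro summable_geometric) auto
    have A: "AE w in \<mu>. summable (\<lambda>n. norm (f n w))"
      using AEK by eventually_elim (rule summable_comparison_test'[OF st], use fn in auto)
    have B: "summable (\<lambda>n. \<integral>w. norm (f n w) \<partial>\<mu>)"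
    proof (rule summable_comparison_test'[OF st])
      fix n
      have "(\<integral>w. norm (f n w) \<partial>\<mu>) \<le> (\<integral>w. t ^ n \<partial>\<mu>)"
        by (rule integral_mono_AE) (use fi AEK fn in \<open>auto elim!: eventually_mono\<close>)
      then show "norm (\<integral>w. norm (f n w) \<partial>\<mu>) \<le> t ^ n" by (simp add: prob_space)
    qed
    have C: "(\<lambda>n. \<integral>w. f n w \<partial>\<mu>) sums (\<integral>w. (\<Sum>n. f n w) \<partial>\<mu>)" "integrable \<mu> (\<lambda>w. \<Sum>n. f n w)"
      using sums_integral[OF fi A B] integrable_suminf[OF fi A B] by auto
    have Lm[measurable]: "(\<lambda>w. Ln (1 + (z - z0) / (z0 - w))) \<in> borel_measurable borel" by measurable
    have D: "AE w in \<mu>. (\<Sum>n. f n w) = Ln (1 + (z - z0) / (z0 - w))"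
      using AEK
    proof eventually_elim
      case (elim w)
      have "cmod ((z - z0) / (z0 - w)) < 1" using q[OF elim] t by linarith
      from Ln_series'[OF this] show ?case unfolding f_def by (simp add: sums_iff)
    qed
    have "(\<integral>w. f n w \<partial>\<mu>) = a n * (z - z0) ^ n" for n
    proof -
      have "f n w = (z - z0) ^ n * (- ((- inverse (z0 - w)) ^ n) / of_nat n)" for w
      proof -
        have e: "- ((z - z0) / (z0 - w)) = (z - z0) * (- inverse (z0 - w))" by (simp add: divide_inverse)
        show ?thesis unfolding f_def e power_mult_distrib by simp
      qed
      then show ?thesis unfolding a_def by simp
    qed
    moreover have "(\<integral>w. (\<Sum>n. f n w) \<partial>\<mu>) = (\<integral>w. Ln (1 + (z - z0) / (z0 - w)) \<partial>\<mu>)"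
      by (rule integral_cong_AE) (use D in auto)
    moreover have "integrable \<mu> (\<lambda>w. Ln (1 + (z - z0) / (z0 - w)))"
      using C(2) D by (subst integrable_cong_AE[symmetric, of "\<lambda>w. \<Sum>n. f n w"]) auto
    ultimately show ?thesis using C(1) by simp
  qed
  have FL: "F z = (\<integral>w. Ln (1 + (z - z0) / (z0 - w)) \<partial>\<mu>)" if "z \<in> ball z0 r" for z
    using main[OF that] by (simp add: F_def sums_iff)
  have "F holomorphic_on ball z0 r"
    by (rule power_series_holomorphic[of z0 r a]) (use main FL in auto)
  then have hol: "(\<lambda>z. F z + of_real (upot \<mu> z0)) holomorphic_on ball z0 r" by (intro holomorphic_intros)
  have i0: "integrable \<mu> (\<lambda>w. ln (cmod (z0 - w)))"
    by (rule integrable_continuous_on_compact[OF \<mu> K]) (use far r in \<open>fastforce intro!: continuous_intros\<close>)+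
  have "upot \<mu> z = Re (F z + of_real (upot \<mu> z0))" if z: "z \<in> ball z0 r" for z
  proof -
    have iL: "integrable \<mu> (\<lambda>w. Ln (1 + (z - z0) / (z0 - w)))" using main[OF z] by blast
    have [measurable]: "(\<lambda>w. Ln (1 + (z - z0) / (z0 - w))) \<in> borel_measurable borel" by measurable
    have "upot \<mu> z = (\<integral>w. ln (cmod (z0 - w)) + Re (Ln (1 + (z - z0) / (z0 - w))) \<partial>\<mu>)"
      unfolding upot_def
    proof (rule integral_cong_AE)
      show "AE w in \<mu>. ln (cmod (z - w)) = ln (cmod (z0 - w)) + Re (Ln (1 + (z - z0) / (z0 - w)))"
        using AEK
      proof eventually_elim
        case (elim w)
        have nz: "z0 - w \<noteq> 0" using far[OF elim] r by auto
        have zw: "z - w \<noteq> 0" using z elim disj by auto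
        have eq: "z - w = (z0 - w) * (1 + (z - z0) / (z0 - w))" using nz by (simp add: field_simps)
        then have nz2: "1 + (z - z0) / (z0 - w) \<noteq> 0" using zw by auto
        have "ln (cmod (z - w)) = ln (cmod (z0 - w)) + ln (cmod (1 + (z - z0) / (z0 - w)))"
          using nz nz2 by (subst eq) (simp add: norm_mult ln_mult_pos)
        then show ?case using nz2 by (simp add: Re_Ln)
      qed
    qed measurable
    also have "\<dots> = upot \<mu> z0 + Re (F z)"
      unfolding FL[OF z] upot_def using i0 iL by simp
    finally show ?thesis by simp
  qed
  with hol show ?thesis by blast
qed

lemma upot_identity:
  assumes \<mu>: "borel_prob_on K \<mu>" and \<nu>: "borel_prob_on K \<nu>" and K: "compact K" "connected (- K)"
    and eq: "\<And>z. R < cmod z \<Longrightarrow> upot \<mu> z = upot \<nu> z" and z: "z \<notin> K"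
  shows "upot \<mu> z = upot \<nu> z"
proof -
  obtain B where B: "0 < B" "\<And>w. w \<in> K \<Longrightarrow> cmod w \<le> B" using compact_imp_bounded[OF K(1)] by (auto simp: bounded_pos)
  define z1 where "z1 = complex_of_real (max B R + 2)"
  have z1: "cmod w > max B R" if "w \<in> ball z1 1" for w
    using that norm_triangle_ineq2[of z1 "z1 - w"] B(1) by (auto simp: z1_def dist_norm)
  have "upot \<mu> z - upot \<nu> z = 0"
  proof (rule locally_Re_holomorphic_identity[of "- K" "\<lambda>z. upot \<mu> z - upot \<nu> z" z1 1])
    show "open (- K)" using K compact_imp_closed by blast
    fix z assume "z \<in> - K"
    then obtain r where r: "0 < r" "ball z r \<subseteq> - K" using compact_imp_closed[OF K(1)] open_Compl openE by blast
    then have d: "ball z r \<inter> K = {}" by blast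
    obtain F G where "F holomorphic_on ball z r" "\<forall>w\<in>ball z r. upot \<mu> w = Re (F w)"
      "G holomorphic_on ball z r" "\<forall>w\<in>ball z r. upot \<nu> w = Re (G w)"
      using upot_locally_Re[OF \<mu> K(1) r(1) d] upot_locally_Re[OF \<nu> K(1) r(1) d] by blast
    then show "\<exists>r F. 0 < r \<and> ball z r \<subseteq> - K \<and> F holomorphic_on ball z r \<and> (\<forall>w\<in>ball z r. upot \<mu> w - upot \<nu> w = Re (F w))"
      using r by (intro exI[of _ r] exI[of _ "\<lambda>w. F w - G w"]) (auto intro!: holomorphic_intros)
  next
    show "z1 \<in> - K" using B z1[of z1] by force
    show "upot \<mu> w - upot \<nu> w = 0" if "w \<in> ball z1 1" for w using eq[of w] z1[OF that] by simp
  qed (use K z in auto)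
  then show ?thesis by simp
qed

lemma upot_near_ln:
  assumes \<mu>: "borel_prob_on K \<mu>" and K: "K \<subseteq> cball 0 B" "compact K" "0 < B" and z: "B < cmod z"
  shows "\<bar>upot \<mu> z - ln (cmod z)\<bar> \<le> B / (cmod z - B)"
proof -
  define s where "s = cmod z - B"
  have s: "0 < s" using z by (simp add: s_def)
  have Kb: "K \<in> sets borel" using K by (intro borel_compact)
  interpret prob_space \<mu> using \<mu> by (rule borel_prob_onD)
  have off: "s \<le> cmod (z - w)" if "w \<in> K" for w
    using that K norm_triangle_ineq2[of z w] by (force simp: s_def)
  have i: "integrable \<mu> (\<lambda>w. ln (max s (cmod (z - w))))" by (rule integrable_ln_max[OF \<mu> K(2) s])
  have "\<bar>upot \<mu> z - ln (cmod z)\<bar> = \<bar>\<integral>w. ln (max s (cmod (z - w))) - ln (max s (cmod z)) \<partial>\<mu>\<bar>"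
    using upot_eq_tpot[OF \<mu> Kb, of s z] off i K(3) by (simp add: tpot_def prob_space s_def)
  also have "\<dots> \<le> (\<integral>w. \<bar>ln (max s (cmod (z - w))) - ln (max s (cmod z))\<bar> \<partial>\<mu>)" by (rule integral_abs_bound)
  also have "\<dots> \<le> (\<integral>w. B / s \<partial>\<mu>)"
  proof (rule integral_mono_AE)
    show "AE w in \<mu>. \<bar>ln (max s (cmod (z - w))) - ln (max s (cmod z))\<bar> \<le> B / s"
      using borel_prob_on_AE[OF \<mu> Kb]
    proof eventually_elim
      case (elim w)
      have "\<bar>ln (max s (cmod (z - w))) - ln (max s (cmod z))\<bar> \<le> \<bar>cmod (z - w) - cmod z\<bar> / s"
        by (rule ln_max_lipschitz[OF s])
      also have "\<dots> \<le> B / s"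
        using elim K norm_triangle_ineq3[of "z - w" z] s by (intro divide_right_mono) (auto intro: order_trans)
      finally show ?case .
    qed
  qed (use i in auto)
  finally show ?thesis by (simp add: prob_space s_def)
qed

text \<open>A potential constant near one point would be constant on the connected complement of
  \<open>K\<close>, but it grows like \<open>ln |z|\<close>.\<close>

lemma upot_nonconstant:
  assumes \<mu>: "borel_prob_on K \<mu>" and K: "compact K" "connected (- K)" and z0: "z0 \<notin> K" "0 < e"
  shows "\<exists>z\<in>ball z0 e. z \<notin> K \<and> upot \<mu> z \<noteq> upot \<mu> z0"
proof (rule ccontr)
  assume const: "\<not> (\<exists>z\<in>ball z0 e. z \<notin> K \<and> upot \<mu> z \<noteq> upot \<mu> z0)"
  have op: "open (- K)" using K compact_imp_closed by blast
  obtain d where d: "0 < d" "ball z0 d \<subseteq> - K" using op z0 by (meson ComplI openE)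
  have all: "upot \<mu> z - upot \<mu> z0 = 0" if "z \<in> - K" for z
  proof (rule locally_Re_holomorphic_identity[of "- K" "\<lambda>z. upot \<mu> z - upot \<mu> z0" z0 "min d e"])
    fix z assume "z \<in> - K"
    then obtain r where r: "0 < r" "ball z r \<subseteq> - K" using op openE by blast
    then have dis: "ball z r \<inter> K = {}" by blast
    obtain F where "F holomorphic_on ball z r" "\<forall>w\<in>ball z r. upot \<mu> w = Re (F w)"
      using upot_locally_Re[OF \<mu> K(1) r(1) dis] by blast
    then show "\<exists>r F. 0 < r \<and> ball z r \<subseteq> - K \<and> F holomorphic_on ball z r \<and> (\<forall>w\<in>ball z r. upot \<mu> w - upot \<mu> z0 = Re (F w))"
      using r by (intro exI[of _ r] exI[of _ "\<lambda>w. F w - of_real (upot \<mu> z0)"]) (auto intro!: holomorphic_intros)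
  next
    fix w assume "w \<in> ball z0 (min d e)"
    then have "w \<in> ball z0 e" "w \<notin> K" using d by auto
    then show "upot \<mu> w - upot \<mu> z0 = 0" using const by auto
  qed (use op K z0 d that in auto)
  obtain B where B: "0 < B" "\<And>w. w \<in> K \<Longrightarrow> cmod w \<le> B" using compact_imp_bounded[OF K(1)] by (auto simp: bounded_pos)
  have KB: "K \<subseteq> cball 0 B" using B by auto
  \<comment> \<open>Far enough that the error \<open>B / (x - B)\<close> is at most 1 while
    \<open>ln x\<close> exceeds the supposed constant by at least 2.\<close>
  define x where "x = max (2 * B) (exp (\<bar>upot \<mu> z0\<bar> + 2))"
  have x: "2 * B \<le> x" "\<bar>upot \<mu> z0\<bar> + 2 \<le> ln x"
  proof -
    show "2 * B \<le> x" by (simp add: x_def)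
    have "ln (exp (\<bar>upot \<mu> z0\<bar> + 2)) \<le> ln x" by (rule ln_mono) (auto simp: x_def)
    then show "\<bar>upot \<mu> z0\<bar> + 2 \<le> ln x" by simp
  qed
  have cx: "cmod (of_real x) = x" using x B by simp
  have "of_real x \<notin> K" using B(2)[of "of_real x"] x(1) B(1) cx by force
  then have "upot \<mu> (of_real x) = upot \<mu> z0" using all by simp
  moreover have "\<bar>upot \<mu> (of_real x) - ln x\<bar> \<le> B / (x - B)"
    using upot_near_ln[OF \<mu> KB K(1) B(1), of "of_real x"] x B cx by simp
  moreover have "B / (x - B) \<le> 1" using x B by simp
  ultimately show False using x(2) by linarith
qed

section \<open>The Green's function as a real potential\<close>

lemma ext_integral_ereal:
  assumes "integrable \<mu> f"
  shows "ext_integral \<mu> (\<lambda>x. ereal (f x)) = ereal (\<integral>x. f x \<partial>\<mu>)"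
proof -
  have fin: "(\<integral>\<^sup>+x. ennreal (f x) \<partial>\<mu>) < \<infinity>" "(\<integral>\<^sup>+x. ennreal (- f x) \<partial>\<mu>) < \<infinity>"
    using integrableD(2)[OF assms] integrableD(3)[OF assms] by (auto simp: less_top)
  obtain a where a: "(\<integral>\<^sup>+x. ennreal (f x) \<partial>\<mu>) = ennreal a" "0 \<le> a" using fin(1) by (cases "\<integral>\<^sup>+x. ennreal (f x) \<partial>\<mu>") auto
  obtain b where b: "(\<integral>\<^sup>+x. ennreal (- f x) \<partial>\<mu>) = ennreal b" "0 \<le> b" using fin(2) by (cases "\<integral>\<^sup>+x. ennreal (- f x) \<partial>\<mu>") auto
  have "(\<integral>x. f x \<partial>\<mu>) = a - b" using a b by (simp add: real_lebesgue_integral_def[OF assms])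
  then show ?thesis unfolding ext_integral_def uminus_ereal.simps e2ennreal_ereal a(1) b(1)
    using a(2) b(2) by (simp add: enn2ereal_ennreal)
qed

lemma log_potential_eq_upot:
  assumes \<mu>: "borel_prob_on K \<mu>" and K: "compact K" and z: "z \<notin> K"
  shows "log_potential \<mu> z = ereal (upot \<mu> z)"
proof -
  have "AE w in \<mu>. log_dist z w = ereal (ln (cmod (z - w)))"
    using borel_prob_on_AE[OF \<mu> borel_compact[OF K]] by eventually_elim (use z in \<open>auto simp: log_dist_def\<close>)
  then have "log_potential \<mu> z = ext_integral \<mu> (\<lambda>w. ereal (ln (cmod (z - w))))"
    unfolding log_potential_def by (rule ext_integral_cong_AE)
  also have "\<dots> = ereal (upot \<mu> z)" unfolding upot_def
    by (intro ext_integral_ereal integrable_continuous_on_compact[OF \<mu> K])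
       (use z in \<open>auto intro!: continuous_intros\<close>)
  finally show ?thesis .
qed

lemma green_eq:
  assumes D: "2 * \<rho> \<le> D" "1 \<le> D" and K: "compact K" "K \<subseteq> cball 0 \<rho>"
    and \<omega>: "min_energy D K \<omega>" and z: "z \<notin> K"
  shows "green K z = upot \<omega> z - (ln D - enn2real (lenergy D \<omega> \<omega>))"
proof -
  have Kb: "K \<in> sets borel" using K by (intro borel_compact)
  have eq: "equilibrium_measure K = \<omega>" by (rule equilibrium_measure_eqI[OF D K(2) Kb \<omega>])
  have \<omega>K: "borel_prob_on K \<omega>" and fin: "lenergy D \<omega> \<omega> < \<infinity>" using \<omega> by (auto simp: min_energy_def)
  obtain e where e: "lenergy D \<omega> \<omega> = ennreal e" "0 \<le> e" using fin by (cases "lenergy D \<omega> \<omega>") auto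
  have "log_energy \<omega> = ereal (ln D - e)"
    unfolding log_energy_eq_lenergy[OF D borel_prob_on_mono[OF \<omega>K K(2) Kb borel_closed[OF closed_cball]]] e(1)
    using e(2) by (simp add: enn2ereal_ennreal)
  then show ?thesis
    unfolding green_def eq log_potential_eq_upot[OF \<omega>K K(1) z] e(1) using e(2) by simp
qed

subsection \<open>Growth of regular sequences off the compact set\<close>

text \<open>The growth of the leading coefficients is part of the conclusion. Along a subsequence
  with zero measures tending to \<open>\<tau>\<close>, beyond \<open>R\<close> the normalised
  logarithms of the leading coefficients tend to \<open>upot \<omega> z - I - upot \<tau> z\<close>.
  This cannot depend on \<open>z\<close>, and since both potentials approach \<open>ln |z|\<close>
  at infinity it equals \<open>- I\<close>. The potentials then agree beyond \<open>R\<close>, hence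
  on the connected complement of \<open>K\<close>.\<close>

lemma zero_measure_limit:
  assumes K: "compact K" "K \<noteq> {}" "connected (- K)" "K \<subseteq> ball 0 R" "0 < R" and \<omega>: "borel_prob_on K \<omega>"
    and deg: "filterlim (\<lambda>k. degree (q k)) at_top sequentially"
    and lim: "\<And>z. R \<le> cmod z \<Longrightarrow> (\<lambda>k. ln (cmod (poly (q k) z)) / real (degree (q k))) \<longlonglongrightarrow> upot \<omega> z - I"
    and zeros: "\<And>k. N \<le> k \<Longrightarrow> {z. poly (q k) z = 0} \<subseteq> ball 0 R"
    and cent: "\<And>L. closed L \<Longrightarrow> L \<inter> K = {} \<Longrightarrow> \<exists>M. \<forall>k\<ge>N. size {#z \<in># proots (q k). z \<in> L#} \<le> M"
  shows "(\<lambda>k. ln (cmod (lead_coeff (q k))) / real (degree (q k))) \<longlonglongrightarrow> - I"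
    and "0 < r \<Longrightarrow> ball z r \<inter> K = {} \<Longrightarrow> (\<lambda>k. tpot r (zero_measure (q k)) z) \<longlonglongrightarrow> upot \<omega> z"
proof -
  define n where "n k = degree (q k)" for k
  define b where "b k = ln (cmod (lead_coeff (q k))) / real (n k)" for k
  define T where "T k = zero_measure (q k)" for k
  obtain N1 where N1: "N \<le> N1" "\<And>k. N1 \<le> k \<Longrightarrow> 0 < n k"
  proof -
    have "\<forall>\<^sub>F k in sequentially. 1 \<le> degree (q k)" using deg by (simp add: filterlim_at_top)
    then obtain N0 where "\<And>k. N0 \<le> k \<Longrightarrow> 1 \<le> degree (q k)" unfolding eventually_sequentially by blast
    then show thesis by (intro that[of "max N N0"]) (auto simp: n_def Suc_le_eq)
  qed
  have Kb: "K \<in> sets borel" and Kc: "closed K" using K by (auto intro: borel_compact compact_imp_closed)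
  have KR: "K \<subseteq> cball 0 R" using K(4) by auto
  have sub: "\<exists>r. strict_mono r \<and> (b \<circ> s \<circ> r) \<longlonglongrightarrow> - I \<and>
      (\<forall>t z. 0 < t \<longrightarrow> ball z t \<inter> K = {} \<longrightarrow> ((\<lambda>k. tpot t (T k) z) \<circ> s \<circ> r) \<longlonglongrightarrow> upot \<omega> z)" if s: "strict_mono s" for s :: "nat \<Rightarrow> nat"
  proof -
    \<comment> \<open>The shift skips the terms of degree 0 and those whose zeros are not yet known
      to lie in the disc.\<close>
    define M where "M k = T (s (k + N1))" for k
    have sk: "N1 \<le> s (k + N1)" for k using seq_suble[OF s, of "k + N1"] by linarith
    have Mb: "borel_prob_on (cball 0 R) (M k)" for k
      unfolding M_def T_def
      by (rule borel_prob_on_zero_measure) (use N1 sk[of k] zeros[of "s (k + N1)"] in \<open>auto simp: n_def\<close>)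
    obtain r0 \<tau> where r0: "strict_mono r0" and \<tau>: "borel_prob_on (cball 0 R) \<tau>" and wl: "weak_lim (M \<circ> r0) \<tau>"
      using weak_compactness[of R M, OF K(5) Mb] by (elim exE conjE) (rule that)
    define r where "r k = r0 k + N1" for k
    have r: "strict_mono r" using r0 by (auto simp: r_def strict_mono_def)
    have Mr: "(M \<circ> r0) k = T (s (r k))" for k by (simp add: M_def r_def)
    have srN: "N1 \<le> s (r k)" for k using sk[of "r0 k"] by (simp add: r_def)
    have sr: "strict_mono (\<lambda>k. s (r k))" using s r by (simp add: strict_mono_def)
    interpret \<tau>: prob_space \<tau> using \<tau> by (rule borel_prob_onD)
    have "AE z in \<tau>. infdist z K \<le> d" if d: "0 < d" for d
    proof -
      \<comment> \<open>\<open>f\<close> vanishes within distance \<open>d\<close> of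
        \<open>K\<close> and is at most 1, so at most \<open>B\<close> of the \<open>n\<close> roots
        contribute to its integral.\<close>
      define f where "f z = min 1 (max 0 (infdist z K - d))" for z
      have fc: "continuous_on UNIV f" unfolding f_def by (intro continuous_intros)
      define L where "L = {z. d \<le> infdist z K}"
      have "closed L" unfolding L_def by (intro closed_Collect_le continuous_intros)
      moreover have "L \<inter> K = {}" using d by (auto simp: L_def)
      ultimately obtain B where B: "\<And>k. N \<le> k \<Longrightarrow> size {#z \<in># proots (q k). z \<in> L#} \<le> B" using cent by blast
      have up: "(\<integral>z. f z \<partial>(M \<circ> r0) k) \<le> real B / real (n (s (r k)))" for k
      proof -
        have "0 < degree (q (s (r k)))" using N1(2)[OF srN] by (simp add: n_def)
        then have "(\<integral>z. f z \<partial>(M \<circ> r0) k) = (\<Sum>z\<in>#proots (q (s (r k))). f z) / real (n (s (r k)))"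
          unfolding Mr T_def n_def by (rule integral_zero_measure) (rule borel_measurable_continuous_UNIV[OF fc])
        also have "\<dots> \<le> (\<Sum>z\<in>#proots (q (s (r k))). if z \<in> L then 1 else 0) / real (n (s (r k)))"
          by (intro divide_right_mono sum_mset_mono) (auto simp: f_def L_def)
        also have "(\<Sum>z\<in>#A. if z \<in> L then 1 else 0) = real (size {#z \<in># A. z \<in> L#})" for A
          by (induction A) auto
        also have "real (size {#z \<in># proots (q (s (r k))). z \<in> L#}) / real (n (s (r k))) \<le> real B / real (n (s (r k)))"
          using B[of "s (r k)"] srN[of k] N1(1) by (intro divide_right_mono) auto
        finally show ?thesis .
      qed
      have "filterlim (\<lambda>k. real (n (s (r k)))) at_top sequentially"
        unfolding n_def using filterlim_compose[OF deg filterlim_subseq[OF sr]]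
        by (intro filterlim_compose[OF filterlim_real_sequentially])
      then have "(\<lambda>k. real B / real (n (s (r k)))) \<longlonglongrightarrow> 0"
        by (intro tendsto_divide_0[OF tendsto_const] filterlim_at_top_imp_at_infinity)
      then have "(\<integral>z. f z \<partial>\<tau>) \<le> 0"
        by (rule LIMSEQ_le[OF weak_limD[OF wl fc]]) (use up in blast)
      moreover have "0 \<le> (\<integral>z. f z \<partial>\<tau>)" by (intro Bochner_Integration.integral_nonneg) (auto simp: f_def)
      ultimately have "(\<integral>z. f z \<partial>\<tau>) = 0" by simp
      then have "AE z in \<tau>. f z = 0"
        by (subst (asm) integral_nonneg_eq_0_iff_AE[OF integrable_continuous[OF \<tau> compact_cball fc]])
           (auto simp: f_def)
      then show ?thesis by eventually_elim (auto simp: f_def min_def max_def split: if_splits)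
    qed
    then have "AE z in \<tau>. \<forall>j::nat. infdist z K \<le> 1 / real (Suc j)"
      unfolding AE_all_countable by simp
    then have "AE z in \<tau>. z \<in> K"
    proof eventually_elim
      case (elim z)
      have "(\<lambda>j. 1 / real (Suc j)) \<longlonglongrightarrow> 0" by (rule lim_1_over_n[THEN LIMSEQ_Suc])
      then have "infdist z K \<le> 0" by (rule LIMSEQ_le_const) (use elim in auto)
      then have "infdist z K = 0" using infdist_nonneg[of z K] by simp
      then show ?case using Kc K(2) by (simp add: in_closed_iff_infdist_zero)
    qed
    then have \<tau>K: "borel_prob_on K \<tau>" using borel_prob_onD[OF \<tau>] Kb by (subst borel_prob_on_iff_AE) auto
    have bl: "(b \<circ> s \<circ> r) \<longlonglongrightarrow> upot \<omega> z - I - upot \<tau> z" if z: "R < cmod z" for z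
    proof -
      define t where "t = cmod z - R"
      have t: "0 < t" using z by (simp add: t_def)
      have off: "t \<le> cmod (z - x)" if "x \<in> cball 0 R" for x
        using that norm_triangle_ineq2[of z x] by (simp add: t_def)
      have "upot \<tau> z = tpot t \<tau> z" by (rule upot_eq_tpot[OF \<tau>]) (use off in auto)
      moreover have "(\<lambda>k. tpot t ((M \<circ> r0) k) z) \<longlonglongrightarrow> tpot t \<tau> z" by (rule weak_lim_tpot[OF wl t])
      ultimately have 1: "(\<lambda>k. tpot t ((M \<circ> r0) k) z) \<longlonglongrightarrow> upot \<tau> z" by simp
      have 2: "(\<lambda>k. ln (cmod (poly (q (s (r k))) z)) / real (degree (q (s (r k))))) \<longlonglongrightarrow> upot \<omega> z - I"
        using LIMSEQ_subseq_LIMSEQ[OF lim[of z] sr] z by (simp add: o_def)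
      have eq: "tpot t ((M \<circ> r0) k) z = ln (cmod (poly (q (s (r k))) z)) / real (degree (q (s (r k)))) - (b \<circ> s \<circ> r) k" for k
      proof -
        have "0 < degree (q (s (r k)))" using N1(2)[OF srN] by (simp add: n_def)
        then have "tpot t ((M \<circ> r0) k) z = (ln (cmod (poly (q (s (r k))) z)) - ln (cmod (lead_coeff (q (s (r k)))))) / real (degree (q (s (r k))))"
          unfolding Mr T_def
        proof (rule tpot_zero_measure_eq[OF _ t])
          fix x assume "poly (q (s (r k))) x = 0"
          then have "x \<in> cball 0 R" using zeros[of "s (r k)"] srN[of k] N1(1) by auto
          then show "t \<le> cmod (z - x)" by (rule off)
        qed
        then show ?thesis by (simp add: b_def n_def diff_divide_distrib)
      qed
      show ?thesis using tendsto_diff[OF 2 1] unfolding eq by (simp add: o_def)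
    qed
    \<comment> \<open>The limit of \<open>b\<close> does not depend on \<open>z\<close>, so the
      difference of the potentials beyond \<open>R\<close> can be sampled at any point and then
      evaluated by going to infinity.\<close>
    define c where "c = upot \<omega> (of_real (R + 1)) - I - upot \<tau> (of_real (R + 1))"
    have R1: "cmod (of_real x) = x" if "R < x" for x using that K(5) by simp
    have c: "upot \<omega> z - I - upot \<tau> z = c" if "R < cmod z" for z
      unfolding c_def using LIMSEQ_unique[OF bl[OF that] bl[of "of_real (R + 1)"]] R1[of "R + 1"] by simp
    have "\<bar>c + I\<bar> \<le> 2 * R * (1 / real (Suc j))" for j
    proof -
      define x where "x = R + real (Suc j)"
      have x: "R < cmod (of_real x)" "cmod (of_real x) = x" using R1[of x] by (auto simp: x_def)
      have "\<bar>upot \<omega> (of_real x) - ln x\<bar> \<le> R / (x - R)" "\<bar>upot \<tau> (of_real x) - ln x\<bar> \<le> R / (x - R)"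
        using upot_near_ln[OF \<omega> KR K(1,5) x(1)] upot_near_ln[OF \<tau>K KR K(1,5) x(1)] unfolding x(2) by auto
      moreover have "x - R = real (Suc j)" by (simp add: x_def)
      ultimately show ?thesis using c[OF x(1)] by (simp add: abs_le_iff)
    qed
    moreover have "(\<lambda>j. 2 * R * (1 / real (Suc j))) \<longlonglongrightarrow> 2 * R * 0"
      by (intro tendsto_mult tendsto_const lim_1_over_n[THEN LIMSEQ_Suc])
    ultimately have "\<bar>c + I\<bar> \<le> 2 * R * 0" by (intro LIMSEQ_le_const) auto
    then have cI: "c = - I" by simp
    have eqU: "upot \<tau> z = upot \<omega> z" if "z \<notin> K" for z
      by (rule upot_identity[OF \<tau>K \<omega> K(1,3) _ that, of R]) (use c cI in force)
    have "((\<lambda>k. tpot t (T k) z) \<circ> s \<circ> r) \<longlonglongrightarrow> upot \<omega> z" if t: "0 < t" and disj: "ball z t \<inter> K = {}" for t z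
    proof -
      have off: "t \<le> cmod (z - x)" if "x \<in> K" for x using disj that by (force simp: dist_norm)
      have "z \<notin> K" using off[of z] t by auto
      then have "upot \<omega> z = tpot t \<tau> z" using eqU upot_eq_tpot[OF \<tau>K Kb, of t z] off by simp
      then show ?thesis using weak_lim_tpot[OF wl t, of z] unfolding Mr by (simp add: o_def)
    qed
    moreover have "(b \<circ> s \<circ> r) \<longlonglongrightarrow> - I" using bl[of "of_real (R + 1)"] R1[of "R + 1"] c[of "of_real (R + 1)"] cI by simp
    ultimately show ?thesis using r by blast
  qed
  have "b \<longlonglongrightarrow> - I" by (rule tendsto_by_subsequences) (use sub in blast)
  then show "(\<lambda>k. ln (cmod (lead_coeff (q k))) / real (degree (q k))) \<longlonglongrightarrow> - I" by (simp add: b_def[abs_def] n_def)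
  show "(\<lambda>k. tpot r (zero_measure (q k)) z) \<longlonglongrightarrow> upot \<omega> z" if "0 < r" "ball z r \<inter> K = {}"
    unfolding T_def[symmetric] by (rule tendsto_by_subsequences) (use sub that in blast)
qed

text \<open>The lower bound is required only somewhere in each disc, since zeros off \<open>K\<close> are permitted.\<close>

definition growth :: "complex set \<Rightarrow> (nat \<Rightarrow> complex poly) \<Rightarrow> (nat \<Rightarrow> nat) \<Rightarrow> (complex \<Rightarrow> real) \<Rightarrow> bool" where
  "growth \<Omega> q n g \<longleftrightarrow> (\<forall>z\<in>\<Omega>. \<forall>e>0.
     (\<exists>d>0. \<forall>\<^sub>F k in sequentially. \<forall>w\<in>ball z d. cmod (poly (q k) w) \<le> exp (real (n k) * (g z + e))) \<and>
     (\<forall>d>0. \<forall>\<^sub>F k in sequentially. \<exists>w\<in>ball z d. exp (real (n k) * (g z - e)) \<le> cmod (poly (q k) w)))"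

lemma growth_upperD:
  "growth \<Omega> q n g \<Longrightarrow> z \<in> \<Omega> \<Longrightarrow> 0 < e \<Longrightarrow>
    \<exists>d>0. \<forall>\<^sub>F k in sequentially. \<forall>w\<in>ball z d. cmod (poly (q k) w) \<le> exp (real (n k) * (g z + e))"
  unfolding growth_def by blast

lemma growth_lowerD:
  "growth \<Omega> q n g \<Longrightarrow> z \<in> \<Omega> \<Longrightarrow> 0 < e \<Longrightarrow> 0 < d \<Longrightarrow>
    \<forall>\<^sub>F k in sequentially. \<exists>w\<in>ball z d. exp (real (n k) * (g z - e)) \<le> cmod (poly (q k) w)"
  unfolding growth_def by blast

text \<open>Upper bound: \<open>ln |q| / n\<close> is at most the leading term plus the truncated
  potential, which is Lipschitz with constant \<open>1 / r\<close>. Lower bound: if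
  \<open>|q|\<close> were small on a whole disc, a circle mean would force the truncated potential
  at the centre below its limit.\<close>

lemma growth_base:
  assumes K: "closed K" and deg: "filterlim (\<lambda>k. degree (q k)) at_top sequentially"
    and zeros: "\<forall>\<^sub>F k in sequentially. {z. poly (q k) z = 0} \<subseteq> ball 0 R"
    and lead: "(\<lambda>k. ln (cmod (lead_coeff (q k))) / real (degree (q k))) \<longlonglongrightarrow> - I"
    and pot: "\<And>z r. 0 < r \<Longrightarrow> ball z r \<inter> K = {} \<Longrightarrow> (\<lambda>k. tpot r (zero_measure (q k)) z) \<longlonglongrightarrow> U z"
  shows "growth (- K) q (\<lambda>k. degree (q k)) (\<lambda>z. U z - I)"
  unfolding growth_def
proof (intro ballI allI impI conjI)
  fix z :: complex and e :: real assume z: "z \<in> - K" and e: "0 < e"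
  obtain r where r: "0 < r" "ball z r \<inter> K = {}"
    using z K open_Compl openE by (metis Compl_disjoint disjoint_eq_subset_Compl)
  have dpos: "\<forall>\<^sub>F k in sequentially. 0 < degree (q k)"
    using deg by (auto simp: filterlim_at_top Suc_le_eq dest: spec[of _ 1])
  have pb: "\<forall>\<^sub>F k in sequentially. ln (cmod (lead_coeff (q k))) / real (degree (q k)) + tpot r (zero_measure (q k)) z < U z - I + e / 2"
    using tendsto_add[OF lead pot[OF r]] e by (intro order_tendstoD(2)) auto
  show "\<exists>d>0. \<forall>\<^sub>F k in sequentially. \<forall>w\<in>ball z d. cmod (poly (q k) w) \<le> exp (real (degree (q k)) * (U z - I + e))"
  proof (intro exI conjI)
    \<comment> \<open>Moving by \<open>e * r / 2\<close> changes the truncated potential by at most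
      \<open>e / 2\<close>; the other half of \<open>e\<close> pays for the convergence at
      \<open>z\<close>.\<close>
    show "0 < e * r / 2" using e r by simp
    show "\<forall>\<^sub>F k in sequentially. \<forall>w\<in>ball z (e * r / 2). cmod (poly (q k) w) \<le> exp (real (degree (q k)) * (U z - I + e))"
      using dpos pb zeros
    proof eventually_elim
      case (elim k)
      show ?case
      proof
        fix w assume w: "w \<in> ball z (e * r / 2)"
        show "cmod (poly (q k) w) \<le> exp (real (degree (q k)) * (U z - I + e))"
        proof (cases "poly (q k) w = 0")
          case False
          have zm: "borel_prob_on (cball 0 R) (zero_measure (q k))"
            by (rule borel_prob_on_zero_measure[OF elim(1)]) (use elim(3) in auto)
          have "\<bar>tpot r (zero_measure (q k)) w - tpot r (zero_measure (q k)) z\<bar> \<le> cmod (w - z) / r"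
            by (rule tpot_lipschitz[OF zm _ r(1)]) simp
          also have "\<dots> \<le> e / 2" using w r by (simp add: field_simps dist_norm norm_minus_commute)
          finally have t: "tpot r (zero_measure (q k)) w \<le> tpot r (zero_measure (q k)) z + e / 2" by linarith
          have "ln (cmod (poly (q k) w)) / real (degree (q k)) - ln (cmod (lead_coeff (q k))) / real (degree (q k)) \<le> tpot r (zero_measure (q k)) w"
            using tpot_zero_measure_ge[OF elim(1) False r(1)] by (simp add: diff_divide_distrib)
          then have "ln (cmod (poly (q k) w)) / real (degree (q k)) \<le> U z - I + e"
            using t elim(2) by linarith
          then have "ln (cmod (poly (q k) w)) \<le> real (degree (q k)) * (U z - I + e)"
            using elim(1) by (simp add: field_simps)
          then show ?thesis using False by (metis exp_le_cancel_iff exp_ln zero_less_norm_iff)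
        qed simp
      qed
    qed
  qed
  fix d :: real assume d: "0 < d"
  \<comment> \<open>Large enough to contain both the zeros and the circle about
    \<open>z\<close>.\<close>
  define \<rho> where "\<rho> = max (R + 1) (cmod z + d)"
  define D where "D = 2 * \<rho>"
  define h where "h = min (r / 2) (d / 2)"
  have h: "0 < h" "h < d" "h \<le> r" "cmod z + h \<le> \<rho>" using r d by (auto simp: h_def \<rho>_def)
  have \<rho>: "0 < \<rho>" "2 * \<rho> \<le> D" using d norm_ge_zero[of z] by (auto simp: \<rho>_def D_def less_max_iff_disj intro: add_nonneg_pos)
  have disj: "ball z h \<inter> K = {}" using r h by (meson disjoint_iff subset_ball subsetD)
  have pl: "\<forall>\<^sub>F k in sequentially. U z - I - e < ln (cmod (lead_coeff (q k))) / real (degree (q k)) + tpot h (zero_measure (q k)) z"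
    using tendsto_add[OF lead pot[OF h(1) disj]] e by (intro order_tendstoD(1)) auto
  show "\<forall>\<^sub>F k in sequentially. \<exists>w\<in>ball z d. exp (real (degree (q k)) * (U z - I - e)) \<le> cmod (poly (q k) w)"
    using dpos pl zeros
  proof eventually_elim
    case (elim k)
    show ?case
    proof (rule ccontr)
      assume "\<not> ?case"
      then have small: "\<And>w. w \<in> ball z d \<Longrightarrow> cmod (poly (q k) w) < exp (real (degree (q k)) * (U z - I - e))" by force
      have roots: "{z. poly (q k) z = 0} \<subseteq> cball 0 \<rho>" using elim(3) by (auto simp: \<rho>_def dest!: subsetD)
      have zm: "borel_prob_on (cball 0 \<rho>) (zero_measure (q k))"
        by (rule borel_prob_on_zero_measure[OF elim(1) roots]) simp
      define G where "G = U z - I - e - ln (cmod (lead_coeff (q k))) / real (degree (q k))"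
      interpret cm: prob_space "circle_measure z h"
        using borel_prob_onD(3)[OF borel_prob_on_circle_measure] h by simp
      have "tpot h (zero_measure (q k)) z \<le> (\<integral>w. G \<partial>circle_measure z h)"
      proof (rule tpot_le_circle_mean[OF \<rho> zm h(1,4)])
        fix w assume w: "w \<in> sphere z h"
        then have wr: "cmod w \<le> \<rho>" using h norm_triangle_ineq[of z "w - z"] by (simp add: dist_norm norm_minus_commute)
        show "ennreal (ln D - G) \<le> lpot D (zero_measure (q k)) w"
        proof (cases "poly (q k) w = 0")
          case True
          then show ?thesis using lpot_zero_measure[OF \<rho>(2,1) elim(1) roots wr] by simp
        next
          case False
          have "ln (cmod (poly (q k) w)) < ln (exp (real (degree (q k)) * (U z - I - e)))"
            using small[of w] w h False by (subst ln_less_cancel_iff) auto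
          then have "ln (cmod (poly (q k) w)) / real (degree (q k)) \<le> U z - I - e"
            using elim(1) by (simp add: field_simps)
          then have "ln D - G \<le> ln D - (ln (cmod (poly (q k) w)) - ln (cmod (lead_coeff (q k)))) / real (degree (q k))"
            by (simp add: G_def diff_divide_distrib)
          then show ?thesis using lpot_zero_measure[OF \<rho>(2,1) elim(1) roots wr] False by (simp add: ennreal_leI)
        qed
      qed simp
      then show False using elim(2) by (simp add: G_def cm.prob_space)
    qed
  qed
qed

text \<open>For the lower bound: between two nearby points with different values of \<open>g\<close>, the polynomial varies
  by about the larger exponential, so its derivative has that size somewhere in between.\<close>

lemma growth_pderiv:
  assumes gr: "growth \<Omega> q n g" and \<Omega>: "open \<Omega>" and g: "continuous_on \<Omega> g"
    and nc: "\<And>z e. z \<in> \<Omega> \<Longrightarrow> 0 < e \<Longrightarrow> \<exists>w\<in>ball z e. w \<in> \<Omega> \<and> g w \<noteq> g z"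
    and n: "filterlim n at_top sequentially"
  shows "growth \<Omega> (\<lambda>k. pderiv (q k)) n g"
  unfolding growth_def
proof (intro ballI allI impI conjI)
  fix z :: complex and e :: real assume z: "z \<in> \<Omega>" and e: "0 < e"
  have big: "\<forall>\<^sub>F k in sequentially. c \<le> real (n k)" for c :: real
    using filterlim_compose[OF filterlim_real_sequentially n] by (simp add: filterlim_at_top)
  \<comment> \<open>Cauchy's estimate on circles of radius \<open>d / 4\<close> costs the factor
    \<open>4 / d\<close>, which is below \<open>exp (n * e / 2)\<close> for large
    \<open>n\<close>.\<close>
  show "\<exists>d>0. \<forall>\<^sub>F k in sequentially. \<forall>w\<in>ball z d. cmod (poly (pderiv (q k)) w) \<le> exp (real (n k) * (g z + e))"
  proof -
    obtain d where d: "0 < d" and up: "\<forall>\<^sub>F k in sequentially. \<forall>w\<in>ball z d. cmod (poly (q k) w) \<le> exp (real (n k) * (g z + e / 2))"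
      using growth_upperD[OF gr z, of "e / 2"] e by auto
    have "\<forall>\<^sub>F k in sequentially. \<forall>w\<in>ball z (d / 2). cmod (poly (pderiv (q k)) w) \<le> exp (real (n k) * (g z + e))"
      using up big[of "2 * ln (4 / d) / e"]
    proof eventually_elim
      case (elim k)
      have "ln (4 / d) \<le> real (n k) * (e / 2)" using elim(2) e by (simp add: field_simps)
      then have c: "4 / d \<le> exp (real (n k) * (e / 2))" using d by (metis divide_pos_pos exp_le_cancel_iff exp_ln zero_less_numeral)
      show ?case
      proof
        fix w assume w: "w \<in> ball z (d / 2)"
        have dv: "deriv (poly (q k)) w = poly (pderiv (q k)) w" by (rule DERIV_imp_deriv[OF poly_DERIV])
        have "cmod ((deriv ^^ 1) (poly (q k)) w) \<le> fact 1 * exp (real (n k) * (g z + e / 2)) / (d / 4) ^ 1"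
        proof (rule Cauchy_inequality)
          show "poly (q k) holomorphic_on ball w (d / 4)" by (intro holomorphic_intros)
          show "continuous_on (cball w (d / 4)) (poly (q k))" by (intro continuous_intros)
          show "0 < d / 4" using d by simp
          fix x assume "cmod (w - x) = d / 4"
          then have "dist z x < d" using w d dist_triangle[of z x w] by (simp add: dist_norm)
          then show "cmod (poly (q k) x) \<le> exp (real (n k) * (g z + e / 2))" using elim(1) by simp
        qed
        then have "cmod (poly (pderiv (q k)) w) \<le> exp (real (n k) * (g z + e / 2)) * (4 / d)" by (simp add: dv)
        also have "\<dots> \<le> exp (real (n k) * (g z + e / 2)) * exp (real (n k) * (e / 2))" using c by (intro mult_left_mono) auto
        also have "\<dots> = exp (real (n k) * (g z + e))" by (simp add: algebra_simps flip: exp_add)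
        finally show "cmod (poly (pderiv (q k)) w) \<le> exp (real (n k) * (g z + e))" .
      qed
    qed
    then show ?thesis using d by (intro exI[of _ "d / 2"]) auto
  qed
  fix d0 :: real assume d0: "0 < d0"
  obtain d1 where d1: "0 < d1" "ball z d1 \<subseteq> \<Omega>" using \<Omega> z openE by blast
  have "isCont g z" using g \<Omega> z by (simp add: continuous_on_eq_continuous_at)
  then obtain d2 where d2: "0 < d2" "\<And>w. dist w z < d2 \<Longrightarrow> dist (g w) (g z) < e / 4"
    using e unfolding continuous_at_eps_delta by (metis divide_pos_pos zero_less_numeral)
  define d where "d = min d0 (min d1 d2)"
  have d: "0 < d" "d \<le> d0" "ball z d \<subseteq> \<Omega>" "\<And>w. w \<in> ball z d \<Longrightarrow> \<bar>g w - g z\<bar> < e / 4"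
    using d0 d1 d2 by (auto simp: d_def dist_real_def dist_commute)
  obtain y where y: "y \<in> ball z d" "g y \<noteq> g z" using nc[OF z d(1)] by blast
  obtain a b where ab: "a \<in> ball z d" "b \<in> ball z d" "g b < g a"
    using y d(1) that by (cases "g y < g z") (metis centre_in_ball linorder_neqE_linordered_idom)+
  \<comment> \<open>The exponents at \<open>a\<close> and \<open>b\<close> then still differ by
    \<open>2 * \<eta>\<close> after each growth estimate has used up its tolerance
    \<open>\<eta>\<close>.\<close>
  define \<eta> where "\<eta> = min (e / 4) ((g a - g b) / 4)"
  have \<eta>: "0 < \<eta>" "\<eta> \<le> e / 4" "g b + \<eta> \<le> g a - 3 * \<eta>" using e ab by (auto simp: \<eta>_def min_def field_simps)
  obtain db where db: "0 < db" "\<forall>\<^sub>F k in sequentially. \<forall>w\<in>ball b db. cmod (poly (q k) w) \<le> exp (real (n k) * (g b + \<eta>))"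
    using growth_upperD[OF gr _ \<eta>(1), of b] ab d by blast
  obtain da where da: "0 < da" "ball a da \<subseteq> ball z d" using ab(1) open_ball openE by blast
  have low: "\<forall>\<^sub>F k in sequentially. \<exists>w\<in>ball a da. exp (real (n k) * (g a - \<eta>)) \<le> cmod (poly (q k) w)"
    using growth_lowerD[OF gr _ \<eta>(1) da(1), of a] ab d by blast
  show "\<forall>\<^sub>F k in sequentially. \<exists>w\<in>ball z d0. exp (real (n k) * (g z - e)) \<le> cmod (poly (pderiv (q k)) w)"
    \<comment> \<open>The first threshold makes \<open>|q b|\<close> at most half of
      \<open>|q w|\<close>. The second makes \<open>exp (n * e / 2)\<close> exceed
      \<open>4 * d\<close>, which contradicts the mean value estimate across the disc.\<close>
    using db(2) low big[of "ln 2 / (2 * \<eta>)"] big[of "2 * (ln (4 * d) + 1) / e"]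
  proof eventually_elim
    case (elim k)
    show ?case
    proof (rule ccontr)
      assume neg: "\<not> ?case"
      have small: "cmod (poly (pderiv (q k)) w) \<le> exp (real (n k) * (g z - e))" if "w \<in> ball z d" for w
      proof -
        have "w \<in> ball z d0" using that d(2) by auto
        then show ?thesis using neg by (meson linear)
      qed
      obtain w where w: "w \<in> ball a da" "exp (real (n k) * (g a - \<eta>)) \<le> cmod (poly (q k) w)" using elim(2) by blast
      define X where "X = exp (real (n k) * (g a - \<eta>))"
      have "cmod (poly (q k) w - poly (q k) b) \<le> exp (real (n k) * (g z - e)) * cmod (w - b)"
        by (rule field_differentiable_bound[of "ball z d" "poly (q k)" "poly (pderiv (q k))"])
           (use w da ab small in \<open>auto intro!: has_field_derivative_at_within poly_DERIV\<close>)
      also have "\<dots> \<le> exp (real (n k) * (g z - e)) * (2 * d)"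
      proof (intro mult_left_mono)
        have "dist w b < d + d" using w da ab dist_triangle_less_add[of w z d b d] by (auto simp: dist_commute)
        then show "cmod (w - b) \<le> 2 * d" by (simp add: dist_norm)
      qed simp
      finally have 1: "cmod (poly (q k) w - poly (q k) b) \<le> exp (real (n k) * (g z - e)) * (2 * d)" .
      have "cmod (poly (q k) b) \<le> exp (real (n k) * (g b + \<eta>))" using elim(1) db(1) by simp
      also have "\<dots> \<le> exp (real (n k) * (g a - \<eta>) - real (n k) * (2 * \<eta>))"
        using mult_left_mono[OF \<eta>(3), of "real (n k)"] by (simp add: algebra_simps)
      also have "\<dots> = X * exp (- (real (n k) * (2 * \<eta>)))" by (simp add: X_def exp_diff exp_minus divide_inverse)
      also have "\<dots> \<le> X * (1 / 2)"
      proof (intro mult_left_mono)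
        have "ln 2 \<le> real (n k) * (2 * \<eta>)" using elim(3) \<eta>(1) by (simp add: field_simps)
        then have "2 \<le> exp (real (n k) * (2 * \<eta>))" by (metis exp_le_cancel_iff exp_ln zero_less_numeral)
        then show "exp (- (real (n k) * (2 * \<eta>))) \<le> 1 / 2" by (simp add: exp_minus field_simps)
      qed (simp add: X_def)
      finally have "X / 2 \<le> cmod (poly (q k) w - poly (q k) b)"
        using w(2) norm_triangle_ineq2[of "poly (q k) w" "poly (q k) b"] by (simp add: X_def)
      with 1 have "X \<le> exp (real (n k) * (g z - e)) * (4 * d)" by simp
      moreover have "exp (real (n k) * (g z - e / 2)) \<le> X"
      proof -
        have "g z - e / 2 \<le> g a - \<eta>" using d(4)[OF ab(1)] \<eta>(2) by linarith
        then show ?thesis unfolding X_def by (simp add: mult_left_mono)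
      qed
      moreover have "exp (real (n k) * (g z - e / 2)) = exp (real (n k) * (g z - e)) * exp (real (n k) * (e / 2))"
        by (simp add: algebra_simps flip: exp_add)
      ultimately have "exp (real (n k) * (g z - e)) * exp (real (n k) * (e / 2)) \<le> exp (real (n k) * (g z - e)) * (4 * d)" by linarith
      then have "exp (real (n k) * (e / 2)) \<le> 4 * d" by (simp only: mult_le_cancel_left_pos[OF exp_gt_zero])
      moreover have "ln (4 * d) + 1 \<le> real (n k) * (e / 2)" using elim(4) e by (simp add: field_simps)
      then have "exp (ln (4 * d) + 1) \<le> exp (real (n k) * (e / 2))" by simp
      then have "4 * d * exp 1 \<le> exp (real (n k) * (e / 2))" using d(1) by (simp add: exp_add)
      moreover have "4 * d * 1 < 4 * d * exp 1" using d(1) by (intro mult_strict_left_mono) auto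
      ultimately show False by linarith
    qed
  qed
qed

subsection \<open>Escape of mass from the exterior\<close>

text \<open>Within distance \<open>r / 2\<close> of \<open>z\<close> the kernel exceeds its
  truncation at \<open>r\<close> by at least \<open>ln 2\<close>, so the gap between the two
  potentials measures the mass of that disc.\<close>

lemma lpot_ge_mass:
  assumes \<mu>: "borel_prob_on (cball 0 \<rho>) \<mu>" and z: "cmod z \<le> \<rho>" and D: "2 * \<rho> \<le> D" and r: "0 < r" "r \<le> D"
  shows "ennreal (ln D - tpot r \<mu> z) + ennreal (ln 2 * measure \<mu> (ball z (r / 2))) \<le> lpot D \<mu> z"
proof -
  interpret prob_space \<mu> using \<mu> by (rule borel_prob_onD)
  have [measurable_cong]: "sets \<mu> = sets borel" using borel_prob_onD[OF \<mu>] by blast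
  have sb: "ball z (r / 2) \<in> sets \<mu>" by measurable
  have D0: "0 < D" using r by simp
  have pw: "ennreal (ln (D / max r (cmod (z - w)))) + ennreal (ln 2) * indicator (ball z (r / 2)) w \<le> lker D z w" for w
  proof (cases "w \<in> ball z (r / 2)")
    case True
    then have w: "cmod (z - w) < r / 2" by (simp add: dist_norm)
    show ?thesis
    proof (cases "z = w")
      case False
      then have zw: "0 < cmod (z - w)" by simp
      have "ln (D / r) + ln 2 = ln (2 * D / r)" using D0 r by (simp add: ln_mult_pos ln_div)
      also have "\<dots> \<le> ln (D / cmod (z - w))"
        using w zw D0 r by (intro ln_mono) (auto simp: field_simps)
      finally have "ennreal (ln (D / r) + ln 2) \<le> ennreal (ln (D / cmod (z - w)))" by (rule ennreal_leI)
      moreover have "0 \<le> ln (D / r)" using D0 r by simp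
      moreover have "max r (cmod (z - w)) = r" using w r by simp
      ultimately show ?thesis using True False by (simp add: lker_def)
    qed (simp add: lker_def)
  next
    case False
    then show ?thesis using truncated_le_lker[OF r(1) D0] by simp
  qed
  have "(\<integral>\<^sup>+w. ennreal (ln (D / max r (cmod (z - w)))) + ennreal (ln 2) * indicator (ball z (r / 2)) w \<partial>\<mu>) =
     ennreal (ln D - tpot r \<mu> z) + ennreal (ln 2) * emeasure \<mu> (ball z (r / 2))"
    unfolding nn_integral_truncated[OF \<mu> z D r, symmetric] nn_integral_cmult_indicator[OF sb, symmetric]
  proof (rule nn_integral_add)
    show "(\<lambda>w. ennreal (ln (D / max r (cmod (z - w))))) \<in> borel_measurable \<mu>" by measurable
    show "(\<lambda>w. ennreal (ln 2) * indicator (ball z (r / 2)) w) \<in> borel_measurable \<mu>"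
      by (intro borel_measurable_times_ennreal borel_measurable_indicator sb borel_measurable_const)
  qed
  also have "ennreal (ln 2) * emeasure \<mu> (ball z (r / 2)) = ennreal (ln 2 * measure \<mu> (ball z (r / 2)))"
    by (simp add: emeasure_eq_measure ennreal_mult)
  finally have eq: "(\<integral>\<^sup>+w. ennreal (ln (D / max r (cmod (z - w)))) + ennreal (ln 2) * indicator (ball z (r / 2)) w \<partial>\<mu>) =
     ennreal (ln D - tpot r \<mu> z) + ennreal (ln 2 * measure \<mu> (ball z (r / 2)))" .
  show ?thesis unfolding eq[symmetric] lpot_def by (rule nn_integral_mono) (rule pw)
qed

lemma circle_mean_upot:
  assumes \<mu>: "borel_prob_on K \<mu>" and K: "compact K" and r: "0 < r" "r < s" and disj: "ball z s \<inter> K = {}"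
  shows "integrable (circle_measure z r) (upot \<mu>)" "(\<integral>w. upot \<mu> w \<partial>circle_measure z r) = upot \<mu> z"
proof -
  have "0 < s" using r by simp
  then obtain F where F: "F holomorphic_on ball z s" "\<And>w. w \<in> ball z s \<Longrightarrow> upot \<mu> w = Re (F w)"
    using upot_locally_Re[OF \<mu> K _ disj] by blast
  define f where "f w = indicator (cball z r) w *\<^sub>R F w" for w
  have sub: "cball z r \<subseteq> ball z s" using r by auto
  have fF: "f w = F w" if "w \<in> cball z r" for w using that by (simp add: f_def)
  have hF: "F holomorphic_on cball z r" using F(1) sub by (rule holomorphic_on_subset)
  have hf: "f holomorphic_on cball z r" by (rule holomorphic_transform[OF hF]) (simp add: fF)
  have m: "f \<in> borel_measurable borel" unfolding f_def
    by (rule borel_measurable_continuous_on_indicator[OF _ holomorphic_on_imp_continuous_on[OF hF]]) simp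
  have cm: "borel_prob_on (sphere z r) (circle_measure z r)" using borel_prob_on_circle_measure r by simp
  have [measurable_cong]: "sets (circle_measure z r) = sets borel" using borel_prob_onD[OF cm] by blast
  have sf: "sigma_finite_measure \<mu>" using borel_prob_onD(3)[OF \<mu>] by (simp add: prob_space_imp_sigma_finite)
  have [measurable_cong]: "sets \<mu> = sets borel" using borel_prob_onD[OF \<mu>] by blast
  have um[measurable]: "upot \<mu> \<in> borel_measurable borel" unfolding upot_def
    by (rule sigma_finite_measure.borel_measurable_lebesgue_integral[OF sf]) measurable
  have int: "integrable (circle_measure z r) f"
    by (rule integrable_continuous_on_compact[OF cm])
       (use m holomorphic_on_imp_continuous_on[OF hf] in \<open>auto intro: continuous_on_subset\<close>)
  have AE: "AE w in circle_measure z r. upot \<mu> w = Re (f w)"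
    using borel_prob_on_AE[OF cm borel_closed[OF closed_sphere]]
  proof eventually_elim
    case (elim w)
    then have w: "w \<in> cball z r" by auto
    then show ?case using F(2)[of w] sub fF[OF w] by auto
  qed
  have fm: "(\<lambda>w. Re (f w)) \<in> borel_measurable (circle_measure z r)" using int by simp
  show "integrable (circle_measure z r) (upot \<mu>)"
    using int AE fm by (subst integrable_cong_AE[of _ _ "\<lambda>w. Re (f w)"]) auto
  have "(\<integral>w. upot \<mu> w \<partial>circle_measure z r) = (\<integral>w. Re (f w) \<partial>circle_measure z r)"
    by (rule integral_cong_AE) (use AE fm in auto)
  also have "\<dots> = Re (\<integral>w. f w \<partial>circle_measure z r)" using int by simp
  also have "\<dots> = upot \<mu> z" using circle_mean_holomorphic[OF hf r(1) m] fF[of z] F(2)[of z] r by simp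
  finally show "(\<integral>w. upot \<mu> w \<partial>circle_measure z r) = upot \<mu> z" .
qed

lemma continuous_on_upot:
  assumes \<mu>: "borel_prob_on K \<mu>" and K: "compact K"
  shows "continuous_on (- K) (upot \<mu>)"
proof -
  have op: "open (- K)" using K compact_imp_closed by blast
  have "isCont (upot \<mu>) z" if z: "z \<in> - K" for z
  proof -
    obtain r where r: "0 < r" "ball z r \<subseteq> - K" using op z openE by blast
    then obtain F where F: "F holomorphic_on ball z r" "\<And>w. w \<in> ball z r \<Longrightarrow> upot \<mu> w = Re (F w)"
      using upot_locally_Re[OF \<mu> K r(1)] by blast
    have "continuous_on (ball z r) (\<lambda>w. Re (F w))"
      by (intro continuous_intros holomorphic_on_imp_continuous_on F)
    then have "continuous_on (ball z r) (upot \<mu>)"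
      by (rule continuous_on_eq) (use F in auto)
    then show ?thesis using r by (simp add: continuous_on_eq_continuous_at)
  qed
  then show ?thesis using op by (simp add: continuous_on_eq_continuous_at)
qed

text \<open>At a point where \<open>|p k|\<close> is not too small, the mass of a small disc is bounded by the difference of
  a circle mean of the potential and its value at the centre. Both are close to the value of the
  harmonic function \<open>upot \<omega>\<close> at the centre.\<close>

lemma exterior_mass_tendsto_0:
  assumes K: "compact K" and \<omega>: "borel_prob_on K \<omega>"
    and gr: "growth (- K) p n (\<lambda>z. upot \<omega> z - I)" and n: "filterlim n at_top sequentially"
    and n2: "\<forall>\<^sub>F k in sequentially. 0 < degree (p k) \<and> n k \<le> 2 * degree (p k)"
    and D: "0 < \<rho>" "2 * \<rho> \<le> D" and c: "0 < c"
    and \<kappa>: "\<And>k. borel_prob_on (cball 0 \<rho>) (\<kappa> k)"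
    and up: "\<And>k z. cmod z < \<rho> \<Longrightarrow> ennreal (ln D - lem_pot (p k) c z) \<le> lpot D (\<kappa> k) z"
    and low: "\<And>k z. cmod z \<le> \<rho> \<Longrightarrow> c < cmod (poly (p k) z) \<Longrightarrow> lpot D (\<kappa> k) z \<le> ennreal (ln D - lem_pot (p k) c z)"
    and z0: "z0 \<notin> K" "0 < upot \<omega> z0 - I" "cmod z0 < \<rho>"
  shows "\<exists>\<delta>>0. (\<lambda>k. measure (\<kappa> k) (ball z0 \<delta>)) \<longlonglongrightarrow> 0"
proof -
  define g where "g z = upot \<omega> z - I" for z
  have op: "open (- K)" using K compact_imp_closed by blast
  have gc: "continuous_on (- K) g" unfolding g_def by (intro continuous_intros continuous_on_upot[OF \<omega> K])
  have gC: "isCont g z" if "z \<notin> K" for z using gc op that by (simp add: continuous_on_eq_continuous_at)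
  have big: "\<forall>\<^sub>F k in sequentially. x \<le> real (n k)" for x :: real
    using filterlim_compose[OF filterlim_real_sequentially n] by (simp add: filterlim_at_top)
  obtain s1 where s1: "0 < s1" "ball z0 s1 \<subseteq> - K" using op z0(1) by (meson ComplI openE)
  have g0: "0 < g z0" using z0 by (simp add: g_def)
  obtain s2 where s2: "0 < s2" "\<And>w. dist w z0 < s2 \<Longrightarrow> dist (g w) (g z0) < g z0"
    using gC[OF z0(1)] g0 unfolding continuous_at_eps_delta by blast
  \<comment> \<open>A third of the available room: the disc of radius \<open>2 * r\<close> about
    \<open>z0\<close> avoids \<open>K\<close> and has \<open>g \<ge> 0\<close>, and it contains the
    circles of radius \<open>r\<close> about all points \<open>z1\<close> within
    \<open>r / 4\<close>, which also keep a margin to \<open>K\<close>.\<close>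
  define r where "r = Min {s1, s2, \<rho> - cmod z0} / 3"
  have r: "0 < r" "3 * r \<le> s1" "3 * r \<le> s2" "cmod z0 + 3 * r \<le> \<rho>" using s1 s2 z0(3) by (auto simp: r_def)
  have rD: "r \<le> D" using r D norm_ge_zero[of z0] by linarith
  have off: "z \<notin> K" "0 \<le> g z" if "z \<in> cball z0 (2 * r)" for z
  proof -
    have "dist z0 z < 3 * r" using that r(1) by simp
    then have "z \<in> ball z0 s1" using r by simp
    then show "z \<notin> K" using s1 by blast
    have "dist (g z) (g z0) < g z0" using \<open>dist z0 z < 3 * r\<close> r by (intro s2) (simp add: dist_commute)
    then show "0 \<le> g z" by (simp add: dist_real_def abs_less_iff)
  qed
  have bound: "\<forall>\<^sub>F k in sequentially. ln 2 * measure (\<kappa> k) (ball z0 (r / 4)) \<le> 6 * e"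
    if e: "0 < e" "e < g z0" for e
  proof -
    \<comment> \<open>The growth bound is stated with the value of \<open>g\<close> at the centre.
      Continuity replaces it by \<open>g w\<close>, and a finite subcover then yields one bound on
      the whole closed disc.\<close>
    have "\<exists>d>0. \<forall>\<^sub>F k in sequentially. \<forall>w\<in>ball z d. cmod (poly (p k) w) \<le> exp (real (n k) * (g w + e))"
      if z: "z \<in> cball z0 (2 * r)" for z
    proof -
      have "z \<in> - K" using off[OF z] by simp
      then obtain d1 where d1: "0 < d1" "\<forall>\<^sub>F k in sequentially. \<forall>w\<in>ball z d1. cmod (poly (p k) w) \<le> exp (real (n k) * (g z + e / 2))"
        using growth_upperD[OF gr, of z "e / 2"] e unfolding g_def by auto
      have "0 < e / 2" using e by simp
      then obtain d2 where d2: "0 < d2" "\<And>w. dist w z < d2 \<Longrightarrow> dist (g w) (g z) < e / 2"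
        using gC[OF off(1)[OF z]] unfolding continuous_at_eps_delta by blast
      have "\<forall>\<^sub>F k in sequentially. \<forall>w\<in>ball z (min d1 d2). cmod (poly (p k) w) \<le> exp (real (n k) * (g w + e))"
        using d1(2)
      proof eventually_elim
        case (elim k)
        show ?case
        proof
          fix w assume w: "w \<in> ball z (min d1 d2)"
          then have "dist (g w) (g z) < e / 2" by (intro d2) (simp add: dist_commute)
          then have "g z + e / 2 \<le> g w + e" unfolding dist_real_def by linarith
          then have "exp (real (n k) * (g z + e / 2)) \<le> exp (real (n k) * (g w + e))" by (simp add: mult_left_mono)
          moreover have "cmod (poly (p k) w) \<le> exp (real (n k) * (g z + e / 2))" using elim w by auto
          ultimately show "cmod (poly (p k) w) \<le> exp (real (n k) * (g w + e))" by linarith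
        qed
      qed
      then show ?thesis using d1(1) d2(1) by (intro exI[of _ "min d1 d2"]) auto
    qed
    then have "\<forall>z\<in>cball z0 (2 * r). \<exists>d. 0 < d \<and>
        (\<forall>\<^sub>F k in sequentially. \<forall>w\<in>ball z d. cmod (poly (p k) w) \<le> exp (real (n k) * (g w + e)))"
      by blast
    from bchoice[OF this] obtain dd where dd: "\<And>z. z \<in> cball z0 (2 * r) \<Longrightarrow> 0 < dd z"
      "\<And>z. z \<in> cball z0 (2 * r) \<Longrightarrow> \<forall>\<^sub>F k in sequentially. \<forall>w\<in>ball z (dd z). cmod (poly (p k) w) \<le> exp (real (n k) * (g w + e))"
      by blast
    have "cball z0 (2 * r) \<subseteq> (\<Union>z\<in>cball z0 (2 * r). ball z (dd z))" using dd(1) by force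
    then obtain Z where Z: "Z \<subseteq> cball z0 (2 * r)" "finite Z" "cball z0 (2 * r) \<subseteq> (\<Union>z\<in>Z. ball z (dd z))"
      using compactE_image[OF compact_cball, of "cball z0 (2 * r)" "\<lambda>z. ball z (dd z)" z0 "2 * r"] by auto
    have "\<forall>\<^sub>F k in sequentially. \<forall>z\<in>Z. \<forall>w\<in>ball z (dd z). cmod (poly (p k) w) \<le> exp (real (n k) * (g w + e))"
      using Z dd(2) by (subst eventually_ball_finite_distrib) auto
    then have unif: "\<forall>\<^sub>F k in sequentially. \<forall>w\<in>cball z0 (2 * r). cmod (poly (p k) w) \<le> exp (real (n k) * (g w + e))"
      by eventually_elim (use Z(3) in blast)
    obtain d3 where d3: "0 < d3" "\<And>w. dist w z0 < d3 \<Longrightarrow> dist (g w) (g z0) < e"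
      using gC[OF z0(1)] e unfolding continuous_at_eps_delta by blast
    define d where "d = min d3 (r / 4)"
    have d: "0 < d" "d \<le> d3" "d \<le> r / 4" using d3 r by (auto simp: d_def)
    have lo: "\<forall>\<^sub>F k in sequentially. \<exists>w\<in>ball z0 d. exp (real (n k) * (g z0 - e)) \<le> cmod (poly (p k) w)"
      using growth_lowerD[OF gr _ e(1) d(1), of z0] z0(1) unfolding g_def by simp
    show ?thesis
      using unif lo n2 big[of "ln c / e"] big[of "(\<bar>ln c\<bar> + 1) / (g z0 - e)"]
    proof eventually_elim
      case (elim k)
      \<comment> \<open>\<open>p k\<close> may vanish at \<open>z0\<close> itself, so the comparison
        is made at a nearby point where it is large.\<close>
      obtain z1 where z1: "z1 \<in> ball z0 d" "exp (real (n k) * (g z0 - e)) \<le> cmod (poly (p k) z1)" using elim(2) by blast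
      define N where "N = real (degree (p k))"
      define a where "a = ln (cmod (lead_coeff (p k)))"
      have N: "0 < N" "real (n k) \<le> 2 * N" using elim(3) by (auto simp: N_def)
      have z1d: "dist z0 z1 < r / 4" using z1 d by simp
      have z1n: "cmod z1 + r < \<rho>" using z1d r norm_triangle_ineq[of z0 "z1 - z0"] by (simp add: dist_norm norm_minus_commute)
      have lc: "ln c \<le> real (n k) * e" using elim(4) e by (simp add: field_simps)
      \<comment> \<open>A majorant of \<open>lem_pot\<close> on the circle that is affine in the
        harmonic function \<open>upot \<omega>\<close>, so its circle mean is its value at the
        centre \<open>z1\<close>.\<close>
      define G where "G w = (real (n k) * (g w + e) - a) / N" for w
      have cp: "borel_prob_on (sphere z1 r) (circle_measure z1 r)" using borel_prob_on_circle_measure r by simp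
      interpret cm: prob_space "circle_measure z1 r" using borel_prob_onD(3)[OF cp] .
      have "ball z1 (2 * r) \<inter> K = {}"
      proof -
        have "dist z0 w < 3 * r" if "w \<in> ball z1 (2 * r)" for w using that z1d dist_triangle[of z0 w z1] r by simp
        then show ?thesis using s1 r by force
      qed
      note mean = circle_mean_upot[OF \<omega> K r(1) _ this]
      have Gi: "integrable (circle_measure z1 r) G" unfolding G_def g_def using mean(1) r by simp
      have Gm: "(\<integral>w. G w \<partial>circle_measure z1 r) = G z1"
        unfolding G_def g_def using mean r by (simp add: cm.prob_space)
      have "tpot r (\<kappa> k) z1 \<le> (\<integral>w. G w \<partial>circle_measure z1 r)"
      proof (rule tpot_le_circle_mean[OF D \<kappa> r(1) _ Gi])
        show "cmod z1 + r \<le> \<rho>" using z1n by simp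
        fix w assume w: "w \<in> sphere z1 r"
        then have wz: "w \<in> cball z0 (2 * r)" using z1d dist_triangle[of z0 w z1] r by simp
        have wr: "cmod w < \<rho>" using w z1n norm_triangle_ineq[of z1 "w - z1"] by (simp add: dist_norm norm_minus_commute)
        have "ln (max c (cmod (poly (p k) w))) \<le> real (n k) * (g w + e)"
        proof (cases "c \<le> cmod (poly (p k) w)")
          case True
          have "0 < cmod (poly (p k) w)" using True c by linarith
          then have "ln (cmod (poly (p k) w)) \<le> ln (exp (real (n k) * (g w + e)))"
            using elim(1) wz by (intro ln_mono) auto
          then show ?thesis using True by (simp add: max_def)
        next
          case False
          have "real (n k) * e \<le> real (n k) * (g w + e)" using off(2)[OF wz] by (intro mult_left_mono) auto
          then show ?thesis using False lc by (simp add: max_def)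
        qed
        then have "lem_pot (p k) c w \<le> G w"
          unfolding lem_pot_def G_def a_def N_def by (intro divide_right_mono) auto
        then have "ennreal (ln D - G w) \<le> ennreal (ln D - lem_pot (p k) c w)" by (intro ennreal_leI) simp
        also have "\<dots> \<le> lpot D (\<kappa> k) w" by (rule up[OF wr])
        finally show "ennreal (ln D - G w) \<le> lpot D (\<kappa> k) w" .
      qed
      then have T: "tpot r (\<kappa> k) z1 \<le> G z1" using Gm by simp
      have gz1: "\<bar>g z1 - g z0\<bar> < e" using d3(2)[of z1] z1 d by (simp add: dist_real_def dist_commute)
      have "ln c < real (n k) * (g z0 - e)"
      proof -
        have "\<bar>ln c\<bar> + 1 \<le> real (n k) * (g z0 - e)" using elim(5) e by (simp add: field_simps)
        then show ?thesis by linarith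
      qed
      then have "exp (ln c) < exp (real (n k) * (g z0 - e))" by simp
      then have cp1: "c < cmod (poly (p k) z1)" using z1(2) c by simp
      have "real (n k) * (g z0 - e) \<le> ln (cmod (poly (p k) z1))"
        using z1(2) cp1 c by (metis exp_gt_zero ln_exp ln_mono order_less_trans)
      moreover have "real (n k) * (g z1 - 2 * e) \<le> real (n k) * (g z0 - e)" using gz1 by (intro mult_left_mono) auto
      ultimately have "real (n k) * (g z1 - 2 * e) \<le> ln (max c (cmod (poly (p k) z1)))" using cp1 by (simp add: max_def)
      then have Vl: "(real (n k) * (g z1 - 2 * e) - a) / N \<le> lem_pot (p k) c z1"
        unfolding lem_pot_def a_def N_def by (intro divide_right_mono) auto
      have "ennreal (ln D - tpot r (\<kappa> k) z1) + ennreal (ln 2 * measure (\<kappa> k) (ball z1 (r / 2))) \<le> lpot D (\<kappa> k) z1"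
        by (rule lpot_ge_mass[OF \<kappa> _ D(2) r(1) rD]) (use z1n r in simp)
      also have "\<dots> \<le> ennreal (ln D - lem_pot (p k) c z1)" by (rule low[OF _ cp1]) (use z1n r in simp)
      finally have le: "ennreal (ln D - tpot r (\<kappa> k) z1) + ennreal (ln 2 * measure (\<kappa> k) (ball z1 (r / 2))) \<le> ennreal (ln D - lem_pot (p k) c z1)" .
      have Tn: "0 \<le> ln D - tpot r (\<kappa> k) z1" using tpot_le_ln[OF \<kappa> _ D(2) r(1) rD, of z1 k] z1n r by simp
      have mn: "0 \<le> ln 2 * measure (\<kappa> k) (ball z1 (r / 2))" by simp
      have "ennreal (ln D - tpot r (\<kappa> k) z1 + ln 2 * measure (\<kappa> k) (ball z1 (r / 2))) \<le> ennreal (ln D - lem_pot (p k) c z1)"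
        using le by (subst ennreal_plus[OF Tn mn])
      then have "ln 2 * measure (\<kappa> k) (ball z1 (r / 2)) \<le> max 0 (tpot r (\<kappa> k) z1 - lem_pot (p k) c z1)"
        unfolding ennreal_le_iff2 using Tn mn by auto
      also have "\<dots> \<le> 6 * e"
      proof -
        \<comment> \<open>The upper and lower bounds differ by \<open>3 * e\<close> in the exponent;
          the factor 2 arises because \<open>n k\<close> may be up to twice the degree of
          \<open>p k\<close>.\<close>
        have "tpot r (\<kappa> k) z1 - lem_pot (p k) c z1 \<le> G z1 - (real (n k) * (g z1 - 2 * e) - a) / N" using T Vl by linarith
        also have "\<dots> = real (n k) * (3 * e) / N" using N(1) by (simp add: G_def field_simps)
        also have "\<dots> \<le> (2 * N) * (3 * e) / N" using N e by (intro divide_right_mono mult_right_mono) auto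
        also have "\<dots> = 6 * e" using N by simp
        finally show ?thesis using e by simp
      qed
      finally have "ln 2 * measure (\<kappa> k) (ball z1 (r / 2)) \<le> 6 * e" .
      moreover have "measure (\<kappa> k) (ball z0 (r / 4)) \<le> measure (\<kappa> k) (ball z1 (r / 2))"
      proof -
        interpret kp: prob_space "\<kappa> k" using borel_prob_onD(3)[OF \<kappa>] .
        have "ball z0 (r / 4) \<subseteq> ball z1 (r / 2)"
        proof
          fix w assume "w \<in> ball z0 (r / 4)"
          then show "w \<in> ball z1 (r / 2)" using z1d dist_triangle[of z1 w z0] by (simp add: dist_commute)
        qed
        then show ?thesis by (rule kp.finite_measure_mono) (use borel_prob_onD(1)[OF \<kappa>] in simp)
      qed
      ultimately show "ln 2 * measure (\<kappa> k) (ball z0 (r / 4)) \<le> 6 * e"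
        by (meson ln_gt_zero less_imp_le mult_left_mono one_less_numeral_iff order_trans semiring_norm(76))
    qed
  qed
  have "(\<lambda>k. measure (\<kappa> k) (ball z0 (r / 4))) \<longlonglongrightarrow> 0"
  proof (rule tendstoI)
    fix e :: real assume e: "0 < e"
    define e' where "e' = min (e * ln 2 / 12) (g z0 / 2)"
    have e': "0 < e'" "e' < g z0" "12 * e' \<le> e * ln 2" using e g0 by (auto simp: e'_def min_def)
    show "\<forall>\<^sub>F k in sequentially. dist (measure (\<kappa> k) (ball z0 (r / 4))) 0 < e"
      using bound[OF e'(1,2)]
    proof eventually_elim
      case (elim k)
      then have "ln 2 * measure (\<kappa> k) (ball z0 (r / 4)) < ln 2 * e"
        using e' mult.commute[of "ln 2" e] by linarith
      then have "measure (\<kappa> k) (ball z0 (r / 4)) < e" by (subst (asm) mult_less_cancel_left_pos) auto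
      then show ?case by (simp add: dist_real_def)
    qed
  qed
  then show ?thesis using r by (intro exI[of _ "r / 4"]) auto
qed

text \<open>A tent function below the indicator of the ball is positive on the whole ball, and its
  integrals tend to 0.\<close>

lemma weak_lim_null_ball:
  assumes lim: "weak_lim M \<sigma>" and \<sigma>: "borel_prob_on (cball 0 \<rho>) \<sigma>" and M: "\<And>k. borel_prob_on (cball 0 \<rho>) (M k)"
    and m: "(\<lambda>k. measure (M k) (ball z d)) \<longlonglongrightarrow> 0" and d: "0 < d"
  shows "AE w in \<sigma>. w \<notin> ball z d"
proof -
  define f where "f w = max 0 (1 - dist w z / d)" for w
  have fc: "continuous_on UNIV f" unfolding f_def using d by (intro continuous_intros) auto
  have f01: "0 \<le> f w" "f w \<le> indicat_real (ball z d) w" for w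
    using d by (auto simp: f_def indicator_def dist_commute field_simps)
  have "(\<integral>w. f w \<partial>M k) \<le> measure (M k) (ball z d)" for k
  proof -
    interpret prob_space "M k" using borel_prob_onD(3)[OF M] .
    have [measurable_cong]: "sets (M k) = sets borel" using borel_prob_onD[OF M] by blast
    have "(\<integral>w. f w \<partial>M k) \<le> (\<integral>w. indicat_real (ball z d) w \<partial>M k)"
    proof (rule integral_mono)
      show "integrable (M k) f" by (rule integrable_continuous[OF M compact_cball fc])
      show "integrable (M k) (indicat_real (ball z d))"
        by (rule integrable_real_indicator) (auto simp: borel_prob_onD(1)[OF M] less_top[symmetric])
    qed (rule f01)
    then show ?thesis using borel_prob_onD(2)[OF M] by simp
  qed
  then have "(\<integral>w. f w \<partial>\<sigma>) \<le> 0" by (intro LIMSEQ_le[OF weak_limD[OF lim fc] m]) auto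
  moreover have "0 \<le> (\<integral>w. f w \<partial>\<sigma>)" by (intro Bochner_Integration.integral_nonneg f01)
  ultimately have "(\<integral>w. f w \<partial>\<sigma>) = 0" by (rule antisym)
  then have "AE w in \<sigma>. f w = 0"
    using integral_nonneg_eq_0_iff_AE[OF integrable_continuous[OF \<sigma> compact_cball fc]] f01 by auto
  then show ?thesis
  proof eventually_elim
    case (elim w)
    then show ?case using d by (auto simp: f_def max_def dist_commute field_simps split: if_splits)
  qed
qed

text \<open>The aim is that the mean of the potential of \<open>\<omega>\<close> under
  \<open>\<sigma>\<close> is at most \<open>I\<close>. Off \<open>K\<close> this holds pointwise by
  hypothesis. On \<open>K\<close> it holds after integration: \<open>\<sigma>\<close> conditioned on
  \<open>K\<close> has finite energy, so \<open>min_energy_variation\<close> applies to it. The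
  mutual energy is then at least both self-energies, which forces equality.\<close>

lemma equilibrium_limit_unique:
  assumes D: "2 * \<rho> \<le> D" "1 \<le> D" and K: "compact K" "K \<subseteq> cball 0 \<rho>"
    and \<omega>: "min_energy D K \<omega>" and I: "I = ln D - enn2real (lenergy D \<omega> \<omega>)"
    and \<sigma>: "borel_prob_on (cball 0 \<rho>) \<sigma>" and le: "lenergy D \<sigma> \<sigma> \<le> lenergy D \<omega> \<omega>"
    and AE: "AE z in \<sigma>. z \<notin> K \<longrightarrow> upot \<omega> z \<le> I"
  shows "\<sigma> = \<omega>"
proof -
  have Kb: "K \<in> sets borel" and Kc: "closed K" using K by (auto intro: borel_compact compact_imp_closed)
  have \<omega>K: "borel_prob_on K \<omega>" and fin: "lenergy D \<omega> \<omega> < \<infinity>" using \<omega> by (auto simp: min_energy_def)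
  have \<omega>b: "borel_prob_on (cball 0 \<rho>) \<omega>" by (rule borel_prob_on_mono[OF \<omega>K K(2) Kb]) simp
  obtain e where e: "lenergy D \<omega> \<omega> = ennreal e" "0 \<le> e" using fin by (cases "lenergy D \<omega> \<omega>") auto
  have Ie: "I = ln D - e" using I e by simp
  interpret \<sigma>: prob_space \<sigma> using \<sigma> by (rule borel_prob_onD)
  have [measurable_cong]: "sets \<sigma> = sets borel" using borel_prob_onD[OF \<sigma>] by blast
  have [measurable]: "K \<in> sets borel" by (rule Kb)
  have pm[measurable]: "lpot D \<omega> \<in> borel_measurable borel" "lpot D \<sigma> \<in> borel_measurable borel"
    using measurable_lpot[OF \<omega>K] measurable_lpot[OF \<sigma>] by auto
  have part1: "ennreal e * emeasure \<sigma> K \<le> (\<integral>\<^sup>+z. lpot D \<omega> z * indicator K z \<partial>\<sigma>)"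
  proof (cases "emeasure \<sigma> K = 0")
    case False
    define m where "m = emeasure \<sigma> K"
    have m0: "m \<noteq> 0" "m < \<infinity>" using False by (auto simp: m_def less_top[symmetric])
    \<comment> \<open>Conditioning divides by the mass \<open>m\<close> in each variable, so the
      energy of \<open>\<nu>\<close> is at most that of \<open>\<sigma>\<close> divided by
      \<open>m\<close> twice, hence finite.\<close>
    define \<nu> where "\<nu> = uniform_measure \<sigma> K"
    have sK: "K \<in> sets \<sigma>" by measurable
    have \<nu>p: "prob_space \<nu>" unfolding \<nu>_def by (rule prob_space_uniform_measure) (use m0 in \<open>auto simp: m_def\<close>)
    have \<nu>K: "borel_prob_on K \<nu>"
    proof -
      have "AE z in \<nu>. z \<in> K" unfolding \<nu>_def by (rule AE_uniform_measureI[OF sK]) simp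
      moreover have "sets \<nu> = sets borel" by (simp add: \<nu>_def borel_prob_onD(1)[OF \<sigma>])
      ultimately show ?thesis using \<nu>p by (simp add: borel_prob_on_iff_AE[OF Kb])
    qed
    have nu: "(\<integral>\<^sup>+z. f z \<partial>\<nu>) = (\<integral>\<^sup>+z. f z * indicator K z \<partial>\<sigma>) / m" if "f \<in> borel_measurable borel" for f
      unfolding \<nu>_def m_def by (rule nn_integral_uniform_measure) (use that sK in auto)
    have div: "x / m < \<infinity>" if "x < \<infinity>" for x
      using that m0 by (simp add: ennreal_divide_eq_top_iff less_top[symmetric])
    have "lpot D \<nu> z \<le> lpot D \<sigma> z / m" for z
      unfolding lpot_def by (subst nu) (auto intro!: divide_right_mono_ennreal nn_integral_mono simp: indicator_def)
    then have "lenergy D \<nu> \<nu> \<le> (\<integral>\<^sup>+z. lpot D \<sigma> z / m \<partial>\<nu>)" unfolding lenergy_def by (intro nn_integral_mono)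
    also have "\<dots> = (\<integral>\<^sup>+z. lpot D \<sigma> z / m * indicator K z \<partial>\<sigma>) / m" by (rule nu) measurable
    also have "\<dots> \<le> (\<integral>\<^sup>+z. lpot D \<sigma> z / m \<partial>\<sigma>) / m"
      by (intro divide_right_mono_ennreal nn_integral_mono) (auto simp: indicator_def)
    also have "\<dots> = lenergy D \<sigma> \<sigma> / m / m" unfolding lenergy_def by (simp add: nn_integral_divide)
    also have "\<dots> < \<infinity>" using le fin by (intro div) simp
    finally have "lenergy D \<omega> \<omega> \<le> lenergy D \<omega> \<nu>"
      by (rule min_energy_variation[OF D K(2) Kb \<omega> \<nu>K])
    also have "\<dots> = lenergy D \<nu> \<omega>" by (rule lenergy_commute[OF \<omega>K \<nu>K])
    also have "\<dots> = (\<integral>\<^sup>+z. lpot D \<omega> z * indicator K z \<partial>\<sigma>) / m" unfolding lenergy_def by (rule nu[OF pm(1)])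
    finally have "ennreal e * m \<le> (\<integral>\<^sup>+z. lpot D \<omega> z * indicator K z \<partial>\<sigma>) / m * m"
      unfolding e(1) by (intro mult_right_mono) auto
    then show ?thesis using m0 by (simp add: m_def ennreal_divide_times ennreal_times_divide mult_divide_eq_ennreal less_top[symmetric])
  qed simp
  have part2: "ennreal e * emeasure \<sigma> (- K) \<le> (\<integral>\<^sup>+z. lpot D \<omega> z * indicator (- K) z \<partial>\<sigma>)"
  proof -
    have "ennreal e * emeasure \<sigma> (- K) = (\<integral>\<^sup>+z. ennreal e * indicator (- K) z \<partial>\<sigma>)"
      by (rule nn_integral_cmult_indicator[symmetric]) measurable
    also have "\<dots> \<le> (\<integral>\<^sup>+z. lpot D \<omega> z * indicator (- K) z \<partial>\<sigma>)"
    proof (rule nn_integral_mono_AE)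
      show "AE z in \<sigma>. ennreal e * indicator (- K) z \<le> lpot D \<omega> z * indicator (- K) z"
        using AE borel_prob_on_AE[OF \<sigma> borel_closed[OF closed_cball]]
      proof eventually_elim
        case (elim z)
        show ?case
        proof (cases "z \<in> K")
          case False
          then obtain s where s: "0 < s" "\<And>w. w \<in> K \<Longrightarrow> s \<le> dist z w" using separate_point_closed[OF Kc] by blast
          define t where "t = min s D"
          have t: "0 < t" "t \<le> D" "\<And>w. w \<in> K \<Longrightarrow> t \<le> cmod (z - w)"
            using s D by (auto simp: t_def dist_norm min_le_iff_disj)
          have "lpot D \<omega> z = ennreal (ln D - tpot t \<omega> z)"
            by (rule lpot_off_support[OF D(1) \<omega>K K(2) Kc _ t(1,2)]) (use elim t in auto)
          moreover have "tpot t \<omega> z = upot \<omega> z" by (rule upot_eq_tpot[OF \<omega>K Kb, symmetric]) (rule t)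
          moreover have "e \<le> ln D - upot \<omega> z" using elim False Ie by simp
          ultimately show ?thesis using False by (simp add: ennreal_leI)
        qed simp
      qed
    qed
    finally show ?thesis .
  qed
  have "lenergy D \<omega> \<omega> = ennreal e * (emeasure \<sigma> K + emeasure \<sigma> (- K))"
  proof -
    have "emeasure \<sigma> K + emeasure \<sigma> (- K) = emeasure \<sigma> (K \<union> - K)" by (rule plus_emeasure) auto
    also have "K \<union> - K = space \<sigma>" using borel_prob_onD(2)[OF \<sigma>] by auto
    finally show ?thesis using e by (simp add: \<sigma>.emeasure_space_1)
  qed
  also have "\<dots> \<le> (\<integral>\<^sup>+z. lpot D \<omega> z * indicator K z \<partial>\<sigma>) + (\<integral>\<^sup>+z. lpot D \<omega> z * indicator (- K) z \<partial>\<sigma>)"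
    unfolding distrib_left by (intro add_mono part1 part2)
  also have "\<dots> = (\<integral>\<^sup>+z. lpot D \<omega> z * indicator K z + lpot D \<omega> z * indicator (- K) z \<partial>\<sigma>)"
    by (rule nn_integral_add[symmetric]) measurable
  also have "\<dots> = lenergy D \<sigma> \<omega>" unfolding lenergy_def by (rule nn_integral_cong) (auto simp: indicator_def)
  finally have ge: "lenergy D \<omega> \<omega> \<le> lenergy D \<sigma> \<omega>" .
  show ?thesis
    by (rule energy_dist_eq_0I[OF D \<sigma> \<omega>b]) (use le ge fin in auto)
qed

subsection \<open>Iterated derivatives\<close>

lemma poly_pderiv_eq_sum_roots:
  fixes p :: "complex poly"
  assumes "poly p z \<noteq> 0"
  shows "poly (pderiv p) z = poly p z * (\<Sum>x\<in>#proots p. 1 / (z - x))"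
proof -
  have *: "poly (pderiv (\<Prod>x\<in>#A. [:-x, 1:])) z = poly (\<Prod>x\<in>#A. [:-x, 1:]) z * (\<Sum>x\<in>#A. 1 / (z - x))"
    if "\<And>x. x \<in># A \<Longrightarrow> z \<noteq> x" for A :: "complex multiset"
    using that
  proof (induction A)
    case (add x A)
    have zx: "z - x \<noteq> 0" using add.prems by simp
    define P where "P = (\<Prod>x\<in>#A. [:-x, 1:])"
    define S where "S = (\<Sum>x\<in>#A. 1 / (z - x))"
    have IH: "poly (pderiv P) z = poly P z * S" using add.IH add.prems by (simp add: P_def S_def)
    have "poly (pderiv ([:-x, 1:] * P)) z = (z - x) * (poly P z * S) + poly P z"
      unfolding pderiv_mult poly_add poly_mult IH by (simp add: pderiv_pCons)
    also have "\<dots> = (z - x) * poly P z * (1 / (z - x) + S)" using zx by (simp add: field_simps)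
    finally show ?case by (simp add: P_def S_def algebra_simps)
  qed simp
  have p0: "p \<noteq> 0" using assms by auto
  have "z \<noteq> x" if "x \<in># proots p" for x using that assms p0 by auto
  then have "poly (pderiv (smult (lead_coeff p) (\<Prod>x\<in>#proots p. [:-x, 1:]))) z =
     poly (smult (lead_coeff p) (\<Prod>x\<in>#proots p. [:-x, 1:])) z * (\<Sum>x\<in>#proots p. 1 / (z - x))"
    using *[of "proots p"] by (simp add: pderiv_smult)
  then show ?thesis by (simp only: complex_poly_decompose_multiset)
qed

text \<open>Gauss-Lucas for a disc about 0: if every root \<open>x\<close> satisfies
  \<open>|x| < |z|\<close>, each \<open>z / (z - x)\<close> has positive real part, so the
  logarithmic derivative cannot vanish at \<open>z\<close>.\<close>

lemma zeros_pderiv_in_ball: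
  fixes p :: "complex poly"
  assumes zeros: "{z. poly p z = 0} \<subseteq> ball 0 R" and p: "0 < degree p"
  shows "{z. poly (pderiv p) z = 0} \<subseteq> ball 0 R"
proof (rule ccontr)
  have p0: "p \<noteq> 0" using p by auto
  assume "\<not> ?thesis"
  then obtain z where z: "poly (pderiv p) z = 0" "R \<le> cmod z" by (auto simp: subset_iff not_less)
  then have pz: "poly p z \<noteq> 0" using zeros by force
  have x: "cmod x < cmod z" if "x \<in># proots p" for x using that zeros z(2) p0 by force
  have "proots p \<noteq> {#}" using p size_proots_complex[of p] by auto
  then obtain x0 where "x0 \<in># proots p" by blast
  then have z0: "0 < cmod z" using x[of x0] by (meson le_less_trans norm_ge_zero)
  have term_pos: "0 < Re (z * (1 / (z - x)))" if "x \<in># proots p" for x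
  proof -
    have "z - x \<noteq> 0" using x[OF that] by auto
    have "Re (z * cnj (z - x)) = (cmod z)\<^sup>2 - Re (z * cnj x)"
      unfolding cmod_power2 by (simp add: power2_eq_square algebra_simps)
    moreover have "Re (z * cnj x) \<le> cmod z * cmod x" using complex_Re_le_cmod[of "z * cnj x"] by (simp add: norm_mult)
    moreover have "cmod z * cmod x < cmod z * cmod z" using x[OF that] z0 by (intro mult_strict_left_mono)
    ultimately have "0 < Re (z * cnj (z - x))" by (simp add: power2_eq_square)
    moreover have "Re (z * (1 / (z - x))) = Re (z * cnj (z - x)) / (cmod (z - x))\<^sup>2"
      by (simp only: times_divide_eq_right mult_1_right complex_div_cnj[of z "z - x"] Re_divide_of_real flip: of_real_power)
    ultimately show ?thesis using \<open>z - x \<noteq> 0\<close> by simp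
  qed
  have sum_pos: "A \<subseteq># proots p \<Longrightarrow> A \<noteq> {#} \<Longrightarrow> 0 < Re (z * (\<Sum>x\<in>#A. 1 / (z - x)))" for A
  proof (induction A)
    case (add x A)
    have xp: "x \<in># proots p" using add.prems by (meson mset_subset_eqD union_single_eq_member)
    show ?case
    proof (cases "A = {#}")
      case True
      then show ?thesis using term_pos[OF xp] by simp
    next
      case False
      then have "0 < Re (z * (\<Sum>x\<in>#A. 1 / (z - x)))" using add.IH add.prems(1) by (meson mset_subset_eq_insertD subset_mset.less_imp_le)
      then show ?thesis using term_pos[OF xp] by (simp add: distrib_left)
    qed
  qed simp
  have "0 < Re (z * (\<Sum>x\<in>#proots p. 1 / (z - x)))" using sum_pos \<open>proots p \<noteq> {#}\<close> by simp
  moreover have "(\<Sum>x\<in>#proots p. 1 / (z - x)) = 0" using poly_pderiv_eq_sum_roots[OF pz] z(1) pz by simp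
  ultimately show False by simp
qed

text \<open>Differentiation multiplies the leading coefficient by \<open>n\<close> and lowers the
  degree to \<open>n - 1\<close>; both \<open>ln n / (n - 1)\<close> and the factor
  \<open>n / (n - 1)\<close> are harmless in the limit.\<close>

lemma lead_coeff_growth_pderiv:
  fixes q :: "nat \<Rightarrow> complex poly"
  assumes deg: "filterlim (\<lambda>k. degree (q k)) at_top sequentially"
    and lim: "(\<lambda>k. ln (cmod (lead_coeff (q k))) / real (degree (q k))) \<longlonglongrightarrow> L"
  shows "filterlim (\<lambda>k. degree (pderiv (q k))) at_top sequentially"
    and "(\<lambda>k. ln (cmod (lead_coeff (pderiv (q k)))) / real (degree (pderiv (q k)))) \<longlonglongrightarrow> L"
proof -
  have "filterlim (\<lambda>n::nat. n - 1) at_top at_top"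
    by (simp add: filterlim_at_top eventually_at_top_linorder) (metis Suc_le_eq add_diff_cancel_right' diff_le_mono)
  then show "filterlim (\<lambda>k. degree (pderiv (q k))) at_top sequentially"
    unfolding degree_pderiv using deg by (rule filterlim_compose)
  have r: "filterlim (\<lambda>k. real (degree (q k))) at_top sequentially"
    using deg by (intro filterlim_compose[OF filterlim_real_sequentially])
  have "((\<lambda>x::real. ln x / (x - 1)) \<longlongrightarrow> 0) at_top" "((\<lambda>x::real. x / (x - 1)) \<longlongrightarrow> 1) at_top" by real_asymp+
  then have "(\<lambda>k. ln (real (degree (q k))) / (real (degree (q k)) - 1)) \<longlonglongrightarrow> 0"
    "(\<lambda>k. real (degree (q k)) / (real (degree (q k)) - 1)) \<longlonglongrightarrow> 1"
    using r by (auto intro: filterlim_compose)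
  then have "(\<lambda>k. ln (real (degree (q k))) / (real (degree (q k)) - 1) +
     (real (degree (q k)) / (real (degree (q k)) - 1)) * (ln (cmod (lead_coeff (q k))) / real (degree (q k)))) \<longlonglongrightarrow> 0 + 1 * L"
    by (intro tendsto_intros lim)
  moreover have "\<forall>\<^sub>F k in sequentially. ln (real (degree (q k))) / (real (degree (q k)) - 1) +
     (real (degree (q k)) / (real (degree (q k)) - 1)) * (ln (cmod (lead_coeff (q k))) / real (degree (q k))) =
     ln (cmod (lead_coeff (pderiv (q k)))) / real (degree (pderiv (q k)))"
  proof -
    have "\<forall>\<^sub>F k in sequentially. 2 \<le> degree (q k)" using deg by (simp add: filterlim_at_top)
    then show ?thesis
    proof eventually_elim
      case (elim k)
      define n where "n = real (degree (q k))"
      have n: "2 \<le> n" using elim by (simp add: n_def)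
      have a: "lead_coeff (q k) \<noteq> 0" using elim by auto
      have "lead_coeff (pderiv (q k)) = of_nat (degree (q k)) * lead_coeff (q k)"
        using elim by (cases "degree (q k)") (auto simp: degree_pderiv coeff_pderiv)
      then have "ln (cmod (lead_coeff (pderiv (q k)))) = ln n + ln (cmod (lead_coeff (q k)))"
        using a n by (simp add: norm_mult ln_mult_pos n_def)
      moreover have "real (degree (pderiv (q k))) = n - 1" using elim by (simp add: degree_pderiv n_def)
      moreover have "n / (n - 1) * (ln (cmod (lead_coeff (q k))) / n) = ln (cmod (lead_coeff (q k))) / (n - 1)" using n by simp
      ultimately show ?case unfolding n_def[symmetric] by (simp only: add_divide_distrib)
    qed
  qed
  ultimately show "(\<lambda>k. ln (cmod (lead_coeff (pderiv (q k)))) / real (degree (pderiv (q k)))) \<longlonglongrightarrow> L"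
    by (simp add: tendsto_cong)
qed

lemma degree_higher_pderiv: "degree ((pderiv ^^ m) (p :: complex poly)) = degree p - m"
  by (induction m) (auto simp: degree_pderiv)

lemma lead_coeff_growth_higher_pderiv:
  fixes q :: "nat \<Rightarrow> complex poly"
  assumes "filterlim (\<lambda>k. degree (q k)) at_top sequentially"
    and "(\<lambda>k. ln (cmod (lead_coeff (q k))) / real (degree (q k))) \<longlonglongrightarrow> L"
  shows "filterlim (\<lambda>k. degree ((pderiv ^^ m) (q k))) at_top sequentially \<and>
    (\<lambda>k. ln (cmod (lead_coeff ((pderiv ^^ m) (q k)))) / real (degree ((pderiv ^^ m) (q k)))) \<longlonglongrightarrow> L"
proof (induction m)
  case (Suc m)
  then show ?case
    using lead_coeff_growth_pderiv[of "\<lambda>k. (pderiv ^^ m) (q k)" L] by simp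
qed (use assms in simp)

lemma growth_higher_pderiv:
  assumes gr: "growth \<Omega> q n g" and \<Omega>: "open \<Omega>" and g: "continuous_on \<Omega> g"
    and nc: "\<And>z e. z \<in> \<Omega> \<Longrightarrow> 0 < e \<Longrightarrow> \<exists>w\<in>ball z e. w \<in> \<Omega> \<and> g w \<noteq> g z"
    and n: "filterlim n at_top sequentially"
  shows "growth \<Omega> (\<lambda>k. (pderiv ^^ m) (q k)) n g"
proof (induction m)
  case (Suc m)
  show ?case using growth_pderiv[OF Suc \<Omega> g nc n] by simp
qed (use gr in simp)

lemma zeros_higher_pderiv_in_ball:
  fixes p :: "complex poly"
  assumes "{z. poly p z = 0} \<subseteq> ball 0 R" "m \<le> degree p"
  shows "{z. poly ((pderiv ^^ m) p) z = 0} \<subseteq> ball 0 R"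
  using assms(2)
proof (induction m)
  case (Suc m)
  have "{z. poly (pderiv ((pderiv ^^ m) p)) z = 0} \<subseteq> ball 0 R"
    using Suc by (intro zeros_pderiv_in_ball) (auto simp: degree_higher_pderiv)
  then show ?case by simp
qed (use assms in simp)

text \<open>Beyond \<open>2 * R\<close> every factor \<open>|z - x|\<close> is at least
  \<open>|z| / 2\<close>, and eventually the leading coefficient is at least \<open>A ^ n\<close>
  with \<open>A = exp (- I - 1)\<close>. So \<open>|p z|\<close> is at least the \<open>n\<close>-th
  power of \<open>A * |z| / 2\<close>, a base that is at least 2 once \<open>|z|\<close> is at least
  \<open>4 / A = 4 * exp (I + 1)\<close>.\<close>

lemma eventually_escape_radius:
  fixes p :: "nat \<Rightarrow> complex poly"
  assumes deg: "filterlim (\<lambda>k. degree (p k)) at_top sequentially"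
    and lim: "(\<lambda>k. ln (cmod (lead_coeff (p k))) / real (degree (p k))) \<longlonglongrightarrow> - I"
    and zeros: "\<forall>\<^sub>F k in sequentially. {z. poly (p k) z = 0} \<subseteq> ball 0 R" and R: "0 < R"
  shows "\<forall>\<^sub>F k in sequentially. escape_radius (p k) (2 * R + 4 * exp (I + 1))"
proof -
  define A where "A = exp (- I - 1)"
  have A: "0 < A" by (simp add: A_def)
  \<comment> \<open>One factor of the power is kept as \<open>A * |z| / 2\<close>; the remaining
    ones supply \<open>2 ^ N\<close>, which exceeds \<open>4 / A\<close> and so produces the
    required \<open>2 * |z|\<close>.\<close>
  obtain N where N: "4 / A < 2 ^ N" using real_arch_pow[of 2 "4 / A"] by auto
  have "\<forall>\<^sub>F k in sequentially. Suc N \<le> degree (p k)" using deg unfolding filterlim_at_top by blast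
  moreover have "\<forall>\<^sub>F k in sequentially. - I - 1 < ln (cmod (lead_coeff (p k))) / real (degree (p k))"
    using lim by (rule order_tendstoD(1)) simp
  ultimately show ?thesis using zeros
  proof eventually_elim
    case (elim k)
    define n where "n = degree (p k)"
    have n: "Suc N \<le> n" using elim(1) by (simp add: n_def)
    have lc0: "lead_coeff (p k) \<noteq> 0" using elim(1) by auto
    have "real n * (- I - 1) \<le> ln (cmod (lead_coeff (p k)))"
      using elim(2) n by (simp add: n_def field_simps)
    then have "exp (real n * (- I - 1)) \<le> cmod (lead_coeff (p k))" using lc0 by (metis exp_le_cancel_iff exp_ln zero_less_norm_iff)
    then have lcA: "A ^ n \<le> cmod (lead_coeff (p k))" by (simp add: A_def exp_of_nat_mult)
    have "2 * cmod z \<le> cmod (poly (p k) z)" if z: "2 * R + 4 * exp (I + 1) \<le> cmod z" for z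
    proof -
      have eA: "exp (I + 1) = 1 / A" by (simp add: A_def exp_diff exp_minus exp_add field_simps)
      have "4 * exp (I + 1) \<le> cmod z" using z R by linarith
      then have z4: "2 \<le> A * cmod z / 2" using A unfolding eA by (simp add: field_simps)
      have z2: "2 * R \<le> cmod z" using z exp_gt_zero[of "I + 1"] by linarith
      have "(cmod z / 2) ^ size B \<le> (\<Prod>x\<in>#B. cmod (z - x))" if "\<And>x. x \<in># B \<Longrightarrow> cmod x < R" for B
        using that
      proof (induction B)
        case (add x B)
        have "cmod x < R" using add.prems by simp
        then have "cmod z / 2 \<le> cmod (z - x)" using norm_triangle_ineq2[of z x] z2 by simp
        moreover have "(cmod z / 2) ^ size B \<le> (\<Prod>x\<in>#B. cmod (z - x))" using add by simp
        ultimately have "cmod z / 2 * (cmod z / 2) ^ size B \<le> cmod (z - x) * (\<Prod>x\<in>#B. cmod (z - x))"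
          by (intro mult_mono) auto
        then show ?case by simp
      qed simp
      moreover have "cmod x < R" if "x \<in># proots (p k)" for x using that elim(3) lc0 by (force dest: subsetD)
      ultimately have prod: "(cmod z / 2) ^ n \<le> (\<Prod>x\<in>#proots (p k). cmod (z - x))"
        unfolding n_def size_proots_complex[symmetric] by blast
      define x where "x = A * cmod z / 2"
      obtain j where j: "n = Suc j" "N \<le> j" using n by (cases n) auto
      have "2 * cmod z \<le> x * 2 ^ j"
      proof -
        have "4 / A \<le> 2 ^ j" using N power_increasing[OF j(2), of "2::real"] by linarith
        then have "x * (4 / A) \<le> x * 2 ^ j" using z4 by (intro mult_left_mono) (auto simp: x_def)
        moreover have "x * (4 / A) = 2 * cmod z" using A by (simp add: x_def)
        ultimately show ?thesis by simp
      qed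
      also have "\<dots> \<le> x * x ^ j" using z4 by (intro mult_left_mono power_mono) (auto simp: x_def)
      also have "\<dots> = A ^ n * (cmod z / 2) ^ n" by (simp add: x_def j power_divide power_mult_distrib)
      also have "\<dots> \<le> cmod (lead_coeff (p k)) * (\<Prod>x\<in>#proots (p k). cmod (z - x))"
        using lcA prod A by (intro mult_mono) auto
      also have "\<dots> = cmod (poly (p k) z)" by (rule norm_poly_eq_prod_mset[symmetric])
      finally show ?thesis .
    qed
    then show ?case using R by (auto simp: escape_radius_def intro: add_pos_pos)
  qed
qed

subsection \<open>Convergence of the equilibrium measures\<close>

lemma growth_subseq:
  assumes "growth \<Omega> q n g" "strict_mono s"
  shows "growth \<Omega> (\<lambda>k. q (s k)) (\<lambda>k. n (s k)) g"
  unfolding growth_def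
proof (intro ballI allI impI conjI)
  fix z e assume z: "z \<in> \<Omega>" and e: "(0::real) < e"
  obtain d where "0 < d" "\<forall>\<^sub>F k in sequentially. \<forall>w\<in>ball z d. cmod (poly (q k) w) \<le> exp (real (n k) * (g z + e))"
    using growth_upperD[OF assms(1) z e] by blast
  then show "\<exists>d>0. \<forall>\<^sub>F k in sequentially. \<forall>w\<in>ball z d. cmod (poly (q (s k)) w) \<le> exp (real (n (s k)) * (g z + e))"
    using eventually_subseq[OF assms(2)] by blast
  fix d :: real assume "0 < d"
  from growth_lowerD[OF assms(1) z e this]
  show "\<forall>\<^sub>F k in sequentially. \<exists>w\<in>ball z d. exp (real (n (s k)) * (g z - e)) \<le> cmod (poly (q (s k)) w)"
    by (rule eventually_subseq[OF assms(2)])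
qed

text \<open>With \<open>D\<close> twice the diameter of the disc the kernel is at least
  \<open>ln 2\<close> there. This provides the strict inequality between equilibrium energy and
  \<open>ln D\<close> that eventual bounds require.\<close>

lemma lenergy_ge_ln2:
  assumes "borel_prob_on (cball 0 \<rho>) \<mu>" "4 * \<rho> \<le> D" "0 < \<rho>"
  shows "ennreal (ln 2) \<le> lenergy D \<mu> \<mu>"
proof -
  interpret prob_space \<mu> using assms(1) by (rule borel_prob_onD)
  note AE = borel_prob_on_AE[OF assms(1) borel_closed[OF closed_cball]]
  have "ennreal (ln 2) \<le> lker D z w" if "z \<in> cball 0 \<rho>" "w \<in> cball 0 \<rho>" for z w
  proof (cases "z = w")
    case False
    then have zw: "0 < cmod (z - w)" by simp
    have "2 * cmod (z - w) \<le> D" using that assms norm_triangle_ineq4[of z w] by simp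
    then have "2 \<le> D / cmod (z - w)" using zw by (simp add: field_simps)
    then show ?thesis using False by (auto simp: lker_def intro!: ennreal_leI)
  qed (simp add: lker_def)
  then have "(\<integral>\<^sup>+w. ennreal (ln 2) \<partial>\<mu>) \<le> lpot D \<mu> z" if "z \<in> cball 0 \<rho>" for z
    unfolding lpot_def using that by (intro nn_integral_mono_AE) (use AE in \<open>auto elim!: eventually_mono\<close>)
  then have "(\<integral>\<^sup>+z. ennreal (ln 2) \<partial>\<mu>) \<le> lenergy D \<mu> \<mu>"
    unfolding lenergy_def by (intro nn_integral_mono_AE) (use AE in \<open>auto elim!: eventually_mono simp: emeasure_space_1\<close>)
  then show ?thesis by (simp add: emeasure_space_1)
qed

lemma integral_complex_eq_Complex:
  fixes f :: "complex \<Rightarrow> complex"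
  assumes "borel_prob_on C \<mu>" "compact C" "continuous_on UNIV f"
  shows "(\<integral>z. f z \<partial>\<mu>) = Complex (\<integral>z. Re (f z) \<partial>\<mu>) (\<integral>z. Im (f z) \<partial>\<mu>)"
  using integrable_continuous[OF assms] by (simp add: complex_eq_iff)

theorem corollary2:
  fixes K :: "complex set" and q :: "nat \<Rightarrow> complex poly" and m :: nat
  assumes "compact K"
    and "\<not> polar K"
    and "polynomially_convex K"
    and "filterlim (\<lambda>k. degree (q k)) at_top sequentially"
    and "K_regular K q"
    and "centers_on q K"
  shows "weak_star_conv
           (\<lambda>k. equilibrium_measure (filled_julia ((pderiv ^^ m) (q k))))
           (equilibrium_measure K)"
proof -
  have K: "compact K" "connected (- K)" using assms(1,3) by (auto simp: polynomially_convex_def)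
  have Kb: "K \<in> sets borel" and Kc: "closed K" using K(1) by (auto intro: borel_compact compact_imp_closed)
  note deg = assms(4)
  obtain R1 where R1: "0 < R1" "K \<subseteq> ball 0 R1"
    and ul: "uniform_limit (- ball 0 R1) (\<lambda>k z. ln (cmod (poly (q k) z)) / real (degree (q k))) (green K) sequentially"
    using assms(5) unfolding K_regular_def by blast
  have K0: "K \<noteq> {}" using assms(6) unfolding centers_on_def by simp
  have "\<exists>N R. R > 0 \<and> (\<forall>k\<ge>N. {z. poly (q k) z = 0} \<subseteq> ball 0 R) \<and>
      (\<forall>L. closed L \<and> L \<inter> K = {} \<longrightarrow> (\<exists>M>0. \<forall>k\<ge>N. size {#z \<in># proots (q k). z \<in> L#} \<le> M))"
    using assms(6) unfolding centers_on_def by (elim conjE)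
  then obtain N R2 where R2: "0 < R2" and z2: "\<And>k. N \<le> k \<Longrightarrow> {z. poly (q k) z = 0} \<subseteq> ball 0 R2"
    and cent: "\<And>L. closed L \<and> L \<inter> K = {} \<longrightarrow> (\<exists>M>0. \<forall>k\<ge>N. size {#z \<in># proots (q k). z \<in> L#} \<le> M)"
    by (elim exE conjE) (rule that, auto)
  define R where "R = max R1 R2"
  have R: "0 < R" "K \<subseteq> ball 0 R" using R1 by (auto simp: R_def)
  have zeros: "{z. poly (q k) z = 0} \<subseteq> ball 0 R" if "N \<le> k" for k
    using z2[OF that] by (auto simp: R_def)

  \<comment> \<open>Equilibrium data of \<open>K\<close> and growth of the derivatives off
    \<open>K\<close>\<close>
  define D0 where "D0 = max (2 * R) 1"
  \<comment> \<open>A provisional kernel constant: the final one depends on the escape radius, which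
    in turn depends on \<open>I\<close>.\<close>
  have D0: "2 * R \<le> D0" "1 \<le> D0" by (auto simp: D0_def)
  have KR: "K \<subseteq> cball 0 R" using R by auto
  obtain \<nu> where \<nu>: "borel_prob_on K \<nu>" "lenergy D0 \<nu> \<nu> < \<infinity>"
    using nonpolar_finite_energy[OF D0 KR Kb assms(2)] by blast
  obtain \<omega> where \<omega>0: "min_energy D0 K \<omega>" using min_energy_exists[OF R(1) D0 KR Kc \<nu>] by blast
  have eqK: "equilibrium_measure K = \<omega>" by (rule equilibrium_measure_eqI[OF D0 KR Kb \<omega>0])
  have \<omega>K: "borel_prob_on K \<omega>" using \<omega>0 by (simp add: min_energy_def)
  define I where "I = ln D0 - enn2real (lenergy D0 \<omega> \<omega>)"
  define g where "g z = upot \<omega> z - I" for z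
  have green: "green K z = g z" if "z \<notin> K" for z
    using green_eq[OF D0 K(1) KR \<omega>0 that] by (simp add: g_def I_def)
  have lim: "(\<lambda>k. ln (cmod (poly (q k) z)) / real (degree (q k))) \<longlonglongrightarrow> upot \<omega> z - I" if "R \<le> cmod z" for z
  proof -
    have z: "z \<in> - ball 0 R1" "z \<notin> K" using that R by (auto simp: R_def)
    show ?thesis using tendsto_uniform_limitI[OF ul z(1)] unfolding green[OF z(2)] g_def .
  qed
  have cent': "\<exists>M. \<forall>k\<ge>N. size {#z \<in># proots (q k). z \<in> L#} \<le> M" if "closed L" "L \<inter> K = {}" for L
    using cent[of L] that by blast
  have lead0: "(\<lambda>k. ln (cmod (lead_coeff (q k))) / real (degree (q k))) \<longlonglongrightarrow> - I"
    by (rule zero_measure_limit(1)[OF K(1) K0 K(2) R(2,1) \<omega>K deg]) (rule lim zeros cent'; assumption)+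
  have pot0: "(\<lambda>k. tpot r (zero_measure (q k)) z) \<longlonglongrightarrow> upot \<omega> z" if "0 < r" "ball z r \<inter> K = {}" for z r
    by (rule zero_measure_limit(2)[OF K(1) K0 K(2) R(2,1) \<omega>K deg _ _ _ that]) (rule lim zeros cent'; assumption)+
  have zerosE: "\<forall>\<^sub>F k in sequentially. {z. poly (q k) z = 0} \<subseteq> ball 0 R"
    using eventually_ge_at_top[of N] by eventually_elim (rule zeros)
  have opK: "open (- K)" using Kc by blast
  have gc: "continuous_on (- K) g" unfolding g_def by (intro continuous_intros continuous_on_upot[OF \<omega>K K(1)])
  have nc: "\<exists>w\<in>ball z e. w \<in> - K \<and> g w \<noteq> g z" if "z \<in> - K" "0 < e" for z e
    using upot_nonconstant[OF \<omega>K K, of z e] that by (auto simp: g_def)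
  define p where "p k = (pderiv ^^ m) (q k)" for k
  have gr0: "growth (- K) q (\<lambda>k. degree (q k)) g"
    unfolding g_def by (rule growth_base[OF Kc deg zerosE lead0]) (rule pot0)
  have gr: "growth (- K) p (\<lambda>k. degree (q k)) g"
    unfolding p_def by (rule growth_higher_pderiv[OF gr0 opK gc _ deg]) (rule nc)
  have degp: "filterlim (\<lambda>k. degree (p k)) at_top sequentially"
    and lead: "(\<lambda>k. ln (cmod (lead_coeff (p k))) / real (degree (p k))) \<longlonglongrightarrow> - I"
    using lead_coeff_growth_higher_pderiv[OF deg lead0, of m] unfolding p_def by blast+
  have big: "\<forall>\<^sub>F k in sequentially. i \<le> degree (q k)" for i using deg unfolding filterlim_at_top by blast
  have zerosp: "\<forall>\<^sub>F k in sequentially. {z. poly (p k) z = 0} \<subseteq> ball 0 R"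
    using zerosE big[of m] unfolding p_def by eventually_elim (rule zeros_higher_pderiv_in_ball)

  \<comment> \<open>Escape radius and final kernel constant\<close>
  define c where "c = 2 * R + 4 * exp (I + 1)"
  define \<rho> where "\<rho> = c + 1"
  \<comment> \<open>Twice the diameter \<open>2 * \<rho>\<close>, so that
    \<open>lenergy_ge_ln2\<close> gives \<open>I < ln D\<close>; the quantities tending to
    \<open>I\<close> are then eventually below \<open>ln D\<close>.\<close>
  define D where "D = 4 * \<rho>"
  have c: "0 < c" "R \<le> c" using R exp_gt_zero[of "I + 1"] unfolding c_def by linarith+
  have \<rho>: "0 < \<rho>" "2 * \<rho> \<le> D" "1 \<le> D" "c < \<rho>" using c by (auto simp: \<rho>_def D_def)
  have K\<rho>: "K \<subseteq> cball 0 \<rho>" using KR c by (auto simp: \<rho>_def dest!: subsetD)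
  have \<omega>: "min_energy D K \<omega>"
  proof -
    obtain \<nu> where "borel_prob_on K \<nu>" "lenergy D \<nu> \<nu> < \<infinity>"
      using nonpolar_finite_energy[OF \<rho>(2,3) K\<rho> Kb assms(2)] by blast
    then obtain \<omega>' where \<omega>': "min_energy D K \<omega>'" using min_energy_exists[OF \<rho>(1,2,3) K\<rho> Kc] by blast
    then have "equilibrium_measure K = \<omega>'" by (rule equilibrium_measure_eqI[OF \<rho>(2,3) K\<rho> Kb])
    then show ?thesis using \<omega>' eqK by simp
  qed
  have ID: "I = ln D - enn2real (lenergy D \<omega> \<omega>)"
  proof -
    \<comment> \<open>The Green's function does not involve the kernel constant, so comparing its
      two expressions at one point off \<open>K\<close> shows that \<open>D0\<close> and
      \<open>D\<close> give the same \<open>I\<close>.\<close>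
    have "of_real (R + 1) \<notin> K" using KR R(1) by (auto dest!: subsetD)
    then show ?thesis using green_eq[OF \<rho>(2,3) K(1) K\<rho> \<omega>] green by (fastforce simp: g_def)
  qed
  have \<omega>b: "borel_prob_on (cball 0 \<rho>) \<omega>" by (rule borel_prob_on_mono[OF \<omega>K K\<rho> Kb]) simp
  obtain e where e: "lenergy D \<omega> \<omega> = ennreal e" "0 \<le> e"
    using \<omega> unfolding min_energy_def by (cases "lenergy D \<omega> \<omega>") auto
  have "ennreal (ln 2) \<le> ennreal e"
    using lenergy_ge_ln2[OF \<omega>b _ \<rho>(1), of D] e by (simp add: D_def)
  then have "ln 2 \<le> e" using e by simp
  moreover have Ie: "I = ln D - e" using ID e by simp
  moreover have "0 < ln (2::real)" by simp
  ultimately have IlD: "I < ln D" by linarith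

  \<comment> \<open>Asymptotics of the two energy bounds\<close>
  define a where "a k = ln (cmod (lead_coeff (p k)))" for k
  define n where "n k = real (degree (p k))" for k
  have rn: "filterlim n at_top sequentially"
    unfolding n_def using degp by (intro filterlim_compose[OF filterlim_real_sequentially])
  have al: "(\<lambda>k. a k / n k) \<longlonglongrightarrow> - I" using lead by (simp add: a_def n_def)
  have cl: "(\<lambda>k. ln c / n k) \<longlonglongrightarrow> 0"
    by (intro tendsto_divide_0[OF tendsto_const] filterlim_at_top_imp_at_infinity rn)
  have V0: "(\<lambda>k. (ln c - a k) / n k) \<longlonglongrightarrow> I"
    using tendsto_diff[OF cl al] by (simp add: diff_divide_distrib)
  have a1: "(\<lambda>k. a k / (n k - 1)) \<longlonglongrightarrow> - I"
  proof -
    have "((\<lambda>x::real. x / (x - 1)) \<longlongrightarrow> 1) at_top" by real_asymp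
    then have "(\<lambda>k. n k / (n k - 1)) \<longlonglongrightarrow> 1" using rn by (rule filterlim_compose)
    from tendsto_mult[OF this al] have "(\<lambda>k. n k / (n k - 1) * (a k / n k)) \<longlonglongrightarrow> - I" by simp
    moreover have "\<forall>\<^sub>F k in sequentially. n k / (n k - 1) * (a k / n k) = a k / (n k - 1)"
      using rn[unfolded filterlim_at_top, rule_format, of 1] by eventually_elim auto
    ultimately show ?thesis by (simp add: tendsto_cong)
  qed
  have "\<forall>\<^sub>F k in sequentially. 2 \<le> degree (p k) \<and> escape_radius (p k) c \<and> (ln c - a k) / n k \<le> ln D \<and>
      - ln D \<le> a k / (n k - 1) \<and> degree (q k) \<le> 2 * degree (p k)"
  proof -
    have "\<forall>\<^sub>F k in sequentially. 2 \<le> degree (p k)" using degp unfolding filterlim_at_top by blast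
    moreover have "\<forall>\<^sub>F k in sequentially. escape_radius (p k) c"
      unfolding c_def by (rule eventually_escape_radius[OF degp lead zerosp R(1)])
    moreover have "\<forall>\<^sub>F k in sequentially. (ln c - a k) / n k < ln D" using V0 IlD by (rule order_tendstoD)
    moreover have "\<forall>\<^sub>F k in sequentially. - ln D < a k / (n k - 1)" using a1 IlD by (intro order_tendstoD(1)) auto
    \<comment> \<open>Once the degree of \<open>q k\<close> is at least \<open>2 * m\<close>, taking
      \<open>m\<close> derivatives loses at most half of it.\<close>
    ultimately show ?thesis using big[of "2 * m"]
      by eventually_elim (auto simp: p_def degree_higher_pderiv)
  qed
  then obtain N' where N': "\<And>k. N' \<le> k \<Longrightarrow> 2 \<le> degree (p k)" "\<And>k. N' \<le> k \<Longrightarrow> escape_radius (p k) c"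
    "\<And>k. N' \<le> k \<Longrightarrow> (ln c - a k) / n k \<le> ln D" "\<And>k. N' \<le> k \<Longrightarrow> - ln D \<le> a k / (n k - 1)"
    "\<And>k. N' \<le> k \<Longrightarrow> degree (q k) \<le> 2 * degree (p k)"
    unfolding eventually_sequentially by blast

  \<comment> \<open>Julia and lemniscate measures for all sufficiently large indices\<close>
  have "\<exists>W. min_energy D (filled_julia (p (k + N'))) W \<and>
      lenergy D W W \<le> ennreal (ln D + a (k + N') / (n (k + N') - 1))" for k
    unfolding a_def n_def
    by (rule filled_julia_min_energy[OF \<rho>(1-3) N'(2) _ N'(1)]) (use \<rho> in auto)
  then obtain W where W: "\<And>k. min_energy D (filled_julia (p (k + N'))) (W k)"
    "\<And>k. lenergy D (W k) (W k) \<le> ennreal (ln D + a (k + N') / (n (k + N') - 1))" by metis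
  have "\<exists>\<kappa>. borel_prob_on (cball 0 c) \<kappa> \<and> lenergy D \<kappa> \<kappa> \<le> ennreal (ln D - (ln c - a (k + N')) / n (k + N')) \<and>
      (\<forall>z. cmod z < \<rho> \<longrightarrow> ennreal (ln D - lem_pot (p (k + N')) c z) \<le> lpot D \<kappa> z) \<and>
      (\<forall>z. cmod z \<le> \<rho> \<longrightarrow> c < cmod (poly (p (k + N')) z) \<longrightarrow> lpot D \<kappa> z \<le> ennreal (ln D - lem_pot (p (k + N')) c z))" for k
  proof -
    have er: "escape_radius (p (k + N')) c" and d2: "2 \<le> degree (p (k + N'))" using N' by auto
    have sub: "{z. cmod (poly (p (k + N')) z) \<le> c} \<subseteq> cball 0 c"
    proof
      fix z assume "z \<in> {z. cmod (poly (p (k + N')) z) \<le> c}"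
      then show "z \<in> cball 0 c" using er unfolding escape_radius_def by (cases "c \<le> cmod z") force+
    qed
    then have sub\<rho>: "{z. cmod (poly (p (k + N')) z) \<le> c} \<subseteq> cball 0 \<rho>" using \<rho>(4) by force
    have dp: "0 < degree (p (k + N'))" using d2 by simp
    obtain \<kappa> where \<kappa>: "borel_prob_on {z. cmod (poly (p (k + N')) z) = c} \<kappa>"
      "lenergy D \<kappa> \<kappa> \<le> ennreal (ln D - (ln c - ln (cmod (lead_coeff (p (k + N'))))) / real (degree (p (k + N'))))"
      "\<And>z. cmod z < \<rho> \<Longrightarrow> ennreal (ln D - lem_pot (p (k + N')) c z) \<le> lpot D \<kappa> z"
      "\<And>z. cmod z \<le> \<rho> \<Longrightarrow> c < cmod (poly (p (k + N')) z) \<Longrightarrow> lpot D \<kappa> z \<le> ennreal (ln D - lem_pot (p (k + N')) c z)"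
      by (rule lemniscate_measure[OF \<rho>(1-3) dp c(1) sub\<rho>]) (rule that)
    have "closed {z. cmod (poly (p (k + N')) z) = c}" by (intro closed_Collect_eq continuous_intros)
    then have "borel_prob_on (cball 0 c) \<kappa>"
      by (intro borel_prob_on_mono[OF \<kappa>(1)] borel_closed closed_cball) (use sub in auto)
    then show ?thesis using \<kappa>(2-4) unfolding a_def n_def by blast
  qed
  then obtain \<kappa> where \<kappa>c: "\<And>k. borel_prob_on (cball 0 c) (\<kappa> k)"
    and \<kappa>E: "\<And>k. lenergy D (\<kappa> k) (\<kappa> k) \<le> ennreal (ln D - (ln c - a (k + N')) / n (k + N'))"
    and \<kappa>up: "\<And>k z. cmod z < \<rho> \<Longrightarrow> ennreal (ln D - lem_pot (p (k + N')) c z) \<le> lpot D (\<kappa> k) z"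
    and \<kappa>low: "\<And>k z. cmod z \<le> \<rho> \<Longrightarrow> c < cmod (poly (p (k + N')) z) \<Longrightarrow> lpot D (\<kappa> k) z \<le> ennreal (ln D - lem_pot (p (k + N')) c z)"
    by metis
  have c\<rho>: "cball 0 c \<subseteq> cball (0::complex) \<rho>" using \<rho>(4) by auto
  have \<kappa>b: "borel_prob_on (cball 0 \<rho>) (\<kappa> k)" for k by (rule borel_prob_on_mono[OF \<kappa>c c\<rho>]) auto
  have WJ: "borel_prob_on (filled_julia (p (k + N'))) (W k)" for k using W(1) by (simp add: min_energy_def)
  have Jc: "closed (filled_julia (p (k + N')))" "filled_julia (p (k + N')) \<subseteq> cball 0 \<rho>" for k
    using closed_filled_julia(1,2)[OF N'(2)[of "k + N'"]] c\<rho> by auto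
  have Wb: "borel_prob_on (cball 0 \<rho>) (W k)" for k
    by (rule borel_prob_on_mono[OF WJ Jc(2)]) (use Jc in auto)
  have eqW: "equilibrium_measure (filled_julia (p (k + N'))) = W k" for k
    by (rule equilibrium_measure_eqI[OF \<rho>(2,3) Jc(2) borel_closed[OF Jc(1)] W(1)])
  have shift: "strict_mono (\<lambda>k. k + N')" by (simp add: strict_mono_def)
  have dist0: "(\<lambda>k. energy_dist (W k) (\<kappa> k)) \<longlonglongrightarrow> 0"
  proof (rule tendsto_sandwich[OF _ _ tendsto_const])
    show "\<forall>\<^sub>F k in sequentially. energy_dist (W k) (\<kappa> k) \<le> ennreal (a (k + N') / (n (k + N') - 1) + (ln c - a (k + N')) / n (k + N'))"
    proof (intro always_eventually allI)
      fix k
      show "energy_dist (W k) (\<kappa> k) \<le> ennreal (a (k + N') / (n (k + N') - 1) + (ln c - a (k + N')) / n (k + N'))"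
        unfolding a_def n_def
        by (rule energy_dist_julia_lemniscate[OF \<rho>(1-3) N'(2) \<rho>(4) N'(1) WJ _ \<kappa>b _ \<kappa>up])
           (use W(2)[of k] \<kappa>E[of k] N'(3,4)[of "k + N'"] in \<open>auto simp: a_def n_def\<close>)
    qed
    \<comment> \<open>The Julia bound contributes \<open>- I\<close> and the lemniscate bound
      \<open>I\<close>, so the distance between the two measures vanishes in the limit.\<close>
    have "(\<lambda>k. a (k + N') / (n (k + N') - 1) + (ln c - a (k + N')) / n (k + N')) \<longlonglongrightarrow> - I + I"
      by (intro tendsto_add LIMSEQ_ignore_initial_segment[OF a1] LIMSEQ_ignore_initial_segment[OF V0])
    then have "(\<lambda>k. ennreal (a (k + N') / (n (k + N') - 1) + (ln c - a (k + N')) / n (k + N'))) \<longlonglongrightarrow> ennreal (- I + I)"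
      by (rule tendsto_ennrealI)
    then show "(\<lambda>k. ennreal (a (k + N') / (n (k + N') - 1) + (ln c - a (k + N')) / n (k + N'))) \<longlonglongrightarrow> 0" by simp
  qed simp
  have mass: "\<exists>\<delta>>0. (\<lambda>k. measure (\<kappa> k) (ball z0 \<delta>)) \<longlonglongrightarrow> 0" if z0: "z0 \<notin> K" "I < upot \<omega> z0" "cmod z0 < \<rho>" for z0
  proof (rule exterior_mass_tendsto_0[OF K(1) \<omega>K _ _ _ \<rho>(1,2) c(1) \<kappa>b \<kappa>up \<kappa>low z0(1) _ z0(3)])
    show "growth (- K) (\<lambda>k. p (k + N')) (\<lambda>k. degree (q (k + N'))) (\<lambda>z. upot \<omega> z - I)"
      using growth_subseq[OF gr shift] by (simp add: g_def[abs_def])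
    show "filterlim (\<lambda>k. degree (q (k + N'))) at_top sequentially"
      by (rule filterlim_compose[OF deg filterlim_subseq[OF shift]])
    show "\<forall>\<^sub>F k in sequentially. 0 < degree (p (k + N')) \<and> degree (q (k + N')) \<le> 2 * degree (p (k + N'))"
    proof (rule always_eventually, rule allI)
      fix k
      show "0 < degree (p (k + N')) \<and> degree (q (k + N')) \<le> 2 * degree (p (k + N'))"
        using N'(1)[of "k + N'"] N'(5)[of "k + N'"] by simp
    qed
    show "0 < upot \<omega> z0 - I" using z0 by simp
  qed

  \<comment> \<open>Identification of the subsequential limits\<close>
  have limit: "\<exists>r. strict_mono r \<and> weak_lim (W \<circ> s \<circ> r) \<omega>" if s: "strict_mono s" for s :: "nat \<Rightarrow> nat"
  proof -
    have b1: "borel_prob_on (cball 0 \<rho>) ((\<kappa> \<circ> s) k)" for k using \<kappa>b by simp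
    obtain r1 \<sigma> where r1: "strict_mono r1" and \<sigma>: "borel_prob_on (cball 0 \<rho>) \<sigma>" and l1: "weak_lim (\<kappa> \<circ> s \<circ> r1) \<sigma>"
      using weak_compactness[of \<rho> "\<kappa> \<circ> s", OF \<rho>(1) b1] by (elim exE conjE) (rule that)
    have b2: "borel_prob_on (cball 0 \<rho>) ((W \<circ> s \<circ> r1) k)" for k using Wb by simp
    obtain r2 \<tau> where r2: "strict_mono r2" and \<tau>: "borel_prob_on (cball 0 \<rho>) \<tau>" and l2: "weak_lim (W \<circ> s \<circ> r1 \<circ> r2) \<tau>"
      using weak_compactness[of \<rho> "W \<circ> s \<circ> r1", OF \<rho>(1) b2] by (elim exE conjE) (rule that)
    define t where "t = s \<circ> r1 \<circ> r2"
    have t: "strict_mono t" unfolding t_def by (intro strict_mono_o s r1 r2)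
    have lt: "weak_lim (\<kappa> \<circ> t) \<sigma>" "weak_lim (W \<circ> t) \<tau>"
      using weak_lim_subseq[OF l1 r2] l2 by (simp_all add: t_def comp_assoc)
    have "\<tau> = \<sigma>"
      by (rule energy_dist_tendsto_0_imp_eq[OF _ _ \<tau> \<sigma> lt(2,1)])
         (use Wb \<kappa>b LIMSEQ_subseq_LIMSEQ[OF dist0 t] in \<open>auto simp: o_def\<close>)
    moreover have "\<sigma> = \<omega>"
    proof (rule equilibrium_limit_unique[OF \<rho>(2,3) K(1) K\<rho> \<omega> ID \<sigma>])
      have "lenergy D \<sigma> \<sigma> \<le> ennreal (e + 1 / real (Suc i))" for i
      proof (rule lenergy_lsc_self[OF \<rho>(1-3) _ \<sigma> lt(1)])
        show "borel_prob_on (cball 0 \<rho>) ((\<kappa> \<circ> t) k)" for k using \<kappa>b by simp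
        have "(\<lambda>k. ln D - (ln c - a (t k + N')) / n (t k + N')) \<longlonglongrightarrow> ln D - I"
          using LIMSEQ_subseq_LIMSEQ[OF LIMSEQ_ignore_initial_segment[OF V0, of N'] t]
          by (intro tendsto_diff tendsto_const) (simp add: o_def)
        then have "\<forall>\<^sub>F k in sequentially. ln D - (ln c - a (t k + N')) / n (t k + N') < e + 1 / real (Suc i)"
          by (rule order_tendstoD(2)) (use ID e in simp)
        then show "\<forall>\<^sub>F k in sequentially. lenergy D ((\<kappa> \<circ> t) k) ((\<kappa> \<circ> t) k) \<le> ennreal (e + 1 / real (Suc i))"
        proof eventually_elim
          case (elim k)
          show ?case unfolding o_def by (rule order_trans[OF \<kappa>E ennreal_leI]) (use elim in simp)
        qed
      qed
      moreover have "(\<lambda>i. ennreal (e + 1 / real (Suc i))) \<longlonglongrightarrow> ennreal (e + 0)"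
        by (intro tendsto_ennrealI tendsto_add tendsto_const lim_1_over_n[THEN LIMSEQ_Suc])
      ultimately show "lenergy D \<sigma> \<sigma> \<le> lenergy D \<omega> \<omega>"
        unfolding e(1) by (intro LIMSEQ_le_const[of "\<lambda>i. ennreal (e + 1 / real (Suc i))"]) auto
      \<comment> \<open>Each point of the exterior set where the potential exceeds \<open>I\<close>
        has a ball that is null for \<open>\<sigma>\<close>; by Lindelof countably many of these
        balls cover the set.\<close>
      define X where "X = {z. z \<notin> K \<and> I < upot \<omega> z \<and> cmod z < \<rho>}"
      have "\<forall>z\<in>X. \<exists>\<delta>. 0 < \<delta> \<and> (\<lambda>k. measure (\<kappa> k) (ball z \<delta>)) \<longlonglongrightarrow> 0" using mass by (auto simp: X_def)
      from bchoice[OF this] obtain \<delta> where \<delta>: "\<And>z. z \<in> X \<Longrightarrow> 0 < \<delta> z"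
        "\<And>z. z \<in> X \<Longrightarrow> (\<lambda>k. measure (\<kappa> k) (ball z (\<delta> z))) \<longlonglongrightarrow> 0" by blast
      obtain F where F: "F \<subseteq> (\<lambda>z. ball z (\<delta> z)) ` X" "countable F" "\<Union>F = \<Union>((\<lambda>z. ball z (\<delta> z)) ` X)"
        using Lindelof[of "(\<lambda>z. ball z (\<delta> z)) ` X"] by auto
      have "AE w in \<sigma>. w \<notin> B" if B: "B \<in> F" for B
      proof -
        obtain z where z: "z \<in> X" "B = ball z (\<delta> z)" using F(1) B by auto
        have "(\<lambda>k. measure ((\<kappa> \<circ> t) k) (ball z (\<delta> z))) \<longlonglongrightarrow> 0"
          using LIMSEQ_subseq_LIMSEQ[OF \<delta>(2)[OF z(1)] t] by (simp add: o_def)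
        then show ?thesis unfolding z(2)
          by (intro weak_lim_null_ball[OF lt(1) \<sigma> _ _ \<delta>(1)[OF z(1)]]) (use \<kappa>b in auto)
      qed
      then have "AE w in \<sigma>. \<forall>B\<in>F. w \<notin> B" using F(2) by (simp add: AE_ball_countable)
      \<comment> \<open>The mass estimate is available only for \<open>|z| < \<rho>\<close>. Since
        \<open>c < \<rho>\<close>, the limit measure does not reach the boundary circle.\<close>
      moreover have "borel_prob_on (cball 0 c) \<sigma>"
        by (rule weak_lim_support[OF lt(1) \<sigma>]) (use \<kappa>c c in auto)
      then have "AE w in \<sigma>. w \<in> cball 0 c" by (rule borel_prob_on_AE) simp
      ultimately show "AE z in \<sigma>. z \<notin> K \<longrightarrow> upot \<omega> z \<le> I"
      proof eventually_elim
        case (elim w)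
        have "w \<notin> X"
        proof
          assume w: "w \<in> X"
          then have "w \<in> \<Union>((\<lambda>z. ball z (\<delta> z)) ` X)" using \<delta>(1) by force
          then show False using elim F(3) by blast
        qed
        then show ?case using elim \<rho>(4) by (auto simp: X_def not_less)
      qed
    qed
    ultimately show ?thesis using lt(2) r1 r2 by (intro exI[of _ "r1 \<circ> r2"]) (simp add: t_def comp_assoc strict_mono_o)
  qed
  show ?thesis
    unfolding weak_star_conv_def eqK
  proof (intro allI impI)
    fix f :: "complex \<Rightarrow> complex" assume f: "continuous_on UNIV f \<and> compact (closure {z. f z \<noteq> 0})"
    then have fc: "continuous_on UNIV f" by simp
    have "(\<lambda>k. \<integral>z. f z \<partial>W k) \<longlonglongrightarrow> (\<integral>z. f z \<partial>\<omega>)"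
    proof (rule tendsto_by_subsequences)
      fix s :: "nat \<Rightarrow> nat" assume "strict_mono s"
      from limit[OF this] obtain r where r: "strict_mono r" "weak_lim (W \<circ> s \<circ> r) \<omega>" by blast
      have "(\<lambda>k. \<integral>z. f z \<partial>(W \<circ> s \<circ> r) k) \<longlonglongrightarrow> (\<integral>z. f z \<partial>\<omega>)"
        unfolding integral_complex_eq_Complex[OF \<omega>b compact_cball fc] o_def integral_complex_eq_Complex[OF Wb compact_cball fc]
        using r(2) by (intro tendsto_Complex) (auto simp: weak_lim_def o_def intro!: continuous_intros fc)
      then show "\<exists>r. strict_mono r \<and> ((\<lambda>k. \<integral>z. f z \<partial>W k) \<circ> s \<circ> r) \<longlonglongrightarrow> (\<integral>z. f z \<partial>\<omega>)"
        using r(1) by (auto simp: o_def)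
    qed
    then have "(\<lambda>k. \<integral>z. f z \<partial>equilibrium_measure (filled_julia (p (k + N')))) \<longlonglongrightarrow> (\<integral>z. f z \<partial>\<omega>)"
      unfolding eqW .
    \<comment> \<open>The shift by \<open>N'\<close> is undone here; the finitely many skipped
      terms, where no equilibrium measure was identified, do not affect the limit.\<close>
    then show "(\<lambda>k. \<integral>z. f z \<partial>equilibrium_measure (filled_julia ((pderiv ^^ m) (q k)))) \<longlonglongrightarrow> (\<integral>z. f z \<partial>\<omega>)"
      unfolding p_def by (rule LIMSEQ_offset)
  qed
qed

end
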